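(* (1) Assume $\mathsf{ZF} + \mathsf{AD}$. Suppose $X \subseteq [\omega_1]^{<\omega_1}$ and $\omega_1$ injects into $X$. Then there is a sequence $\langle E_\alpha : \alpha < \omega_1\rangle$ of weakly smooth equivalence relations on $\mathbb{R}$ such that $X$ is in bijection with $\bigsqcup_{\alpha < \omega_1} \mathbb{R}/E_\alpha$. (2) Assume $\mathsf{ZF} + \mathsf{AD}^+ + V = L(\mathscr{P}(\mathbb{R}))$. Suppose $X \subseteq [\omega_1]^{<\omega_1}$ and $\mathbb{R} \sqcup \omega_1$ injects into $X$. Then there is a sequence $\langle E_\alpha : \alpha < \omega_1\rangle$ of smooth equivalence relations on $\mathbb{R}$ such that $X$ is in bijection with $\bigsqcup_{\alpha < \omega_1} \mathbb{R}/E_\alpha$. (3) Consequently, assuming $\mathsf{ZF} + \mathsf{AD}^+ + V = L(\mathscr{P}(\mathbb{R}))$, a set $X \subseteq [\omega_1]^{<\omega_1}$ admits a sequence $\langle E_\alpha : \alpha < \omega_1\rangle$ of smooth equivalence relations on $\mathbb{R}$ with $X$ in bijection with $\bigsqcup_{\alpha<\omega_1}\mathbb{R}/E_\alpha$ if and only if $\mathbb{R} \sqcup \omega_1$ injects into $X$.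
   Context: $[\omega_1]^{<\omega_1}$ denotes the set of strictly increasing functions from a countable ordinal into $\omega_1$ (equivalently, countable subsets of $\omega_1$). An equivalence relation $E$ on $\mathbb{R}$ is smooth if $\mathbb{R}/E$ is in bijection with $\mathbb{R}$, and weakly smooth if $\mathbb{R}/E$ injects into $\mathbb{R}$. $\bigsqcup_{\alpha<\omega_1} \mathbb{R}/E_\alpha$ denotes the formal disjoint union $\{(\alpha, c) : \alpha < \omega_1,\ c \in \mathbb{R}/E_\alpha\}$, and $\mathbb{R}\sqcup\omega_1$ the formal disjoint union of $\mathbb{R}$ and $\omega_1$. $\mathsf{AD}^+$ is the conjunction of: (1) $\mathsf{DC}_{\mathbb{R}}$; (2) every $A \subseteq \mathbb{R}$ has an $\infty$-Borel code, i.e. there are a set of ordinals $S$ and a formula $\varphi$ with $A = \{x \in \mathbb{R} : L[S,x] \models \varphi(S,x)\}$; (3) for every $\lambda < \Theta$ (the least ordinal which is not a surjective image of $\mathbb{R}$), every $A \subseteq \mathbb{R}$ and every continuous $\pi : {}^\omega\lambda \to \mathbb{R}$, the set $\pi^{-1}[A]$ is determined. *)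

theory Defs
  imports Main
begin

text \<open>
  Isabelle/HOL proves the axiom of choice, which contradicts AD. Hence ``assume ZF + AD'' is
  rendered semantically: the results are about an arbitrary first-order structure
  \<open>('v, mem)\<close> satisfying the ZF axioms, with Separation and Replacement as schemas over
  first-order formulas. All set-theoretic notions below are evaluated inside that structure:
  sets, functions, strategies, sequences etc. are elements of \<open>'v\<close>. By Goedel's completeness
  theorem, validity in all such structures is provability in the theory.
\<close>

datatype fm = Mem nat nat | Eq nat nat | Neg fm | And fm fm | All nat fm

primrec fv :: "fm \<Rightarrow> nat set" where
  "fv (Mem i j) = {i, j}"
| "fv (Eq i j) = {i, j}"
| "fv (Neg p) = fv p"
| "fv (And p q) = fv p \<union> fv q"
| "fv (All i p) = fv p - {i}"

primrec sat :: "'v set \<Rightarrow> ('v \<Rightarrow> 'v \<Rightarrow> bool) \<Rightarrow> (nat \<Rightarrow> 'v) \<Rightarrow> fm \<Rightarrow> bool" where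
  "sat D m s (Mem i j) \<longleftrightarrow> m (s i) (s j)"
| "sat D m s (Eq i j) \<longleftrightarrow> s i = s j"
| "sat D m s (Neg p) \<longleftrightarrow> \<not> sat D m s p"
| "sat D m s (And p q) \<longleftrightarrow> sat D m s p \<and> sat D m s q"
| "sat D m s (All i p) \<longleftrightarrow> (\<forall>x\<in>D. sat D m (s(i := x)) p)"

locale eps_structure =
  fixes mem :: "'v \<Rightarrow> 'v \<Rightarrow> bool" (infix \<open>\<epsilon>\<close> 50)
begin

definition extensionality :: bool where
  "extensionality \<longleftrightarrow> (\<forall>a b. (\<forall>x. x \<epsilon> a \<longleftrightarrow> x \<epsilon> b) \<longrightarrow> a = b)"

definition foundation :: bool where
  "foundation \<longleftrightarrow> (\<forall>a. (\<exists>x. x \<epsilon> a) \<longrightarrow> (\<exists>x. x \<epsilon> a \<and> \<not> (\<exists>y. y \<epsilon> x \<and> y \<epsilon> a)))"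

definition pairing :: bool where
  "pairing \<longleftrightarrow> (\<forall>a b. \<exists>c. \<forall>x. x \<epsilon> c \<longleftrightarrow> x = a \<or> x = b)"

definition union_axiom :: bool where
  "union_axiom \<longleftrightarrow> (\<forall>a. \<exists>u. \<forall>x. x \<epsilon> u \<longleftrightarrow> (\<exists>y. y \<epsilon> a \<and> x \<epsilon> y))"

definition power_set_axiom :: bool where
  "power_set_axiom \<longleftrightarrow> (\<forall>a. \<exists>p. \<forall>x. x \<epsilon> p \<longleftrightarrow> (\<forall>y. y \<epsilon> x \<longrightarrow> y \<epsilon> a))"

definition infinity :: bool where
  "infinity \<longleftrightarrow> (\<exists>w. (\<exists>z. z \<epsilon> w \<and> (\<forall>u. \<not> u \<epsilon> z)) \<and>
     (\<forall>x. x \<epsilon> w \<longrightarrow> (\<exists>y. y \<epsilon> w \<and> (\<forall>u. u \<epsilon> y \<longleftrightarrow> u \<epsilon> x \<or> u = x))))"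

definition separation :: bool where
  "separation \<longleftrightarrow> (\<forall>p s a. \<exists>b. \<forall>x. x \<epsilon> b \<longleftrightarrow> x \<epsilon> a \<and> sat UNIV mem (s(0 := x)) p)"

definition replacement :: bool where
  "replacement \<longleftrightarrow> (\<forall>p s a.
     (\<forall>x y z. x \<epsilon> a \<longrightarrow> sat UNIV mem (s(0 := x, 1 := y)) p \<longrightarrow>
        sat UNIV mem (s(0 := x, 1 := z)) p \<longrightarrow> y = z) \<longrightarrow>
     (\<exists>b. \<forall>y. y \<epsilon> b \<longleftrightarrow> (\<exists>x. x \<epsilon> a \<and> sat UNIV mem (s(0 := x, 1 := y)) p)))"

definition ZF :: bool where
  "ZF \<longleftrightarrow> extensionality \<and> foundation \<and> pairing \<and> union_axiom \<and> power_set_axiom \<and>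
     infinity \<and> separation \<and> replacement"

text \<open>The element with the given extension; used only where ZF provides such an element.\<close>
definition set_of :: "('v \<Rightarrow> bool) \<Rightarrow> 'v" (binder \<open>SET \<close> 10) where
  "set_of P = (THE a. \<forall>x. x \<epsilon> a \<longleftrightarrow> P x)"

definition subset :: "'v \<Rightarrow> 'v \<Rightarrow> bool" where
  "subset a b \<longleftrightarrow> (\<forall>x. x \<epsilon> a \<longrightarrow> x \<epsilon> b)"

definition empty :: 'v where
  "empty = (SET x. False)"

definition upair :: "'v \<Rightarrow> 'v \<Rightarrow> 'v" where
  "upair a b = (SET x. x = a \<or> x = b)"

definition opair :: "'v \<Rightarrow> 'v \<Rightarrow> 'v" where
  "opair a b = upair (upair a a) (upair a b)"

definition suc :: "'v \<Rightarrow> 'v" where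
  "suc a = (SET x. x \<epsilon> a \<or> x = a)"

definition power_set :: "'v \<Rightarrow> 'v" where
  "power_set a = (SET x. subset x a)"

definition fun_on :: "'v \<Rightarrow> 'v \<Rightarrow> bool" where
  "fun_on f A \<longleftrightarrow> (\<forall>p. p \<epsilon> f \<longrightarrow> (\<exists>x y. x \<epsilon> A \<and> p = opair x y)) \<and>
     (\<forall>x. x \<epsilon> A \<longrightarrow> (\<exists>!y. opair x y \<epsilon> f))"

definition app :: "'v \<Rightarrow> 'v \<Rightarrow> 'v" where
  "app f x = (THE y. opair x y \<epsilon> f)"

definition maps :: "'v \<Rightarrow> 'v \<Rightarrow> 'v \<Rightarrow> bool" where
  "maps f A B \<longleftrightarrow> fun_on f A \<and> (\<forall>x. x \<epsilon> A \<longrightarrow> app f x \<epsilon> B)"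

definition fun_space :: "'v \<Rightarrow> 'v \<Rightarrow> 'v" where
  "fun_space A B = (SET f. maps f A B)"

definition restr :: "'v \<Rightarrow> 'v \<Rightarrow> 'v" where
  "restr f A = (SET p. p \<epsilon> f \<and> (\<exists>x y. x \<epsilon> A \<and> p = opair x y))"

definition inj_from_to :: "'v \<Rightarrow> 'v \<Rightarrow> 'v \<Rightarrow> bool" where
  "inj_from_to f A B \<longleftrightarrow> maps f A B \<and>
     (\<forall>x y. x \<epsilon> A \<longrightarrow> y \<epsilon> A \<longrightarrow> app f x = app f y \<longrightarrow> x = y)"

definition surj_from_to :: "'v \<Rightarrow> 'v \<Rightarrow> 'v \<Rightarrow> bool" where
  "surj_from_to f A B \<longleftrightarrow> maps f A B \<and> (\<forall>y. y \<epsilon> B \<longrightarrow> (\<exists>x. x \<epsilon> A \<and> app f x = y))"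

definition injects :: "'v \<Rightarrow> 'v \<Rightarrow> bool" where
  "injects A B \<longleftrightarrow> (\<exists>f. inj_from_to f A B)"

definition in_bijection :: "'v \<Rightarrow> 'v \<Rightarrow> bool" where
  "in_bijection A B \<longleftrightarrow> (\<exists>f. inj_from_to f A B \<and> surj_from_to f A B)"

definition transitive :: "'v \<Rightarrow> bool" where
  "transitive a \<longleftrightarrow> (\<forall>x. x \<epsilon> a \<longrightarrow> subset x a)"

definition ordinal :: "'v \<Rightarrow> bool" where
  "ordinal a \<longleftrightarrow> transitive a \<and> (\<forall>x. x \<epsilon> a \<longrightarrow> transitive x)"

definition zero_or_suc :: "'v \<Rightarrow> bool" where
  "zero_or_suc a \<longleftrightarrow> a = empty \<or> (\<exists>b. a = suc b)"

definition limit_ordinal :: "'v \<Rightarrow> bool" where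
  "limit_ordinal a \<longleftrightarrow> ordinal a \<and> \<not> zero_or_suc a"

definition omega :: 'v where
  "omega = (SET n. ordinal n \<and> zero_or_suc n \<and> (\<forall>k. k \<epsilon> n \<longrightarrow> zero_or_suc k))"

definition omega1 :: 'v where
  "omega1 = (SET a. ordinal a \<and> injects a omega)"

definition reals :: 'v where
  "reals = fun_space omega omega"

text \<open>For \<open>n\<close> in \<open>omega\<close>; \<open>e\<close> alternates along \<open>0, \<dots>, n\<close> starting with \<open>0\<close> inside \<open>e\<close>.\<close>
definition even_nat :: "'v \<Rightarrow> bool" where
  "even_nat n \<longleftrightarrow> (\<exists>e. empty \<epsilon> e \<and> (\<forall>k. k \<epsilon> n \<longrightarrow> (suc k \<epsilon> e \<longleftrightarrow> \<not> k \<epsilon> e)) \<and> n \<epsilon> e)"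

definition even_positions :: "'v \<Rightarrow> 'v" where
  "even_positions A = (SET s. \<exists>n. n \<epsilon> omega \<and> even_nat n \<and> maps s n A)"

definition odd_positions :: "'v \<Rightarrow> 'v" where
  "odd_positions A = (SET s. \<exists>n. n \<epsilon> omega \<and> \<not> even_nat n \<and> maps s n A)"

definition I_wins :: "'v \<Rightarrow> 'v \<Rightarrow> bool" where
  "I_wins A Z \<longleftrightarrow> (\<exists>\<sigma>. maps \<sigma> (even_positions A) A \<and>
     (\<forall>f. maps f omega A \<longrightarrow>
        (\<forall>n. n \<epsilon> omega \<longrightarrow> even_nat n \<longrightarrow> app f n = app \<sigma> (restr f n)) \<longrightarrow> f \<epsilon> Z))"

definition II_wins :: "'v \<Rightarrow> 'v \<Rightarrow> bool" where
  "II_wins A Z \<longleftrightarrow> (\<exists>\<tau>. maps \<tau> (odd_positions A) A \<and>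
     (\<forall>f. maps f omega A \<longrightarrow>
        (\<forall>n. n \<epsilon> omega \<longrightarrow> \<not> even_nat n \<longrightarrow> app f n = app \<tau> (restr f n)) \<longrightarrow> \<not> f \<epsilon> Z))"

text \<open>The game of length omega with moves in \<open>A\<close> and payoff set \<open>Z\<close> for player I.\<close>
definition determined :: "'v \<Rightarrow> 'v \<Rightarrow> bool" where
  "determined A Z \<longleftrightarrow> I_wins A Z \<or> II_wins A Z"

definition AD :: bool where
  "AD \<longleftrightarrow> (\<forall>Z. subset Z reals \<longrightarrow> determined omega Z)"

text \<open>
  The inductive closure conditions of the family of all pairs \<open>(n, R)\<close> such that \<open>R\<close> is an
  \<open>n\<close>-ary relation first-order definable without parameters over
  \<open>(A, \<in>, P \<inter> A, Q \<inter> A)\<close>: atomic formulas, negation, conjunction, and existential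
  quantification over the last variable (cf. Kunen, Set Theory, Chapter VI).
\<close>
definition definability_closed :: "'v \<Rightarrow> 'v \<Rightarrow> 'v \<Rightarrow> 'v \<Rightarrow> bool" where
  "definability_closed P Q A D \<longleftrightarrow>
     (\<forall>n i j. n \<epsilon> omega \<longrightarrow> i \<epsilon> n \<longrightarrow> j \<epsilon> n \<longrightarrow>
        opair n (SET s. maps s n A \<and> app s i \<epsilon> app s j) \<epsilon> D \<and>
        opair n (SET s. maps s n A \<and> app s i = app s j) \<epsilon> D \<and>
        opair n (SET s. maps s n A \<and> app s i \<epsilon> P) \<epsilon> D \<and>
        opair n (SET s. maps s n A \<and> app s i \<epsilon> Q) \<epsilon> D) \<and>
     (\<forall>n R. n \<epsilon> omega \<longrightarrow> opair n R \<epsilon> D \<longrightarrow>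
        opair n (SET s. maps s n A \<and> \<not> s \<epsilon> R) \<epsilon> D) \<and>
     (\<forall>n R R'. n \<epsilon> omega \<longrightarrow> opair n R \<epsilon> D \<longrightarrow> opair n R' \<epsilon> D \<longrightarrow>
        opair n (SET s. s \<epsilon> R \<and> s \<epsilon> R') \<epsilon> D) \<and>
     (\<forall>n R. n \<epsilon> omega \<longrightarrow> opair (suc n) R \<epsilon> D \<longrightarrow>
        opair n (SET s. maps s n A \<and> (\<exists>t. t \<epsilon> R \<and> restr t n = s)) \<epsilon> D)"

definition definable_relation :: "'v \<Rightarrow> 'v \<Rightarrow> 'v \<Rightarrow> 'v \<Rightarrow> 'v \<Rightarrow> bool" where
  "definable_relation P Q A n R \<longleftrightarrow> (\<forall>D. definability_closed P Q A D \<longrightarrow> opair n R \<epsilon> D)"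

text \<open>The set of subsets of \<open>A\<close> definable with parameters over \<open>(A, \<in>, P \<inter> A, Q \<inter> A)\<close>.\<close>
definition Def :: "'v \<Rightarrow> 'v \<Rightarrow> 'v \<Rightarrow> 'v" where
  "Def P Q A = (SET X. \<exists>n s R. n \<epsilon> omega \<and> maps s n A \<and> definable_relation P Q A (suc n) R \<and>
     X = (SET a. a \<epsilon> A \<and> (SET p. p \<epsilon> s \<or> p = opair n a) \<epsilon> R))"

text \<open>\<open>F\<close> lists the levels up to \<open>a\<close> of the hierarchy that starts with \<open>B\<close> and iterates \<open>Def P Q\<close>.\<close>
definition constructible_levels :: "'v \<Rightarrow> 'v \<Rightarrow> 'v \<Rightarrow> 'v \<Rightarrow> 'v \<Rightarrow> bool" where
  "constructible_levels B P Q a F \<longleftrightarrow> ordinal a \<and> fun_on F (suc a) \<and> app F empty = B \<and>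
     (\<forall>b. b \<epsilon> a \<longrightarrow> app F (suc b) = Def P Q (app F b)) \<and>
     (\<forall>b. b \<epsilon> suc a \<longrightarrow> limit_ordinal b \<longrightarrow>
        app F b = (SET x. \<exists>c. c \<epsilon> b \<and> x \<epsilon> app F c))"

definition constructible :: "'v \<Rightarrow> 'v \<Rightarrow> 'v \<Rightarrow> 'v \<Rightarrow> bool" where
  "constructible B P Q y \<longleftrightarrow> (\<exists>a F. constructible_levels B P Q a F \<and> y \<epsilon> app F a)"

text \<open>The class \<open>L[S, x]\<close>.\<close>
definition L_rel :: "'v \<Rightarrow> 'v \<Rightarrow> 'v set" where
  "L_rel S x = {y. constructible empty S x y}"

text \<open>The transitive closure of \<open>{A}\<close>.\<close>
definition trcl_singleton :: "'v \<Rightarrow> 'v" where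
  "trcl_singleton A = (SET y. \<forall>T. transitive T \<longrightarrow> A \<epsilon> T \<longrightarrow> y \<epsilon> T)"

text \<open>The class \<open>L(A)\<close>; the empty predicates add nothing to definability.\<close>
definition L_over :: "'v \<Rightarrow> 'v set" where
  "L_over A = {y. constructible (trcl_singleton A) empty empty y}"

definition V_eq_L_power_reals :: bool where
  "V_eq_L_power_reals \<longleftrightarrow> L_over (power_set reals) = UNIV"

definition DC_reals :: bool where
  "DC_reals \<longleftrightarrow> (\<forall>R. (\<forall>x. x \<epsilon> reals \<longrightarrow> (\<exists>y. y \<epsilon> reals \<and> opair x y \<epsilon> R)) \<longrightarrow>
     (\<exists>f. maps f omega reals \<and> (\<forall>n. n \<epsilon> omega \<longrightarrow> opair (app f n) (app f (suc n)) \<epsilon> R)))"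

definition infinity_Borel_code :: "'v \<Rightarrow> fm \<Rightarrow> 'v \<Rightarrow> bool" where
  "infinity_Borel_code S p A \<longleftrightarrow> (\<forall>a. a \<epsilon> S \<longrightarrow> ordinal a) \<and> fv p \<subseteq> {0, 1} \<and>
     (\<forall>x. x \<epsilon> A \<longleftrightarrow> x \<epsilon> reals \<and> sat (L_rel S x) mem ((\<lambda>_. empty)(0 := S, 1 := x)) p)"

text \<open>Nonzero is required because \<open>0\<close>, too, is not a surjective image of the reals.\<close>
definition is_Theta :: "'v \<Rightarrow> bool" where
  "is_Theta t \<longleftrightarrow> ordinal t \<and> t \<noteq> empty \<and> \<not> (\<exists>f. surj_from_to f reals t) \<and>
     (\<forall>b. b \<epsilon> t \<longrightarrow> b \<noteq> empty \<longrightarrow> (\<exists>f. surj_from_to f reals b))"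

text \<open>Continuity for the products of the discrete topologies on \<open>l\<close> and on \<open>omega\<close>.\<close>
definition continuous_to_reals :: "'v \<Rightarrow> 'v \<Rightarrow> bool" where
  "continuous_to_reals l h \<longleftrightarrow> maps h (fun_space omega l) reals \<and>
     (\<forall>f n. maps f omega l \<longrightarrow> n \<epsilon> omega \<longrightarrow>
        (\<exists>m. m \<epsilon> omega \<and> (\<forall>g. maps g omega l \<longrightarrow> restr g m = restr f m \<longrightarrow>
           restr (app h g) n = restr (app h f) n)))"

definition ordinal_determinacy :: bool where
  "ordinal_determinacy \<longleftrightarrow> (\<forall>t l A h. is_Theta t \<longrightarrow> l \<epsilon> t \<longrightarrow> subset A reals \<longrightarrow>
     continuous_to_reals l h \<longrightarrow> determined l (SET f. maps f omega l \<and> app h f \<epsilon> A))"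

definition AD_plus :: bool where
  "AD_plus \<longleftrightarrow> DC_reals \<and>
     (\<forall>A. subset A reals \<longrightarrow> (\<exists>S p. infinity_Borel_code S p A)) \<and>
     ordinal_determinacy"

definition equivalence_on_reals :: "'v \<Rightarrow> bool" where
  "equivalence_on_reals E \<longleftrightarrow>
     (\<forall>p. p \<epsilon> E \<longrightarrow> (\<exists>x y. x \<epsilon> reals \<and> y \<epsilon> reals \<and> p = opair x y)) \<and>
     (\<forall>x. x \<epsilon> reals \<longrightarrow> opair x x \<epsilon> E) \<and>
     (\<forall>x y. opair x y \<epsilon> E \<longrightarrow> opair y x \<epsilon> E) \<and>
     (\<forall>x y z. opair x y \<epsilon> E \<longrightarrow> opair y z \<epsilon> E \<longrightarrow> opair x z \<epsilon> E)"

definition reals_quotient :: "'v \<Rightarrow> 'v" where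
  "reals_quotient E = (SET c. \<exists>x. x \<epsilon> reals \<and> c = (SET y. opair x y \<epsilon> E))"

definition smooth :: "'v \<Rightarrow> bool" where
  "smooth E \<longleftrightarrow> equivalence_on_reals E \<and> in_bijection (reals_quotient E) reals"

definition weakly_smooth :: "'v \<Rightarrow> bool" where
  "weakly_smooth E \<longleftrightarrow> equivalence_on_reals E \<and> injects (reals_quotient E) reals"

text \<open>For a function \<open>E\<close> on \<open>omega1\<close>, the disjoint union of the quotients of the reals by \<open>E(a)\<close>.\<close>
definition quotients_disjoint_union :: "'v \<Rightarrow> 'v" where
  "quotients_disjoint_union E =
     (SET p. \<exists>a c. a \<epsilon> omega1 \<and> c \<epsilon> reals_quotient (app E a) \<and> p = opair a c)"

definition disjoint_sum :: "'v \<Rightarrow> 'v \<Rightarrow> 'v" where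
  "disjoint_sum A B =
     (SET p. (\<exists>x. x \<epsilon> A \<and> p = opair empty x) \<or> (\<exists>y. y \<epsilon> B \<and> p = opair (suc empty) y))"

definition countable_increasing :: 'v where
  "countable_increasing = (SET f. \<exists>a. a \<epsilon> omega1 \<and> maps f a omega1 \<and>
     (\<forall>b c. b \<epsilon> c \<longrightarrow> c \<epsilon> a \<longrightarrow> app f b \<epsilon> app f c))"

end

end

theory Submission imports Defs begin

text \<open>
  Determinacy enters only through countable choice for sets of reals, which follows from AD by a
  simple game and from AD+ because of \<open>DC\<close> for the reals. Choice makes \<open>omega1\<close> regular, so every
  element of \<open>X\<close> is a subset of \<open>d \<times> d\<close> for some countable ordinal \<open>d\<close>. Such sets are coded by
  reals (a real codes a wellorder of a subset of the natural numbers and a transported copy of the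
  set), and those below a fixed \<open>d\<close> inject into the reals.

  Hence \<open>X\<close> splits into pieces \<open>X\<^sub>a\<close> (\<open>a < omega1\<close>) that inject into the reals. An injection \<open>j\<close> of
  \<open>omega1\<close> into \<open>X\<close> lets us arrange \<open>j a \<in> X\<^sub>a\<close>, so that the coding becomes a total surjection of
  the reals onto \<open>X\<^sub>a\<close>, uniformly in \<open>a\<close>; its kernel is \<open>E\<^sub>a\<close>. If the reals also inject into \<open>X\<close>,
  distribute this copy over the pieces: send the pair \<open>(x, y)\<close> to the ordinal coded by \<open>y\<close>. Every piece
  then contains a copy of the reals, and Cantor-Bernstein applies. Conversely \<open>a \<mapsto> [0]\<close> injects
  \<open>omega1\<close> into any disjoint union of quotients.
\<close>

section \<open>First-order definability\<close>

text \<open>Separation and Replacement are available only for formulas, so every comprehension owes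
  a proof that its predicate is definable. Instead of writing formulas, definability is made a
  property of HOL predicates and functions on assignments, closed under connectives, quantifiers,
  substitution and \<open>SET\<close>; \<open>intro definability\<close> then follows the shape of
  the HOL term. This requires terms that stay definable even where they mean nothing, hence
  \<open>the_set\<close> and \<open>ap\<close> in place of \<open>THE\<close> and
  \<open>app\<close>.

  The other obstacle is choice. Counting functions of infinitely many ordinals cannot be picked
  directly, but members of countably many sets of reals can. The detour through reals succeeds
  because wellorders are rigid: the code of a countable ordinal determines the counting function on
  it. This fact yields the existence of \<open>omega1\<close>, its regularity, and the decoding of
  bounded sets.\<close>

lemma finite_fv: "finite (fv p)"
  by (induction p) auto

lemma sat_cong: "(\<And>i. i \<in> fv p \<Longrightarrow> s i = t i) \<Longrightarrow> sat D m s p \<longleftrightarrow> sat D m t p"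
proof (induction p arbitrary: s t)
  case (All i p)
  have "sat D m (s(i := x)) p \<longleftrightarrow> sat D m (t(i := x)) p" for x
    by (rule All.IH) (use All.prems in auto)
  then show ?case by simp
next
  case (And p q)
  have "sat D m s p \<longleftrightarrow> sat D m t p" by (rule And.IH) (use And.prems in auto)
  moreover have "sat D m s q \<longleftrightarrow> sat D m t q" by (rule And.IH) (use And.prems in auto)
  ultimately show ?case by simp
next
  case (Neg p)
  have "sat D m s p \<longleftrightarrow> sat D m t p" by (rule Neg.IH) (use Neg.prems in auto)
  then show ?case by simp
qed simp_all

text \<open>The map \<open>\<rho>\<close> need not be injective, so a bound variable could capture
  the image of a free one. The quantifier case therefore moves the bound variable to an index
  \<open>j\<close> outside the image of the free variables.\<close>

lemma ex_sat_rename: "\<exists>q. \<forall>s. sat D m s q \<longleftrightarrow> sat D m (\<lambda>n. s (\<rho> n)) p"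
proof (induction p arbitrary: \<rho>)
  case (Mem i j) show ?case by (rule exI[of _ "Mem (\<rho> i) (\<rho> j)"]) simp
next
  case (Eq i j) show ?case by (rule exI[of _ "Eq (\<rho> i) (\<rho> j)"]) simp
next
  case (Neg p)
  then obtain q where "\<forall>s. sat D m s q \<longleftrightarrow> sat D m (\<lambda>n. s (\<rho> n)) p" by blast
  then show ?case by (intro exI[of _ "Neg q"]) simp
next
  case (And p p')
  obtain q where "\<forall>s. sat D m s q \<longleftrightarrow> sat D m (\<lambda>n. s (\<rho> n)) p" using And by blast
  moreover obtain q' where "\<forall>s. sat D m s q' \<longleftrightarrow> sat D m (\<lambda>n. s (\<rho> n)) p'" using And by blast
  ultimately show ?case by (intro exI[of _ "And q q'"]) simp
next
  case (All i p)
  obtain j where j: "j \<notin> \<rho> ` fv p"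
    using ex_new_if_finite[OF infinite_UNIV_nat] finite_fv by blast
  obtain q where q: "\<forall>s. sat D m s q \<longleftrightarrow> sat D m (\<lambda>n. s ((\<rho>(i := j)) n)) p"
    using All by blast
  have "sat D m (s(j := x)) q \<longleftrightarrow> sat D m ((\<lambda>n. s (\<rho> n))(i := x)) p" for s x
    unfolding q[rule_format] by (rule sat_cong) (use j in auto)
  then show ?case by (intro exI[of _ "All j q"]) simp
qed

text \<open>Variables sit at the even indices and parameters at the odd ones. Both are then
  unlimited in supply, and the closure properties below reduce to renamings of indices.\<close>

definition interleave :: "(nat \<Rightarrow> 'a) \<Rightarrow> (nat \<Rightarrow> 'a) \<Rightarrow> nat \<Rightarrow> 'a" where
  "interleave s r n = (if even n then s (n div 2) else r (n div 2))"

lemma interleave_simps [simp]: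
  "interleave s r (2 * n) = s n" "interleave s r (Suc (2 * n)) = r n" "interleave s r 0 = s 0"
  by (simp_all add: interleave_def)

locale zf_model = eps_structure +
  assumes ZF: ZF
begin

text \<open>
  The predicates and functions on assignments that are first-order definable with parameters.
  The assignment \<open>s\<close> holds the variables, \<open>r\<close> the parameters; passing under a binder shifts the
  variables, de Bruijn style.
\<close>

definition dpred :: "((nat \<Rightarrow> 'a) \<Rightarrow> bool) \<Rightarrow> bool" where
  "dpred P \<longleftrightarrow> (\<exists>p r. \<forall>s. P s \<longleftrightarrow> sat UNIV mem (interleave s r) p)"

definition dfun :: "((nat \<Rightarrow> 'a) \<Rightarrow> 'a) \<Rightarrow> bool" where
  "dfun t \<longleftrightarrow> dpred (\<lambda>s. s 0 = t (\<lambda>n. s (Suc n)))"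

lemma dpred_rename:
  assumes "dpred P" shows "dpred (\<lambda>s. P (\<lambda>n. s (\<rho> n)))"
proof -
  obtain p r where p: "\<And>s. P s \<longleftrightarrow> sat UNIV mem (interleave s r) p"
    using assms unfolding dpred_def by blast
  obtain q where q: "\<And>s. sat UNIV mem s q \<longleftrightarrow>
      sat UNIV mem (\<lambda>n. s (if even n then 2 * \<rho> (n div 2) else n)) p"
    using ex_sat_rename[of UNIV mem "\<lambda>n. if even n then 2 * \<rho> (n div 2) else n" p] by blast
  have "interleave (\<lambda>n. s (\<rho> n)) r = (\<lambda>n. interleave s r (if even n then 2 * \<rho> (n div 2) else n))" for s
    by (auto simp: interleave_def fun_eq_iff)
  then have "\<forall>s. P (\<lambda>n. s (\<rho> n)) \<longleftrightarrow> sat UNIV mem (interleave s r) q"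
    by (simp add: p q)
  then show ?thesis unfolding dpred_def by blast
qed

lemma dpred_not:
  assumes "dpred P" shows "dpred (\<lambda>s. \<not> P s)"
proof -
  obtain p r where "\<forall>s. P s \<longleftrightarrow> sat UNIV mem (interleave s r) p"
    using assms unfolding dpred_def by blast
  then show ?thesis unfolding dpred_def by (intro exI[of _ "Neg p"] exI[of _ r]) simp
qed

lemma dpred_conj:
  assumes "dpred P" "dpred Q" shows "dpred (\<lambda>s. P s \<and> Q s)"
proof -
  obtain p r where p: "\<And>s. P s \<longleftrightarrow> sat UNIV mem (interleave s r) p"
    using assms unfolding dpred_def by blast
  obtain q r' where q: "\<And>s. Q s \<longleftrightarrow> sat UNIV mem (interleave s r') q"
    using assms unfolding dpred_def by blast
  \<comment> \<open>The two parameter lists are merged into \<open>interleave r r'\<close>. Both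
    maps fix the variables; \<open>f\<close> sends the parameters of \<open>p\<close> to the even
    half of the merged list, \<open>g\<close> those of \<open>q\<close> to the odd half.\<close>
  define f where "f n = (if even n then n else Suc (2 * (2 * (n div 2))))" for n :: nat
  define g where "g n = (if even n then n else Suc (2 * Suc (2 * (n div 2))))" for n :: nat
  obtain p' where p': "\<And>s. sat UNIV mem s p' \<longleftrightarrow> sat UNIV mem (\<lambda>n. s (f n)) p"
    using ex_sat_rename by blast
  obtain q' where q': "\<And>s. sat UNIV mem s q' \<longleftrightarrow> sat UNIV mem (\<lambda>n. s (g n)) q"
    using ex_sat_rename by blast
  have e: "(\<lambda>n. interleave s (interleave r r') (f n)) = interleave s r"
    "(\<lambda>n. interleave s (interleave r r') (g n)) = interleave s r'" for s
    by (auto simp: interleave_def fun_eq_iff f_def g_def elim!: oddE)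
  have "\<forall>s. P s \<and> Q s \<longleftrightarrow> sat UNIV mem (interleave s (interleave r r')) (And p' q')"
    by (simp add: p q p' q' e)
  then show ?thesis unfolding dpred_def by blast
qed

text \<open>In the conclusion \<open>P s x\<close> is a higher-order pattern, so
  \<open>intro\<close> reads off \<open>P\<close> from the goal, and the premise appears with every
  outer variable shifted by one.\<close>

lemma dpred_all:
  assumes "dpred (\<lambda>s. P (\<lambda>n. s (Suc n)) (s 0))" shows "dpred (\<lambda>s. \<forall>x. P s x)"
proof -
  obtain p r where p: "\<And>s. P (\<lambda>n. s (Suc n)) (s 0) \<longleftrightarrow> sat UNIV mem (interleave s r) p"
    using assms unfolding dpred_def by blast
  \<comment> \<open>\<open>g\<close> takes variable \<open>Suc m\<close> under the binder back to
    variable \<open>m\<close> and leaves the parameters alone; the \<open>Suc\<close> in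
    \<open>f\<close> skips the index that is about to be freed for the quantifier.\<close>
  define g where "g n = (if even n then n - 2 else n)" for n :: nat
  define f where "f n = (if n = 0 then 0 else Suc (g n))" for n
  obtain p' where p': "\<And>s. sat UNIV mem s p' \<longleftrightarrow> sat UNIV mem (\<lambda>n. s (f n)) p"
    using ex_sat_rename by blast
  \<comment> \<open>The quantifier gets index 0 to itself by shifting the assignment with
    \<open>n - 1\<close>. That index 0 then repeats an old entry is harmless, because
    \<open>All 0\<close> overwrites it.\<close>
  obtain q where q: "\<And>s. sat UNIV mem s q \<longleftrightarrow> sat UNIV mem (\<lambda>n. s (n - 1)) (All 0 p')"
    using ex_sat_rename[of UNIV mem "\<lambda>n. n - 1" "All 0 p'"] by blast
  have "(\<lambda>n. ((\<lambda>n. interleave s r (n - 1))(0 := x)) (f n)) = interleave (case_nat x s) r" for s x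
  proof
    fix n :: nat
    show "((\<lambda>n. interleave s r (n - 1))(0 := x)) (f n) = interleave (case_nat x s) r n"
    proof (cases "even n")
      case True
      then obtain m where "n = 2 * m" by blast
      then show ?thesis by (cases m) (auto simp: f_def g_def interleave_def)
    next
      case False
      then obtain m where "n = Suc (2 * m)" by (metis oddE Suc_eq_plus1)
      then show ?thesis by (simp add: f_def g_def)
    qed
  qed
  moreover have "P s x \<longleftrightarrow> sat UNIV mem (interleave (case_nat x s) r) p" for s x
    using p[of "case_nat x s"] by simp
  ultimately have "(\<forall>x. P s x) \<longleftrightarrow> sat UNIV mem (interleave s r) q" for s
    unfolding q by (simp add: p')
  then show ?thesis unfolding dpred_def by blast
qed

lemma dpred_disj: "dpred P \<Longrightarrow> dpred Q \<Longrightarrow> dpred (\<lambda>s. P s \<or> Q s)"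
  using dpred_not[OF dpred_conj[OF dpred_not dpred_not]] by simp

lemma dpred_imp: "dpred P \<Longrightarrow> dpred Q \<Longrightarrow> dpred (\<lambda>s. P s \<longrightarrow> Q s)"
  using dpred_not[OF dpred_conj[OF _ dpred_not]] by simp

lemma dpred_iff: "dpred P \<Longrightarrow> dpred Q \<Longrightarrow> dpred (\<lambda>s. P s \<longleftrightarrow> Q s)"
  using dpred_conj[OF dpred_imp dpred_imp, of P Q Q P] by (simp add: iff_conv_conj_imp)

lemma dpred_ex:
  assumes "dpred (\<lambda>s. P (\<lambda>n. s (Suc n)) (s 0))" shows "dpred (\<lambda>s. \<exists>x. P s x)"
  using dpred_not[OF dpred_all[OF dpred_not[OF assms]]] by simp

text \<open>The formulas have no function symbols, so a term becomes a quantified variable that is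
  equated with its value.\<close>

lemma dpred_subst:
  assumes "dpred (\<lambda>s. P (\<lambda>n. s (Suc n)) (s 0))" "dfun t" shows "dpred (\<lambda>s. P s (t s))"
proof -
  have "dpred (\<lambda>s. \<exists>x. x = t s \<and> P s x)"
    using assms by (intro dpred_ex dpred_conj) (simp_all add: dfun_def)
  then show ?thesis by simp
qed

lemma dfun_rename: "dfun t \<Longrightarrow> dfun (\<lambda>s. t (\<lambda>n. s (\<rho> n)))"
  unfolding dfun_def by (drule dpred_rename[where \<rho> = "case_nat 0 (\<lambda>n. Suc (\<rho> n))"]) simp

lemma dpred_subst1: "dpred (\<lambda>s. P (s 0)) \<Longrightarrow> dfun t \<Longrightarrow> dpred (\<lambda>s. P (t s))"
  by (rule dpred_subst)

lemma dpred_subst2: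
  assumes "dpred (\<lambda>s. P (s 0) (s (Suc 0)))" "dfun t" "dfun u" shows "dpred (\<lambda>s. P (t s) (u s))"
proof -
  have "dpred (\<lambda>s. P (t (\<lambda>n. s (Suc n))) (s 0))"
    by (rule dpred_subst[where P = "\<lambda>s x. P x (s 0)" and t = "\<lambda>s. t (\<lambda>n. s (Suc n))"])
       (use assms dfun_rename in auto)
  from dpred_subst[where P = "\<lambda>s x. P (t s) x", OF this assms(3)] show ?thesis .
qed

lemma dfun_subst1: "dfun (\<lambda>s. h (s 0)) \<Longrightarrow> dfun t \<Longrightarrow> dfun (\<lambda>s. h (t s))"
proof -
  assume h: "dfun (\<lambda>s. h (s 0))" and t: "dfun t"
  \<comment> \<open>The renaming exchanges value and argument. No index beyond these two occurs in
    the predicate, so the rest may be \<open>undefined\<close>.\<close>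
  have "dpred (\<lambda>s. s (Suc 0) = h (s 0))"
    using dpred_rename[OF h[unfolded dfun_def], of "case_nat (Suc 0) (case_nat 0 undefined)"] by simp
  then have "dpred (\<lambda>s. s 0 = h (t (\<lambda>n. s (Suc n))))"
    by (rule dpred_subst[where P = "\<lambda>s x. s 0 = h x", OF _ dfun_rename[OF t]])
  then show ?thesis unfolding dfun_def .
qed

lemma dfun_subst2:
  assumes h: "dfun (\<lambda>s. h (s 0) (s (Suc 0)))" and t: "dfun t" and u: "dfun u"
  shows "dfun (\<lambda>s. h (t s) (u s))"
proof -
  have "dpred (\<lambda>s. s (Suc (Suc 0)) = h (s (Suc 0)) (s 0))"
    using dpred_rename[OF h[unfolded dfun_def],
        of "case_nat (Suc (Suc 0)) (case_nat (Suc 0) (case_nat 0 undefined))"] by simp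
  then have "dpred (\<lambda>s. s (Suc 0) = h (s 0) (u (\<lambda>n. s (Suc (Suc n)))))"
    by (rule dpred_subst[where P = "\<lambda>s x. s (Suc 0) = h (s 0) x", OF _ dfun_rename[OF u]])
  then have "dpred (\<lambda>s. s 0 = h (t (\<lambda>n. s (Suc n))) (u (\<lambda>n. s (Suc n))))"
    by (rule dpred_subst[where P = "\<lambda>s x. s 0 = h x (u (\<lambda>n. s (Suc n)))", OF _ dfun_rename[OF t]])
  then show ?thesis unfolding dfun_def .
qed

lemma dpred_mem: "dfun t \<Longrightarrow> dfun u \<Longrightarrow> dpred (\<lambda>s. t s \<epsilon> u s)"
  by (rule dpred_subst2) (auto simp: dpred_def interleave_def intro!: exI[of _ "Mem 0 2"])

lemma dpred_eq: "dfun t \<Longrightarrow> dfun u \<Longrightarrow> dpred (\<lambda>s. t s = u s)"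
  by (rule dpred_subst2) (auto simp: dpred_def interleave_def intro!: exI[of _ "Eq 0 2"])

lemma dfun_var: "dfun (\<lambda>s. s i)"
  by (auto simp: dfun_def dpred_def interleave_def intro!: exI[of _ "Eq 0 (2 * Suc i)"])

lemma dfun_const: "dfun (\<lambda>s. c)"
  by (auto simp: dfun_def dpred_def interleave_def intro!: exI[of _ "Eq 0 1"] exI[of _ "\<lambda>_. c"])

lemma dpred_const: "dpred (\<lambda>s. b)"
proof -
  have "dpred (\<lambda>s. undefined = (undefined :: 'a))" by (rule dpred_eq) (rule dfun_const)+
  then show ?thesis using dpred_not by (cases b) fastforce+
qed

lemma dpred_ex1:
  assumes "dpred (\<lambda>s. P (\<lambda>n. s (Suc n)) (s 0))" shows "dpred (\<lambda>s. \<exists>!x. P s x)"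
proof -
  have "dpred (\<lambda>s. P (\<lambda>n. s (Suc (Suc n))) (s 0))"
    using dpred_rename[OF assms, of "case_nat 0 (\<lambda>n. Suc (Suc n))"] by simp
  then have "dpred (\<lambda>s. \<exists>x. P s x \<and> (\<forall>y. P s y \<longrightarrow> y = x))"
    by (intro dpred_ex dpred_conj assms dpred_all dpred_imp dpred_eq dfun_var)
  then show ?thesis by (simp add: Ex1_def)
qed

lemma dfun_if:
  assumes "dpred P" "dfun t" "dfun u" shows "dfun (\<lambda>s. if P s then t s else u s)"
proof -
  have "dpred (\<lambda>s. (P (\<lambda>n. s (Suc n)) \<and> s 0 = t (\<lambda>n. s (Suc n))) \<or>
      (\<not> P (\<lambda>n. s (Suc n)) \<and> s 0 = u (\<lambda>n. s (Suc n))))"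
    by (intro dpred_disj dpred_conj dpred_not dpred_rename[OF assms(1)] assms(2,3)[unfolded dfun_def])
  then show ?thesis unfolding dfun_def by (rule back_subst[of dpred]) auto
qed

section \<open>Existence of sets by Separation and Replacement\<close>

lemma extens: "(\<And>x. x \<epsilon> a \<longleftrightarrow> x \<epsilon> b) \<Longrightarrow> a = b"
  using ZF unfolding ZF_def extensionality_def by blast

definition is_set :: "('a \<Rightarrow> bool) \<Rightarrow> bool" where
  "is_set P \<longleftrightarrow> (\<exists>a. \<forall>x. x \<epsilon> a \<longleftrightarrow> P x)"

lemma SET_eq: "(\<And>x. x \<epsilon> a \<longleftrightarrow> P x) \<Longrightarrow> (SET x. P x) = a"
  unfolding set_of_def by (rule the_equality) (auto intro: extens)

lemma mem_SET: "is_set P \<Longrightarrow> x \<epsilon> (SET x. P x) \<longleftrightarrow> P x"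
  unfolding is_set_def using SET_eq by blast

text \<open>True even where the set does not exist: there \<open>SET\<close> takes the fixed value
  \<open>THE x. False\<close>, which serves as a parameter, and whether the set exists is itself
  first-order. Definability of a term and existence of the set can thus be proved
  separately.\<close>

lemma dfun_SET:
  assumes "dpred (\<lambda>s. P (\<lambda>n. s (Suc n)) (s 0))" shows "dfun (\<lambda>s. SET x. P s x)"
proof -
  let ?c = "THE x :: 'a. False"
  have eq: "z = (SET x. P s x) \<longleftrightarrow> (\<forall>x. x \<epsilon> z \<longleftrightarrow> P s x) \<or> (\<not> (\<exists>a. \<forall>x. x \<epsilon> a \<longleftrightarrow> P s x) \<and> z = ?c)" for z s
  proof (cases "is_set (P s)")
    case True
    then obtain a where a: "\<And>x. x \<epsilon> a \<longleftrightarrow> P s x" unfolding is_set_def by blast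
    then have "(SET x. P s x) = a" by (rule SET_eq)
    moreover have "z = a \<longleftrightarrow> (\<forall>x. x \<epsilon> z \<longleftrightarrow> P s x)" using a extens by metis
    moreover have "\<exists>a. \<forall>x. x \<epsilon> a \<longleftrightarrow> P s x" using True unfolding is_set_def .
    ultimately show ?thesis by (simp only: simp_thms not_True_eq_False)
  next
    case False
    then have *: "\<not> (\<forall>x. x \<epsilon> a \<longleftrightarrow> P s x)" for a unfolding is_set_def by blast
    then have "(\<lambda>a. \<forall>x. x \<epsilon> a \<longleftrightarrow> P s x) = (\<lambda>a. False)" by (simp only:)
    then have "(SET x. P s x) = ?c" unfolding set_of_def by simp
    with * show ?thesis by (simp only: simp_thms)
  qed
  have P: "dpred (\<lambda>s. P (\<lambda>n. s (Suc (Suc n))) (s 0))"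
    using dpred_rename[OF assms, of "case_nat 0 (\<lambda>n. Suc (Suc n))"] by simp
  have P': "dpred (\<lambda>s. P (\<lambda>n. s (Suc (Suc (Suc n)))) (s 0))"
    using dpred_rename[OF assms, of "case_nat 0 (\<lambda>n. Suc (Suc (Suc n)))"] by simp
  show ?thesis unfolding dfun_def eq
    by (intro dpred_disj dpred_conj dpred_not dpred_ex dpred_all dpred_iff dpred_mem dpred_eq
        dfun_var dfun_const P P')
qed

lemmas dintros = dpred_mem dpred_eq dpred_const dpred_not dpred_conj dpred_disj dpred_imp dpred_iff
  dpred_all dpred_ex dpred_ex1 dfun_var dfun_const dfun_if dfun_SET

lemma is_set_sep:
  assumes "dpred (\<lambda>s. P (s 0))" "\<And>x. P x \<Longrightarrow> x \<epsilon> a" shows "is_set P"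
proof -
  obtain p r where p: "\<And>s. P (s 0) \<longleftrightarrow> sat UNIV mem (interleave s r) p"
    using assms unfolding dpred_def by blast
  have "(interleave (\<lambda>_. a) r)(0 := x) = interleave ((\<lambda>_. a)(0 := x)) r" for x
    by (auto simp: interleave_def fun_eq_iff)
  then have "P x \<longleftrightarrow> sat UNIV mem ((interleave (\<lambda>_. a) r)(0 := x)) p" for x
    using p[of "(\<lambda>_. a)(0 := x)"] by simp
  moreover have "\<exists>b. \<forall>x. x \<epsilon> b \<longleftrightarrow> x \<epsilon> a \<and> sat UNIV mem ((interleave (\<lambda>_. a) r)(0 := x)) p"
    using ZF unfolding ZF_def separation_def by blast
  ultimately show ?thesis using assms(2) unfolding is_set_def by auto
qed

lemma is_set_replace:
  assumes "dfun (\<lambda>s. t (s 0))" shows "is_set (\<lambda>y. \<exists>x. x \<epsilon> a \<and> y = t x)"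
proof -
  have "dpred (\<lambda>s. s (Suc 0) = t (s 0))"
    using assms by (intro dpred_eq dfun_var)
  then obtain p r where p: "\<And>s. s (Suc 0) = t (s 0) \<longleftrightarrow> sat UNIV mem (interleave s r) p"
    unfolding dpred_def by blast
  \<comment> \<open>Replacement reads the value at index 1, but in \<open>interleave\<close> the
    second variable sits at index 2 and index 1 holds a parameter. Hence the swap, both in the
    formula and in \<open>?s\<close>.\<close>
  obtain q where q: "\<And>s. sat UNIV mem s q \<longleftrightarrow>
      sat UNIV mem (\<lambda>n. s (if n = 2 then 1 else if n = 1 then 2 else n)) p"
    using ex_sat_rename[of UNIV mem "\<lambda>n. if n = 2 then 1 else if n = 1 then 2 else n" p] by blast
  let ?s = "\<lambda>n. (interleave (\<lambda>_. a) r) (if n = 2 then 1 else if n = 1 then 2 else n)"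
  have "(\<lambda>n. (?s(0 := x, 1 := y)) (if n = 2 then 1 else if n = 1 then 2 else n)) =
      interleave ((\<lambda>_. a)(0 := x, Suc 0 := y)) r" for x y
    by (auto simp: interleave_def fun_eq_iff)
  then have *: "sat UNIV mem (?s(0 := x, 1 := y)) q \<longleftrightarrow> y = t x" for x y
    using p[of "(\<lambda>_. a)(0 := x, Suc 0 := y)"] unfolding q by simp
  have "(\<forall>x y z. x \<epsilon> a \<longrightarrow> sat UNIV mem (?s(0 := x, 1 := y)) q \<longrightarrow>
        sat UNIV mem (?s(0 := x, 1 := z)) q \<longrightarrow> y = z) \<longrightarrow>
     (\<exists>b. \<forall>y. y \<epsilon> b \<longleftrightarrow> (\<exists>x. x \<epsilon> a \<and> sat UNIV mem (?s(0 := x, 1 := y)) q))"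
    using ZF unfolding ZF_def replacement_def by blast
  then show ?thesis unfolding * is_set_def by simp
qed

section \<open>Sets and functions\<close>

lemma dpred_subst3:
  assumes "dpred (\<lambda>s. P (s 0) (s (Suc 0)) (s (Suc (Suc 0))))" "dfun t" "dfun u" "dfun v"
  shows "dpred (\<lambda>s. P (t s) (u s) (v s))"
proof -
  have "dpred (\<lambda>s. P (t (\<lambda>n. s (Suc (Suc n)))) (s 0) (s (Suc 0)))"
    by (rule dpred_subst[where P = "\<lambda>s x. P x (s 0) (s (Suc 0))", OF assms(1) dfun_rename[OF assms(2)]])
  then have "dpred (\<lambda>s. P (t (\<lambda>n. s (Suc n))) (u (\<lambda>n. s (Suc n))) (s 0))"
    by (rule dpred_subst[where P = "\<lambda>s x. P (t (\<lambda>n. s (Suc n))) x (s 0)", OF _ dfun_rename[OF assms(3)]])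
  from dpred_subst[where P = "\<lambda>s x. P (t s) (u s) x", OF this assms(4)] show ?thesis .
qed

lemma empty_iff [simp]: "\<not> x \<epsilon> empty"
  unfolding empty_def by (subst mem_SET) (auto intro: is_set_sep dpred_const)

lemma is_set_upair: "is_set (\<lambda>x. x = a \<or> x = b)"
  using ZF unfolding ZF_def pairing_def is_set_def by blast

lemma upair_iff [simp]: "x \<epsilon> upair a b \<longleftrightarrow> x = a \<or> x = b"
  unfolding upair_def by (rule mem_SET[OF is_set_upair])

lemma upair_eq_iff: "upair a b = upair c d \<longleftrightarrow> (a = c \<and> b = d) \<or> (a = d \<and> b = c)"
  by (auto simp: upair_iff intro!: extens) (metis upair_iff)+

lemma opair_eq_iff [simp]: "opair a b = opair c d \<longleftrightarrow> a = c \<and> b = d"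
  unfolding opair_def upair_eq_iff by auto

lemma is_set_Union: "is_set (\<lambda>x. \<exists>y. y \<epsilon> a \<and> x \<epsilon> y)"
  using ZF unfolding ZF_def union_axiom_def is_set_def by blast

lemma is_set_UN:
  assumes "dfun (\<lambda>s. t (s 0))" shows "is_set (\<lambda>z. \<exists>x. x \<epsilon> A \<and> z \<epsilon> t x)"
proof -
  obtain c where c: "\<And>y. y \<epsilon> c \<longleftrightarrow> (\<exists>x. x \<epsilon> A \<and> y = t x)"
    using is_set_replace[OF assms] unfolding is_set_def by blast
  show ?thesis by (rule back_subst[of is_set, OF is_set_Union[of c]]) (auto simp: c)
qed

lemma is_set_Un: "is_set (\<lambda>x. x \<epsilon> a \<or> x \<epsilon> b)"
  using is_set_Union[of "upair a b"] by (rule back_subst[of is_set]) auto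

definition un :: "'a \<Rightarrow> 'a \<Rightarrow> 'a" where
  "un a b = (SET x. x \<epsilon> a \<or> x \<epsilon> b)"

lemma un_iff [simp]: "x \<epsilon> un a b \<longleftrightarrow> x \<epsilon> a \<or> x \<epsilon> b"
  unfolding un_def by (rule mem_SET[OF is_set_Un])

lemma suc_iff [simp]: "x \<epsilon> suc a \<longleftrightarrow> x \<epsilon> a \<or> x = a"
  unfolding suc_def by (rule mem_SET) (use is_set_Un[of a "upair a a"] in simp)

lemma power_set_iff [simp]: "x \<epsilon> power_set a \<longleftrightarrow> subset x a"
  unfolding power_set_def
  by (rule mem_SET) (use ZF in \<open>auto simp: ZF_def power_set_axiom_def is_set_def subset_def\<close>)

lemma dfun_upair: "dfun t \<Longrightarrow> dfun u \<Longrightarrow> dfun (\<lambda>s. upair (t s) (u s))"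
  by (rule dfun_subst2) (unfold upair_def, intro dintros)

lemma dfun_opair: "dfun t \<Longrightarrow> dfun u \<Longrightarrow> dfun (\<lambda>s. opair (t s) (u s))"
  unfolding opair_def by (intro dfun_upair)

lemma dfun_suc: "dfun t \<Longrightarrow> dfun (\<lambda>s. suc (t s))"
  by (rule dfun_subst1) (unfold suc_def, intro dintros)

lemma dfun_un: "dfun t \<Longrightarrow> dfun u \<Longrightarrow> dfun (\<lambda>s. un (t s) (u s))"
  by (rule dfun_subst2) (unfold un_def, intro dintros)

lemma dpred_subset: "dfun t \<Longrightarrow> dfun u \<Longrightarrow> dpred (\<lambda>s. subset (t s) (u s))"
  by (rule dpred_subst2) (unfold subset_def, intro dintros)

lemma dfun_power_set: "dfun t \<Longrightarrow> dfun (\<lambda>s. power_set (t s))"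
  by (rule dfun_subst1) (unfold power_set_def, intro dintros dpred_subset)

lemma is_set_replace2:
  assumes "dfun (\<lambda>s. t (s 0) (s (Suc 0)))"
  shows "is_set (\<lambda>z. \<exists>x y. x \<epsilon> A \<and> y \<epsilon> B \<and> z = t x y)"
proof -
  let ?f = "\<lambda>x. SET z. \<exists>y. y \<epsilon> B \<and> z = t x y"
  have f: "z \<epsilon> ?f x \<longleftrightarrow> (\<exists>y. y \<epsilon> B \<and> z = t x y)" for z x
    by (rule mem_SET) (rule is_set_replace[OF dfun_subst2[OF assms dfun_const dfun_var]])
  have "is_set (\<lambda>z. \<exists>x. x \<epsilon> A \<and> z \<epsilon> ?f x)"
    by (rule is_set_UN) (intro dintros dfun_subst2[OF assms])
  then show ?thesis by (rule back_subst[of is_set]) (auto simp: f)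
qed

definition prod :: "'a \<Rightarrow> 'a \<Rightarrow> 'a" where
  "prod A B = (SET p. \<exists>x y. x \<epsilon> A \<and> y \<epsilon> B \<and> p = opair x y)"

lemma prod_iff: "p \<epsilon> prod A B \<longleftrightarrow> (\<exists>x y. x \<epsilon> A \<and> y \<epsilon> B \<and> p = opair x y)"
  unfolding prod_def by (rule mem_SET) (intro is_set_replace2 dfun_opair dintros)

lemma opair_prod_iff [simp]: "opair x y \<epsilon> prod A B \<longleftrightarrow> x \<epsilon> A \<and> y \<epsilon> B"
  by (auto simp: prod_iff)

lemma dfun_prod: "dfun t \<Longrightarrow> dfun u \<Longrightarrow> dfun (\<lambda>s. prod (t s) (u s))"
  by (rule dfun_subst2) (unfold prod_def, intro dintros dfun_opair)

text \<open>A definable version of unique choice: unlike \<open>THE\<close>, its value is definable even on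
  predicates satisfied by several sets.\<close>

definition the_set :: "('a \<Rightarrow> bool) \<Rightarrow> 'a" where
  "the_set Q = (SET z. \<exists>y. Q y \<and> z \<epsilon> y)"

lemma the_set_eq: "Q y \<Longrightarrow> (\<And>y'. Q y' \<Longrightarrow> y' = y) \<Longrightarrow> the_set Q = y"
  unfolding the_set_def by (rule SET_eq) blast

lemma dfun_the_set:
  assumes "dpred (\<lambda>s. Q (\<lambda>n. s (Suc n)) (s 0))" shows "dfun (\<lambda>s. the_set (\<lambda>y. Q s y))"
proof -
  have "dpred (\<lambda>s. Q (\<lambda>n. s (Suc (Suc n))) (s 0))"
    using dpred_rename[OF assms, of "case_nat 0 (\<lambda>n. Suc (Suc n))"] by simp
  then show ?thesis unfolding the_set_def by (intro dintros)
qed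

text \<open>\<open>app\<close> is a \<open>THE\<close>, and off the domain its value need not depend
  definably on the arguments. This total variant is definable in both arguments and agrees with
  \<open>app\<close> on the domain.\<close>

definition ap :: "'a \<Rightarrow> 'a \<Rightarrow> 'a" where
  "ap f x = the_set (\<lambda>y. opair x y \<epsilon> f)"

lemma dfun_ap: "dfun t \<Longrightarrow> dfun u \<Longrightarrow> dfun (\<lambda>s. ap (t s) (u s))"
  by (rule dfun_subst2) (unfold ap_def, intro dintros dfun_opair dfun_the_set)

lemma opair_app_mem: "fun_on f A \<Longrightarrow> x \<epsilon> A \<Longrightarrow> opair x (app f x) \<epsilon> f"
  unfolding app_def by (rule theI') (simp add: fun_on_def)

lemma opair_mem_iff_app: "fun_on f A \<Longrightarrow> x \<epsilon> A \<Longrightarrow> opair x y \<epsilon> f \<longleftrightarrow> y = app f x"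
  using opair_app_mem unfolding fun_on_def by blast

lemma ap_eq: "opair x y \<epsilon> f \<Longrightarrow> (\<And>y'. opair x y' \<epsilon> f \<Longrightarrow> y' = y) \<Longrightarrow> ap f x = y"
  unfolding ap_def by (rule the_set_eq)

lemma app_eq_ap: "fun_on f A \<Longrightarrow> x \<epsilon> A \<Longrightarrow> app f x = ap f x"
  by (rule sym, rule ap_eq) (auto simp: opair_mem_iff_app)

lemma mem_fun_on_iff:
  assumes "fun_on f A" shows "p \<epsilon> f \<longleftrightarrow> (\<exists>x. x \<epsilon> A \<and> p = opair x (ap f x))"
proof
  assume p: "p \<epsilon> f"
  then obtain x y where xy: "x \<epsilon> A" "p = opair x y" using assms unfolding fun_on_def by blast
  then have "y = ap f x" using p opair_mem_iff_app[OF assms] app_eq_ap[OF assms] by simp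
  then show "\<exists>x. x \<epsilon> A \<and> p = opair x (ap f x)" using xy by blast
next
  assume "\<exists>x. x \<epsilon> A \<and> p = opair x (ap f x)"
  then show "p \<epsilon> f" using opair_app_mem[OF assms] app_eq_ap[OF assms] by auto
qed

lemma fun_on_eqI:
  assumes "fun_on f A" "fun_on g A" "\<And>x. x \<epsilon> A \<Longrightarrow> ap f x = ap g x" shows "f = g"
proof (rule extens)
  fix p
  show "p \<epsilon> f \<longleftrightarrow> p \<epsilon> g"
    using assms mem_fun_on_iff[OF assms(1), of p] mem_fun_on_iff[OF assms(2), of p] by auto
qed

definition lam :: "'a \<Rightarrow> ('a \<Rightarrow> 'a) \<Rightarrow> 'a" where
  "lam A t = (SET p. \<exists>x. x \<epsilon> A \<and> p = opair x (t x))"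

lemma dfun_lam:
  assumes "dfun A" "dfun (\<lambda>s. t (\<lambda>n. s (Suc n)) (s 0))" shows "dfun (\<lambda>s. lam (A s) (\<lambda>x. t s x))"
proof -
  have "dfun (\<lambda>s. t (\<lambda>n. s (Suc (Suc n))) (s 0))"
    using dfun_rename[OF assms(2), of "case_nat 0 (\<lambda>n. Suc (Suc n))"] by simp
  moreover have "dfun (\<lambda>s. A (\<lambda>n. s (Suc (Suc n))))"
    by (rule dfun_rename[OF assms(1)])
  ultimately show ?thesis unfolding lam_def by (intro dintros dfun_opair)
qed

lemma mem_lam: "dfun (\<lambda>s. t (s 0)) \<Longrightarrow> p \<epsilon> lam A t \<longleftrightarrow> (\<exists>x. x \<epsilon> A \<and> p = opair x (t x))"
  unfolding lam_def by (rule mem_SET) (intro is_set_replace dfun_opair dintros)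

lemma fun_on_lam: "dfun (\<lambda>s. t (s 0)) \<Longrightarrow> fun_on (lam A t) A"
  unfolding fun_on_def by (auto simp: mem_lam)

lemma ap_lam: "dfun (\<lambda>s. t (s 0)) \<Longrightarrow> x \<epsilon> A \<Longrightarrow> ap (lam A t) x = t x"
  by (rule ap_eq) (auto simp: mem_lam)

lemma app_lam: "dfun (\<lambda>s. t (s 0)) \<Longrightarrow> x \<epsilon> A \<Longrightarrow> app (lam A t) x = t x"
  using app_eq_ap[OF fun_on_lam] ap_lam by metis

lemma maps_iff: "maps f A B \<longleftrightarrow> fun_on f A \<and> (\<forall>x. x \<epsilon> A \<longrightarrow> ap f x \<epsilon> B)"
  unfolding maps_def using app_eq_ap by auto

lemma maps_lam: "dfun (\<lambda>s. t (s 0)) \<Longrightarrow> (\<And>x. x \<epsilon> A \<Longrightarrow> t x \<epsilon> B) \<Longrightarrow> maps (lam A t) A B"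
  by (simp add: maps_def fun_on_lam app_lam)

lemma inj_from_to_iff: "inj_from_to f A B \<longleftrightarrow> maps f A B \<and>
     (\<forall>x y. x \<epsilon> A \<longrightarrow> y \<epsilon> A \<longrightarrow> ap f x = ap f y \<longrightarrow> x = y)"
proof (cases "fun_on f A")
  case True
  then show ?thesis unfolding inj_from_to_def using app_eq_ap[OF True] by auto
qed (simp add: inj_from_to_def maps_def)

lemma dpred_fun_on: "dfun t \<Longrightarrow> dfun u \<Longrightarrow> dpred (\<lambda>s. fun_on (t s) (u s))"
  by (rule dpred_subst2) (unfold fun_on_def, intro dintros dfun_opair)

lemma dpred_maps: "dfun t \<Longrightarrow> dfun u \<Longrightarrow> dfun v \<Longrightarrow> dpred (\<lambda>s. maps (t s) (u s) (v s))"
  by (rule dpred_subst3) (unfold maps_iff, intro dintros dfun_ap dpred_fun_on)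

lemma dpred_inj_from_to:
  "dfun t \<Longrightarrow> dfun u \<Longrightarrow> dfun v \<Longrightarrow> dpred (\<lambda>s. inj_from_to (t s) (u s) (v s))"
  by (rule dpred_subst3) (unfold inj_from_to_iff, intro dintros dfun_ap dpred_maps)

lemma dpred_injects: "dfun t \<Longrightarrow> dfun u \<Longrightarrow> dpred (\<lambda>s. injects (t s) (u s))"
  by (rule dpred_subst2) (unfold injects_def, intro dintros dpred_inj_from_to)

lemma dfun_restr: "dfun t \<Longrightarrow> dfun u \<Longrightarrow> dfun (\<lambda>s. restr (t s) (u s))"
  by (rule dfun_subst2) (unfold restr_def, intro dintros dfun_opair)

section \<open>Injections, bijections and the Cantor-Bernstein theorem\<close>

lemma injectsI:
  assumes "dfun (\<lambda>s. t (s 0))" "\<And>x. x \<epsilon> A \<Longrightarrow> t x \<epsilon> B"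
    "\<And>x y. x \<epsilon> A \<Longrightarrow> y \<epsilon> A \<Longrightarrow> t x = t y \<Longrightarrow> x = y"
  shows "injects A B"
  unfolding injects_def inj_from_to_def
  by (rule exI[of _ "lam A t"]) (use assms in \<open>simp add: maps_lam app_lam\<close>)

lemma injectsE:
  assumes "injects A B"
  obtains f where "\<And>x. x \<epsilon> A \<Longrightarrow> ap f x \<epsilon> B"
    "\<And>x y. x \<epsilon> A \<Longrightarrow> y \<epsilon> A \<Longrightarrow> ap f x = ap f y \<Longrightarrow> x = y"
  using assms unfolding injects_def inj_from_to_iff maps_iff by blast

lemma injects_trans:
  assumes "injects A B" "injects B C" shows "injects A C"
proof -
  obtain f where f: "\<And>x. x \<epsilon> A \<Longrightarrow> ap f x \<epsilon> B"
    "\<And>x y. x \<epsilon> A \<Longrightarrow> y \<epsilon> A \<Longrightarrow> ap f x = ap f y \<Longrightarrow> x = y" using assms(1) by (rule injectsE) blast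
  obtain g where g: "\<And>x. x \<epsilon> B \<Longrightarrow> ap g x \<epsilon> C"
    "\<And>x y. x \<epsilon> B \<Longrightarrow> y \<epsilon> B \<Longrightarrow> ap g x = ap g y \<Longrightarrow> x = y" using assms(2) by (rule injectsE) blast
  show ?thesis
  proof (rule injectsI[where t = "\<lambda>x. ap g (ap f x)"])
    show "dfun (\<lambda>s. ap g (ap f (s 0)))" by (intro dfun_ap dintros)
  qed (auto intro: f g)
qed

lemma injects_subset: "subset A B \<Longrightarrow> injects A B"
  by (rule injectsI[where t = "\<lambda>x. x"]) (auto simp: subset_def intro: dfun_var)

lemma in_bijectionI:
  assumes "dfun (\<lambda>s. t (s 0))" "\<And>x. x \<epsilon> A \<Longrightarrow> t x \<epsilon> B"
    "\<And>x y. x \<epsilon> A \<Longrightarrow> y \<epsilon> A \<Longrightarrow> t x = t y \<Longrightarrow> x = y"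
    "\<And>y. y \<epsilon> B \<Longrightarrow> \<exists>x. x \<epsilon> A \<and> t x = y"
  shows "in_bijection A B"
proof -
  have "\<exists>x. x \<epsilon> A \<and> app (lam A t) x = y" if "y \<epsilon> B" for y
    using assms(4)[OF that] app_lam[OF assms(1)] by auto
  then show ?thesis unfolding in_bijection_def inj_from_to_def surj_from_to_def
    by (intro exI[of _ "lam A t"]) (use assms(1-3) in \<open>simp add: maps_lam app_lam\<close>)
qed

lemma in_bijectionE:
  assumes "in_bijection A B"
  obtains f where "\<And>x. x \<epsilon> A \<Longrightarrow> ap f x \<epsilon> B"
    "\<And>x y. x \<epsilon> A \<Longrightarrow> y \<epsilon> A \<Longrightarrow> ap f x = ap f y \<Longrightarrow> x = y"
    "\<And>y. y \<epsilon> B \<Longrightarrow> \<exists>x. x \<epsilon> A \<and> ap f x = y"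
proof -
  obtain f where f: "inj_from_to f A B" "surj_from_to f A B"
    using assms unfolding in_bijection_def by blast
  then have "fun_on f A" unfolding inj_from_to_def maps_def by blast
  then have "\<And>y. y \<epsilon> B \<Longrightarrow> \<exists>x. x \<epsilon> A \<and> ap f x = y"
    using f(2) app_eq_ap unfolding surj_from_to_def by metis
  then show ?thesis using that f(1) unfolding inj_from_to_iff maps_iff by blast
qed

lemma in_bijection_sym:
  assumes "in_bijection A B" shows "in_bijection B A"
proof -
  obtain f where f: "\<And>x. x \<epsilon> A \<Longrightarrow> ap f x \<epsilon> B"
    "\<And>x y. x \<epsilon> A \<Longrightarrow> y \<epsilon> A \<Longrightarrow> ap f x = ap f y \<Longrightarrow> x = y"
    "\<And>y. y \<epsilon> B \<Longrightarrow> \<exists>x. x \<epsilon> A \<and> ap f x = y"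
    using assms by (rule in_bijectionE) blast
  let ?g = "\<lambda>y. the_set (\<lambda>x. x \<epsilon> A \<and> ap f x = y)"
  have g: "?g (ap f x) = x" if "x \<epsilon> A" for x
    by (rule the_set_eq) (use f that in auto)
  show ?thesis
  proof (rule in_bijectionI[where t = ?g])
    show "dfun (\<lambda>s. ?g (s 0))" by (intro dfun_the_set dfun_ap dintros)
    show "?g y \<epsilon> A" if "y \<epsilon> B" for y using f(3)[OF that] g by auto
    show "x = y" if "x \<epsilon> B" "y \<epsilon> B" "?g x = ?g y" for x y
      using f(3)[OF that(1)] f(3)[OF that(2)] g that(3) by auto
    show "\<exists>y. y \<epsilon> B \<and> ?g y = x" if "x \<epsilon> A" for x using f(1)[OF that] g[OF that] by blast
  qed
qed

lemma in_bijection_injects: "in_bijection A B \<Longrightarrow> injects A B"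
  unfolding in_bijection_def injects_def by blast

text \<open>The Knaster-Tarski proof. The operator \<phi> takes \<open>S\<close> to \<open>A\<close>
  minus the \<open>g\<close>-image of what \<open>f\<close> misses of \<open>B\<close> on
  \<open>S\<close>; it is monotone, and \<open>D\<close>, the union of all \<open>S\<close>
  contained in their own image, is its greatest fixed point. The bijection is \<open>f\<close> on
  \<open>D\<close> and the inverse of \<open>g\<close> elsewhere. Working with a union of sets
  avoids recursion along \<open>omega\<close>.\<close>

lemma cantor_bernstein:
  assumes "injects A B" "injects B A" shows "in_bijection A B"
proof -
  obtain f where f: "\<And>x. x \<epsilon> A \<Longrightarrow> ap f x \<epsilon> B"
    "\<And>x y. x \<epsilon> A \<Longrightarrow> y \<epsilon> A \<Longrightarrow> ap f x = ap f y \<Longrightarrow> x = y" using assms(1) by (rule injectsE) blast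
  obtain g where g: "\<And>x. x \<epsilon> B \<Longrightarrow> ap g x \<epsilon> A"
    "\<And>x y. x \<epsilon> B \<Longrightarrow> y \<epsilon> B \<Longrightarrow> ap g x = ap g y \<Longrightarrow> x = y" using assms(2) by (rule injectsE) blast
  define \<phi> where "\<phi> S x \<longleftrightarrow> x \<epsilon> A \<and>
      \<not> (\<exists>b. b \<epsilon> B \<and> ap g b = x \<and> \<not> (\<exists>y. y \<epsilon> S \<and> ap f y = b))" for S x
  have \<phi>_mono: "\<phi> S x \<Longrightarrow> (\<And>y. y \<epsilon> S \<Longrightarrow> y \<epsilon> T) \<Longrightarrow> \<phi> T x" for S T x
    unfolding \<phi>_def by blast
  have \<phi>_dpred: "dfun t \<Longrightarrow> dfun u \<Longrightarrow> dpred (\<lambda>s. \<phi> (t s) (u s))" for t u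
    by (rule dpred_subst2) (unfold \<phi>_def, intro dintros dfun_ap)
  define D where "D = (SET x. \<exists>S. x \<epsilon> S \<and> (\<forall>y. y \<epsilon> S \<longrightarrow> \<phi> S y))"
  have D: "x \<epsilon> D \<longleftrightarrow> (\<exists>S. x \<epsilon> S \<and> (\<forall>y. y \<epsilon> S \<longrightarrow> \<phi> S y))" for x
    unfolding D_def
  proof (rule mem_SET, rule is_set_sep[where a = A])
    show "dpred (\<lambda>s. \<exists>S. s 0 \<epsilon> S \<and> (\<forall>y. y \<epsilon> S \<longrightarrow> \<phi> S y))" by (intro dintros \<phi>_dpred)
  qed (auto simp: \<phi>_def)
  have D1: "\<phi> D x" if "x \<epsilon> D" for x
  proof -
    obtain S where S: "x \<epsilon> S" "\<forall>y. y \<epsilon> S \<longrightarrow> \<phi> S y" using \<open>x \<epsilon> D\<close> D by blast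
    then have "y \<epsilon> D" if "y \<epsilon> S" for y using that D by blast
    then show ?thesis using S \<phi>_mono by blast
  qed
  have D2: "x \<epsilon> D" if "\<phi> D x" for x
  proof -
    have "is_set (\<phi> D)"
      by (rule is_set_sep[where a = A]) (intro dintros \<phi>_dpred, simp add: \<phi>_def)
    then obtain S where S: "\<And>y. y \<epsilon> S \<longleftrightarrow> \<phi> D y" unfolding is_set_def by blast
    have "\<phi> S y" if "y \<epsilon> S" for y
      using \<phi>_mono[of D y S] D1 S that by blast
    then show ?thesis using D S that by blast
  qed
  define h where "h x = (if x \<epsilon> D then ap f x else the_set (\<lambda>b. b \<epsilon> B \<and> ap g b = x))" for x
  have h1: "h x = ap f x \<and> x \<epsilon> A" if "x \<epsilon> D" for x
    using that D1 unfolding \<phi>_def h_def by simp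
  have inv: "the_set (\<lambda>b. b \<epsilon> B \<and> ap g b = ap g b') = b'" if "b' \<epsilon> B" for b'
    by (rule the_set_eq) (use g that in auto)
  have h2: "h x \<epsilon> B \<and> ap g (h x) = x \<and> \<not> (\<exists>y. y \<epsilon> D \<and> ap f y = h x)" if x: "x \<epsilon> A" "\<not> x \<epsilon> D" for x
  proof -
    obtain b where b: "b \<epsilon> B" "ap g b = x" "\<not> (\<exists>y. y \<epsilon> D \<and> ap f y = b)"
      using x D2 unfolding \<phi>_def by blast
    then have "h x = b" using inv x unfolding h_def by auto
    then show ?thesis using b by blast
  qed
  show ?thesis
  proof (rule in_bijectionI[where t = h])
    show "dfun (\<lambda>s. h (s 0))" unfolding h_def by (intro dintros dfun_ap dfun_the_set)
    show "h x \<epsilon> B" if "x \<epsilon> A" for x using that f h1 h2 by (cases "x \<epsilon> D") auto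
    show "x = y" if "x \<epsilon> A" "y \<epsilon> A" "h x = h y" for x y
    proof (cases "x \<epsilon> D"; cases "y \<epsilon> D")
      assume "x \<epsilon> D" "y \<epsilon> D" then show ?thesis using that f(2) h1 by auto
    next
      assume "x \<epsilon> D" "\<not> y \<epsilon> D" then show ?thesis using that h1[of x] h2[of y] by metis
    next
      assume "\<not> x \<epsilon> D" "y \<epsilon> D" then show ?thesis using that h1[of y] h2[of x] by metis
    next
      assume "\<not> x \<epsilon> D" "\<not> y \<epsilon> D" then show ?thesis using that h2[of x] h2[of y] by metis
    qed
    show "\<exists>x. x \<epsilon> A \<and> h x = b" if "b \<epsilon> B" for b
    proof (cases "\<exists>y. y \<epsilon> D \<and> ap f y = b")
      case True then show ?thesis using h1 by blast
    next
      case False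
      then have "\<not> \<phi> D (ap g b)" using that unfolding \<phi>_def by blast
      then have "\<not> ap g b \<epsilon> D" using D1 by blast
      then show ?thesis using inv[OF that] g(1)[OF that] unfolding h_def by auto
    qed
  qed
qed

section \<open>Ordinals and natural numbers\<close>

lemmas definability = dintros dfun_upair dfun_opair dfun_suc dfun_un dfun_power_set dfun_prod
  dfun_the_set dfun_ap dfun_lam dfun_restr dpred_subset dpred_fun_on dpred_maps dpred_inj_from_to
  dpred_injects

lemma foundation_min:
  assumes "x \<epsilon> a" obtains m where "m \<epsilon> a" "\<And>y. y \<epsilon> m \<Longrightarrow> \<not> y \<epsilon> a"
  using assms ZF unfolding ZF_def foundation_def by blast

lemma not_mem_self [simp]: "\<not> x \<epsilon> x"
proof -
  obtain m where "m \<epsilon> upair x x" "\<And>y. y \<epsilon> m \<Longrightarrow> \<not> y \<epsilon> upair x x"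
    using foundation_min[of x "upair x x"] by (metis upair_iff)
  then show ?thesis by auto
qed

lemma mem_asym: "x \<epsilon> y \<Longrightarrow> \<not> y \<epsilon> x"
proof -
  obtain m where "m \<epsilon> upair x y" "\<And>z. z \<epsilon> m \<Longrightarrow> \<not> z \<epsilon> upair x y"
    using foundation_min[of x "upair x y"] by (metis upair_iff)
  then show "x \<epsilon> y \<Longrightarrow> \<not> y \<epsilon> x" by auto
qed

lemma suc_inject [simp]: "suc a = suc b \<longleftrightarrow> a = b"
proof
  assume "suc a = suc b"
  then have "a \<epsilon> suc b" "b \<epsilon> suc a" using suc_iff[of a a] suc_iff[of b b] by auto
  then show "a = b" using mem_asym by auto
qed simp

lemma suc_neq_empty [simp]: "suc a \<noteq> empty" "empty \<noteq> suc a"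
  using suc_iff[of a a] empty_iff[of a] by metis+

lemma eq_empty_iff: "a = empty \<longleftrightarrow> (\<forall>x. \<not> x \<epsilon> a)"
  using extens[of a empty] by auto

lemma ordinal_mem: "ordinal a \<Longrightarrow> x \<epsilon> a \<Longrightarrow> ordinal x"
  unfolding ordinal_def transitive_def subset_def by blast

lemma ordinal_trans: "ordinal a \<Longrightarrow> x \<epsilon> y \<Longrightarrow> y \<epsilon> a \<Longrightarrow> x \<epsilon> a"
  unfolding ordinal_def transitive_def subset_def by blast

lemma ordinalI: "(\<And>x y. x \<epsilon> a \<Longrightarrow> y \<epsilon> x \<Longrightarrow> y \<epsilon> a) \<Longrightarrow> (\<And>x. x \<epsilon> a \<Longrightarrow> ordinal x) \<Longrightarrow> ordinal a"
  unfolding ordinal_def transitive_def subset_def by blast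

lemma ordinal_empty: "ordinal empty"
  by (rule ordinalI) auto

lemma ordinal_suc: "ordinal a \<Longrightarrow> ordinal (suc a)"
  by (rule ordinalI) (auto intro: ordinal_trans ordinal_mem)

lemma ordinal_UN:
  assumes "\<And>z. z \<epsilon> u \<longleftrightarrow> (\<exists>x. x \<epsilon> A \<and> z \<epsilon> t x)" "\<And>x. x \<epsilon> A \<Longrightarrow> ordinal (t x)"
  shows "ordinal u"
  by (rule ordinalI) (use assms ordinal_trans ordinal_mem in blast)+

lemma ordinal_un: "ordinal a \<Longrightarrow> ordinal b \<Longrightarrow> ordinal (un a b)"
  by (rule ordinalI) (auto intro: ordinal_trans ordinal_mem)

lemma dpred_ordinal: "dfun t \<Longrightarrow> dpred (\<lambda>s. ordinal (t s))"
  by (rule dpred_subst1) (unfold ordinal_def transitive_def, intro definability)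

text \<open>Restricted to definable predicates: the counterexamples inside \<open>suc a\<close> must
  form a set before foundation can provide a minimal one.\<close>

lemma ordinal_induct:
  assumes P: "dpred (\<lambda>s. P (s 0))" and step: "\<And>a. ordinal a \<Longrightarrow> (\<And>b. b \<epsilon> a \<Longrightarrow> P b) \<Longrightarrow> P a"
    and a: "ordinal a"
  shows "P a"
proof (rule ccontr)
  assume nP: "\<not> P a"
  have "is_set (\<lambda>x. x \<epsilon> suc a \<and> \<not> P x)"
    by (rule is_set_sep[where a = "suc a"]) (intro definability P, simp)
  then obtain S where S: "\<And>x. x \<epsilon> S \<longleftrightarrow> x \<epsilon> suc a \<and> \<not> P x" unfolding is_set_def by blast
  then have "a \<epsilon> S" using nP by simp
  then obtain m where m: "m \<epsilon> S" "\<And>y. y \<epsilon> m \<Longrightarrow> \<not> y \<epsilon> S" using foundation_min by blast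
  then have m': "m \<epsilon> suc a" "\<not> P m" using S by blast+
  have "P b" if "b \<epsilon> m" for b
    using m(2)[OF that] S ordinal_trans[OF ordinal_suc[OF a] that m'(1)] by blast
  then show False using step ordinal_mem[OF ordinal_suc[OF a] m'(1)] m'(2) by blast
qed

text \<open>Two nested inductions. If neither ordinal contains the other, each element of one must
  lie in the other, since the remaining cases of the induction hypothesis would, by transitivity,
  put one ordinal into the other.\<close>

lemma ordinal_linear:
  assumes a: "ordinal a" and b: "ordinal b" shows "a \<epsilon> b \<or> a = b \<or> b \<epsilon> a"
proof -
  have "\<forall>b. ordinal b \<longrightarrow> a \<epsilon> b \<or> a = b \<or> b \<epsilon> a"
  proof (rule ordinal_induct[where P = "\<lambda>a. \<forall>b. ordinal b \<longrightarrow> a \<epsilon> b \<or> a = b \<or> b \<epsilon> a", OF _ _ a])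
    show "dpred (\<lambda>s. \<forall>b. ordinal b \<longrightarrow> s 0 \<epsilon> b \<or> s 0 = b \<or> b \<epsilon> s 0)"
      by (intro definability dpred_ordinal)
    fix a assume a: "ordinal a" and IH: "\<And>x. x \<epsilon> a \<Longrightarrow> \<forall>b. ordinal b \<longrightarrow> x \<epsilon> b \<or> x = b \<or> b \<epsilon> x"
    have "a \<epsilon> b \<or> a = b \<or> b \<epsilon> a" if "ordinal b" for b
    proof (rule ordinal_induct[where P = "\<lambda>b. a \<epsilon> b \<or> a = b \<or> b \<epsilon> a", OF _ _ that])
      show "dpred (\<lambda>s. a \<epsilon> s 0 \<or> a = s 0 \<or> s 0 \<epsilon> a)" by (intro definability)
      fix b assume b: "ordinal b" and IHb: "\<And>y. y \<epsilon> b \<Longrightarrow> a \<epsilon> y \<or> a = y \<or> y \<epsilon> a"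
      have "a = b" if n: "\<not> a \<epsilon> b" "\<not> b \<epsilon> a"
      proof (rule extens)
        fix x
        have "x \<epsilon> b" if "x \<epsilon> a" using IH[OF that] b n that ordinal_trans[OF a _ that] by blast
        moreover have "x \<epsilon> a" if "x \<epsilon> b" using IHb[OF that] n that ordinal_trans[OF b _ that] by blast
        ultimately show "x \<epsilon> a \<longleftrightarrow> x \<epsilon> b" by blast
      qed
      then show "a \<epsilon> b \<or> a = b \<or> b \<epsilon> a" by blast
    qed
    then show "\<forall>b. ordinal b \<longrightarrow> a \<epsilon> b \<or> a = b \<or> b \<epsilon> a" by blast
  qed
  then show ?thesis using b by blast
qed

section \<open>Natural numbers and recursion along them\<close>

lemma dpred_zero_or_suc: "dfun t \<Longrightarrow> dpred (\<lambda>s. zero_or_suc (t s))"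
  by (rule dpred_subst1) (unfold zero_or_suc_def, intro definability)

text \<open>\<open>omega\<close> is defined without reference to an infinite set. Infinity supplies
  some inductive \<open>w\<close>, ordinal induction puts every candidate into \<open>w\<close>, and
  Separation cuts \<open>omega\<close> out of it.\<close>

lemma omega_iff: "n \<epsilon> omega \<longleftrightarrow> ordinal n \<and> zero_or_suc n \<and> (\<forall>k. k \<epsilon> n \<longrightarrow> zero_or_suc k)"
proof -
  let ?Q = "\<lambda>n. ordinal n \<and> zero_or_suc n \<and> (\<forall>k. k \<epsilon> n \<longrightarrow> zero_or_suc k)"
  have Q: "dpred (\<lambda>s. ?Q (s 0))" by (intro definability dpred_ordinal dpred_zero_or_suc)
  obtain w z where z: "z \<epsilon> w" "\<forall>u. \<not> u \<epsilon> z"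
    and w: "\<And>x. x \<epsilon> w \<Longrightarrow> \<exists>y. y \<epsilon> w \<and> (\<forall>u. u \<epsilon> y \<longleftrightarrow> u \<epsilon> x \<or> u = x)"
    using ZF unfolding ZF_def infinity_def by blast
  have ew: "empty \<epsilon> w" using z eq_empty_iff[of z] by simp
  have sw: "suc x \<epsilon> w" if x: "x \<epsilon> w" for x
  proof -
    obtain y where y: "y \<epsilon> w" "\<And>u. u \<epsilon> y \<longleftrightarrow> u \<epsilon> x \<or> u = x" using w[OF x] by blast
    then have "y = suc x" by (intro extens) simp
    then show ?thesis using y by simp
  qed
  have "n \<epsilon> w" if n: "?Q n" for n
  proof -
    have "?Q n \<longrightarrow> n \<epsilon> w"
    proof (rule ordinal_induct[where P = "\<lambda>n. ?Q n \<longrightarrow> n \<epsilon> w"])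
      show "dpred (\<lambda>s. ?Q (s 0) \<longrightarrow> s 0 \<epsilon> w)" by (intro Q definability)
      fix a assume a: "ordinal a" and IH: "\<And>b. b \<epsilon> a \<Longrightarrow> ?Q b \<longrightarrow> b \<epsilon> w"
      show "?Q a \<longrightarrow> a \<epsilon> w"
      proof
        assume Qa: "?Q a"
        show "a \<epsilon> w"
        proof (cases "a = empty")
          case False
          then obtain b where b: "a = suc b" using Qa unfolding zero_or_suc_def by blast
          then have "b \<epsilon> a" by simp
          then have "?Q b" using Qa ordinal_mem[OF a] ordinal_trans[OF a] by blast
          then show ?thesis using IH[OF \<open>b \<epsilon> a\<close>] sw b by blast
        qed (simp add: ew)
      qed
    qed (use n in blast)
    then show ?thesis using n by blast
  qed
  then show ?thesis unfolding omega_def by (intro mem_SET is_set_sep[where a = w] Q)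
qed

lemma omega_empty [simp]: "empty \<epsilon> omega"
  by (simp add: omega_iff ordinal_empty zero_or_suc_def)

lemma omega_suc [simp]: "suc n \<epsilon> omega \<longleftrightarrow> n \<epsilon> omega"
proof
  assume "suc n \<epsilon> omega"
  then show "n \<epsilon> omega" using ordinal_mem[of "suc n" n] unfolding omega_iff by auto
next
  assume "n \<epsilon> omega"
  then show "suc n \<epsilon> omega" using ordinal_suc[of n] unfolding omega_iff by (auto simp: zero_or_suc_def)
qed

lemma omega_mem: "n \<epsilon> omega \<Longrightarrow> k \<epsilon> n \<Longrightarrow> k \<epsilon> omega"
  unfolding omega_iff using ordinal_mem ordinal_trans by blast

lemma omega_cases:
  assumes "n \<epsilon> omega" obtains "n = empty" | k where "k \<epsilon> omega" "n = suc k"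
  using assms unfolding omega_iff[of n] zero_or_suc_def by (metis assms omega_suc)

lemma ordinal_omega: "ordinal omega"
proof (rule ordinalI)
  show "y \<epsilon> omega" if "x \<epsilon> omega" "y \<epsilon> x" for x y using omega_mem that .
  show "ordinal x" if "x \<epsilon> omega" for x using that omega_iff by blast
qed

lemma omega_induct:
  assumes P: "dpred (\<lambda>s. P (s 0))" and "P empty" and "\<And>n. n \<epsilon> omega \<Longrightarrow> P n \<Longrightarrow> P (suc n)"
    and n: "n \<epsilon> omega"
  shows "P n"
proof -
  have "n \<epsilon> omega \<longrightarrow> P n"
  proof (rule ordinal_induct[where P = "\<lambda>n. n \<epsilon> omega \<longrightarrow> P n"])
    show "dpred (\<lambda>s. s 0 \<epsilon> omega \<longrightarrow> P (s 0))" by (intro definability P)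
    show "ordinal n" using n omega_iff by blast
    show "a \<epsilon> omega \<longrightarrow> P a" if IH: "\<And>b. b \<epsilon> a \<Longrightarrow> b \<epsilon> omega \<longrightarrow> P b" for a
    proof
      assume "a \<epsilon> omega"
      then show "P a" by (cases rule: omega_cases) (use assms(2,3) IH in auto)
    qed
  qed
  then show ?thesis using n by blast
qed

text \<open>The third conclusion presents the least witness as a definable term, so that it can be
  used inside \<open>lam\<close> to choose for infinitely many arguments at once.\<close>

lemma omega_least:
  assumes P: "dpred (\<lambda>s. P (s 0))" and n: "n \<epsilon> omega" "P n"
  obtains m where "m \<epsilon> omega" "P m" "the_set (\<lambda>m. m \<epsilon> omega \<and> P m \<and> (\<forall>k. k \<epsilon> m \<longrightarrow> \<not> P k)) = m"
proof -
  have "is_set (\<lambda>m. m \<epsilon> omega \<and> P m)" by (rule is_set_sep[where a = omega]) (intro definability P, simp)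
  then obtain S where S: "\<And>m. m \<epsilon> S \<longleftrightarrow> m \<epsilon> omega \<and> P m" unfolding is_set_def by blast
  then have "n \<epsilon> S" using n by blast
  then obtain m where m: "m \<epsilon> S" "\<And>y. y \<epsilon> m \<Longrightarrow> \<not> y \<epsilon> S" using foundation_min by blast
  then have m': "m \<epsilon> omega" "P m" "\<And>k. k \<epsilon> m \<Longrightarrow> \<not> P k" using S omega_mem by blast+
  have "the_set (\<lambda>m. m \<epsilon> omega \<and> P m \<and> (\<forall>k. k \<epsilon> m \<longrightarrow> \<not> P k)) = m"
    by (rule the_set_eq) (use m' ordinal_linear[of _ m] ordinal_mem[OF ordinal_omega] in blast)+
  then show ?thesis using that m' by blast
qed

text \<open>\<open>g\<close> may be any set; only its values at the numbers up to \<open>n\<close>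
  are constrained. The extra \<open>y\<close> keeps the arguments of \<open>h\<close> variables, so
  that \<open>dfun_nrec\<close> asks for definability of \<open>h\<close> at variables only.\<close>

definition nrec_approx :: "'a \<Rightarrow> ('a \<Rightarrow> 'a \<Rightarrow> 'a) \<Rightarrow> 'a \<Rightarrow> 'a \<Rightarrow> bool" where
  "nrec_approx a h n g \<longleftrightarrow> ap g empty = a \<and>
     (\<forall>k y. k \<epsilon> n \<longrightarrow> y = ap g k \<longrightarrow> ap g (suc k) = h k y)"

definition nrec :: "'a \<Rightarrow> ('a \<Rightarrow> 'a \<Rightarrow> 'a) \<Rightarrow> 'a \<Rightarrow> 'a" where
  "nrec a h n = the_set (\<lambda>y. \<exists>g. nrec_approx a h n g \<and> y = ap g n)"

lemma dfun_nrec: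
  assumes a: "dfun a" and h: "dfun (\<lambda>s. h (\<lambda>n. s (Suc (Suc n))) (s (Suc 0)) (s 0))" and m: "dfun m"
  shows "dfun (\<lambda>s. nrec (a s) (\<lambda>k y. h s k y) (m s))"
proof -
  have h': "dfun (\<lambda>s. h (\<lambda>n. s (Suc (Suc (Suc (Suc n))))) (s (Suc 0)) (s 0))"
    using dfun_rename[OF h, of "case_nat 0 (case_nat (Suc 0) (\<lambda>n. Suc (Suc (Suc (Suc n)))))"] by simp
  have a': "dfun (\<lambda>s. a (\<lambda>n. s (Suc (Suc n))))" by (rule dfun_rename[OF a])
  have m': "dfun (\<lambda>s. m (\<lambda>n. s (Suc (Suc n))))" by (rule dfun_rename[OF m])
  have m'': "dfun (\<lambda>s. m (\<lambda>n. s (Suc (Suc (Suc (Suc n))))))" by (rule dfun_rename[OF m])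
  show ?thesis unfolding nrec_def nrec_approx_def by (intro definability h' a' m' m'')
qed

context
  fixes h assumes h: "dfun (\<lambda>s. h (s 0) (s (Suc 0)))"
begin

lemma nrec_approx_suc:
  assumes n: "n \<epsilon> omega" and g: "nrec_approx a h n g"
  shows "\<exists>g'. nrec_approx a h (suc n) g'"
proof -
  let ?t = "\<lambda>k. if k = suc n then h n (ap g n) else ap g k"
  have t: "dfun (\<lambda>s. ?t (s 0))" by (intro definability dfun_subst2[OF h])
  let ?g = "lam (suc (suc n)) ?t"
  have on: "ordinal n" using n omega_iff by blast
  have ap: "ap ?g k = ?t k" if "k \<epsilon> suc (suc n)" for k by (rule ap_lam[OF t that])
  have s: "suc k \<epsilon> suc n" if "k \<epsilon> n" for k
    using ordinal_linear[of "suc k" n] ordinal_suc[OF ordinal_mem[OF on that]] on that mem_asym[OF that]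
    by auto
  have n1: "k \<noteq> suc n" if "k \<epsilon> suc n" for k using that not_mem_self by metis
  have "empty \<epsilon> suc n" using ordinal_linear[OF ordinal_empty ordinal_suc[OF on]] by auto
  then have "ap ?g empty = a" using ap[of empty] g unfolding nrec_approx_def by auto
  moreover have "ap ?g (suc k) = h k (ap ?g k)" if "k \<epsilon> suc n" for k
  proof (cases "k = n")
    case True then show ?thesis using ap[of "suc n"] ap[of n] n1[of n] by simp
  next
    case False
    then have "k \<epsilon> n" using that by simp
    then show ?thesis using ap[of "suc k"] ap[of k] s[of k] n1[of k] n1[of "suc k"] g
      unfolding nrec_approx_def by auto
  qed
  ultimately show ?thesis unfolding nrec_approx_def by blast
qed

lemma nrec_approx_unique:
  assumes n: "n \<epsilon> omega" and g: "nrec_approx a h n g" "nrec_approx a h n g'"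
  shows "ap g n = ap g' n"
proof -
  have on: "ordinal n" using n omega_iff by blast
  have "k \<epsilon> suc n \<longrightarrow> ap g k = ap g' k" if "k \<epsilon> omega" for k
  proof (rule omega_induct[where P = "\<lambda>k. k \<epsilon> suc n \<longrightarrow> ap g k = ap g' k", OF _ _ _ that])
    show "dpred (\<lambda>s. s 0 \<epsilon> suc n \<longrightarrow> ap g (s 0) = ap g' (s 0))" by (intro definability)
    show "empty \<epsilon> suc n \<longrightarrow> ap g empty = ap g' empty" using g unfolding nrec_approx_def by simp
    fix k assume "k \<epsilon> omega" and IH: "k \<epsilon> suc n \<longrightarrow> ap g k = ap g' k"
    show "suc k \<epsilon> suc n \<longrightarrow> ap g (suc k) = ap g' (suc k)"
    proof
      assume "suc k \<epsilon> suc n"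
      then have "k \<epsilon> n" using ordinal_trans[OF on, of k "suc k"] by auto
      then show "ap g (suc k) = ap g' (suc k)" using IH g unfolding nrec_approx_def by simp
    qed
  qed
  then show ?thesis using n by simp
qed

lemma nrec_approx_ex: "n \<epsilon> omega \<Longrightarrow> \<exists>g. nrec_approx a h n g"
proof (rule omega_induct[where P = "\<lambda>n. \<exists>g. nrec_approx a h n g"])
  show "dpred (\<lambda>s. \<exists>g. nrec_approx a h (s 0) g)"
    unfolding nrec_approx_def by (intro definability dfun_subst2[OF h])
  have "ap (lam (suc empty) (\<lambda>_. a)) empty = a" by (rule ap_lam) (intro definability, simp)
  then show "\<exists>g. nrec_approx a h empty g" unfolding nrec_approx_def by auto
qed (use nrec_approx_suc in blast)

lemma nrec_eq: "n \<epsilon> omega \<Longrightarrow> nrec_approx a h n g \<Longrightarrow> nrec a h n = ap g n"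
  unfolding nrec_def by (rule the_set_eq) (use nrec_approx_unique in blast)+

lemma nrec_empty: "nrec a h empty = a"
proof -
  obtain g where g: "nrec_approx a h empty g" using nrec_approx_ex omega_empty by blast
  then show ?thesis using nrec_eq[OF omega_empty g] by (simp add: nrec_approx_def)
qed

lemma nrec_suc: "n \<epsilon> omega \<Longrightarrow> nrec a h (suc n) = h n (nrec a h n)"
proof -
  assume n: "n \<epsilon> omega"
  then obtain g where g: "nrec_approx a h (suc n) g" using nrec_approx_ex omega_suc by blast
  then have "nrec_approx a h n g" by (simp add: nrec_approx_def)
  then show ?thesis using nrec_eq[OF _ g] nrec_eq[of n a g] n g by (simp add: nrec_approx_def)
qed

end

section \<open>Countable sets, reals and countable ordinals\<close>

definition pfst :: "'a \<Rightarrow> 'a" where "pfst p = the_set (\<lambda>x. \<exists>y. p = opair x y)"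
definition psnd :: "'a \<Rightarrow> 'a" where "psnd p = the_set (\<lambda>y. \<exists>x. p = opair x y)"

lemma pfst_opair [simp]: "pfst (opair x y) = x"
  unfolding pfst_def by (rule the_set_eq) auto

lemma psnd_opair [simp]: "psnd (opair x y) = y"
  unfolding psnd_def by (rule the_set_eq) auto

lemma dfun_pfst: "dfun t \<Longrightarrow> dfun (\<lambda>s. pfst (t s))"
  by (rule dfun_subst1) (unfold pfst_def, intro definability)

lemma dfun_psnd: "dfun t \<Longrightarrow> dfun (\<lambda>s. psnd (t s))"
  by (rule dfun_subst1) (unfold psnd_def, intro definability)

definition dbl :: "'a \<Rightarrow> 'a" where
  "dbl n = nrec empty (\<lambda>_ y. suc (suc y)) n"

lemma dfun_dbl: "dfun t \<Longrightarrow> dfun (\<lambda>s. dbl (t s))"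
  by (rule dfun_subst1) (unfold dbl_def, intro definability dfun_nrec)

lemma dbl_empty [simp]: "dbl empty = empty"
  unfolding dbl_def by (rule nrec_empty) (intro definability)

lemma dbl_suc [simp]: "n \<epsilon> omega \<Longrightarrow> dbl (suc n) = suc (suc (dbl n))"
  unfolding dbl_def by (rule nrec_suc) (intro definability)

lemma dbl_omega [simp]: "n \<epsilon> omega \<Longrightarrow> dbl n \<epsilon> omega"
  by (rule omega_induct[where P = "\<lambda>n. dbl n \<epsilon> omega"]) (intro definability dfun_dbl, simp_all)

lemma dbl_inject:
  assumes "m \<epsilon> omega" "n \<epsilon> omega" "dbl m = dbl n" shows "m = n"
proof -
  have "\<forall>n. n \<epsilon> omega \<longrightarrow> dbl m = dbl n \<longrightarrow> m = n"
  proof (rule omega_induct[where P = "\<lambda>m. \<forall>n. n \<epsilon> omega \<longrightarrow> dbl m = dbl n \<longrightarrow> m = n", OF _ _ _ assms(1)])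
    show "dpred (\<lambda>s. \<forall>n. n \<epsilon> omega \<longrightarrow> dbl (s 0) = dbl n \<longrightarrow> s 0 = n)" by (intro definability dfun_dbl)
    show "\<forall>n. n \<epsilon> omega \<longrightarrow> dbl empty = dbl n \<longrightarrow> empty = n"
    proof (intro allI impI)
      fix n assume "n \<epsilon> omega" "dbl empty = dbl n"
      then show "empty = n" by (cases rule: omega_cases) auto
    qed
    fix m assume m: "m \<epsilon> omega" and IH: "\<forall>n. n \<epsilon> omega \<longrightarrow> dbl m = dbl n \<longrightarrow> m = n"
    show "\<forall>n. n \<epsilon> omega \<longrightarrow> dbl (suc m) = dbl n \<longrightarrow> suc m = n"
    proof (intro allI impI)
      fix n assume "n \<epsilon> omega" "dbl (suc m) = dbl n"
      then show "suc m = n" by (cases rule: omega_cases) (use m IH in auto)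
    qed
  qed
  then show ?thesis using assms by blast
qed

lemma dbl_neq_suc_dbl:
  assumes "m \<epsilon> omega" "n \<epsilon> omega" shows "dbl m \<noteq> suc (dbl n)"
proof -
  have "\<forall>n. n \<epsilon> omega \<longrightarrow> dbl m \<noteq> suc (dbl n)"
  proof (rule omega_induct[where P = "\<lambda>m. \<forall>n. n \<epsilon> omega \<longrightarrow> dbl m \<noteq> suc (dbl n)", OF _ _ _ assms(1)])
    show "dpred (\<lambda>s. \<forall>n. n \<epsilon> omega \<longrightarrow> dbl (s 0) \<noteq> suc (dbl n))" by (intro definability dfun_dbl)
    fix m assume m: "m \<epsilon> omega" and IH: "\<forall>n. n \<epsilon> omega \<longrightarrow> dbl m \<noteq> suc (dbl n)"
    show "\<forall>n. n \<epsilon> omega \<longrightarrow> dbl (suc m) \<noteq> suc (dbl n)"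
    proof (intro allI impI)
      fix n assume "n \<epsilon> omega"
      then show "dbl (suc m) \<noteq> suc (dbl n)" by (cases rule: omega_cases) (use m IH in auto)
    qed
  qed simp
  then show ?thesis using assms by blast
qed

lemma dbl_or_suc_dbl: "n \<epsilon> omega \<Longrightarrow> \<exists>k. k \<epsilon> omega \<and> (n = dbl k \<or> n = suc (dbl k))"
proof (rule omega_induct[where P = "\<lambda>n. \<exists>k. k \<epsilon> omega \<and> (n = dbl k \<or> n = suc (dbl k))"])
  show "dpred (\<lambda>s. \<exists>k. k \<epsilon> omega \<and> (s 0 = dbl k \<or> s 0 = suc (dbl k)))" by (intro definability dfun_dbl)
  show "\<exists>k. k \<epsilon> omega \<and> (empty = dbl k \<or> empty = suc (dbl k))" using dbl_empty omega_empty by metis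
  show "\<exists>k. k \<epsilon> omega \<and> (suc n = dbl k \<or> suc n = suc (dbl k))"
    if "\<exists>k. k \<epsilon> omega \<and> (n = dbl k \<or> n = suc (dbl k))" for n
    using that dbl_suc omega_suc by metis
qed

text \<open>The pairing function \<open>(m, n) \<mapsto> 2\<^sup>m (2n + 1)\<close>.\<close>

definition npair :: "'a \<Rightarrow> 'a \<Rightarrow> 'a" where
  "npair m n = nrec (suc (dbl n)) (\<lambda>_ y. dbl y) m"

lemma dfun_npair: "dfun t \<Longrightarrow> dfun u \<Longrightarrow> dfun (\<lambda>s. npair (t s) (u s))"
  by (rule dfun_subst2) (unfold npair_def, intro definability dfun_dbl dfun_nrec)

lemma npair_empty [simp]: "npair empty n = suc (dbl n)"
  unfolding npair_def by (rule nrec_empty) (intro definability dfun_dbl)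

lemma npair_suc [simp]: "m \<epsilon> omega \<Longrightarrow> npair (suc m) n = dbl (npair m n)"
  unfolding npair_def by (rule nrec_suc) (intro definability dfun_dbl)

lemma npair_omega [simp]: "m \<epsilon> omega \<Longrightarrow> n \<epsilon> omega \<Longrightarrow> npair m n \<epsilon> omega"
  by (rule omega_induct[where P = "\<lambda>m. npair m n \<epsilon> omega"]) (intro definability dfun_npair, simp_all)

text \<open>Parity decides whether the first component is \<open>empty\<close>; if it is not, both
  sides are doubles and halving them lowers the first component by one.\<close>

lemma npair_inject:
  assumes "m \<epsilon> omega" "n \<epsilon> omega" "m' \<epsilon> omega" "n' \<epsilon> omega" "npair m n = npair m' n'"
  shows "m = m' \<and> n = n'"
proof -
  have "\<forall>m'. m' \<epsilon> omega \<longrightarrow> npair m n = npair m' n' \<longrightarrow> m = m' \<and> n = n'"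
  proof (rule omega_induct[where P = "\<lambda>m. \<forall>m'. m' \<epsilon> omega \<longrightarrow> npair m n = npair m' n' \<longrightarrow> m = m' \<and> n = n'",
        OF _ _ _ assms(1)])
    show "dpred (\<lambda>s. \<forall>m'. m' \<epsilon> omega \<longrightarrow> npair (s 0) n = npair m' n' \<longrightarrow> s 0 = m' \<and> n = n')"
      by (intro definability dfun_npair)
    show "\<forall>m'. m' \<epsilon> omega \<longrightarrow> npair empty n = npair m' n' \<longrightarrow> empty = m' \<and> n = n'"
    proof (intro allI impI)
      fix m' assume m': "m' \<epsilon> omega" and eq: "npair empty n = npair m' n'"
      show "empty = m' \<and> n = n'" using m'
      proof (cases rule: omega_cases)
        case 1 then show ?thesis using eq assms dbl_inject[of n n'] by auto
      next
        case (2 k) then show ?thesis using eq assms dbl_neq_suc_dbl[of "npair k n'" n] by auto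
      qed
    qed
    fix m assume m: "m \<epsilon> omega"
      and IH: "\<forall>m'. m' \<epsilon> omega \<longrightarrow> npair m n = npair m' n' \<longrightarrow> m = m' \<and> n = n'"
    show "\<forall>m'. m' \<epsilon> omega \<longrightarrow> npair (suc m) n = npair m' n' \<longrightarrow> suc m = m' \<and> n = n'"
    proof (intro allI impI)
      fix m' assume "m' \<epsilon> omega" "npair (suc m) n = npair m' n'"
      then show "suc m = m' \<and> n = n'"
        by (cases rule: omega_cases)
          (use m IH assms(2,4) dbl_inject[of "npair m n"] dbl_neq_suc_dbl[of "npair m n" n'] in auto)
    qed
  qed
  then show ?thesis using assms by blast
qed

text \<open>The set of doubles alternates from 0 on, so it can serve as the witness
  \<open>e\<close>. Any other witness agrees with it up to \<open>n\<close>, because the start and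
  the alternation leave no freedom.\<close>

lemma even_nat_iff:
  assumes "n \<epsilon> omega" shows "even_nat n \<longleftrightarrow> (\<exists>k. k \<epsilon> omega \<and> n = dbl k)"
proof -
  have "is_set (\<lambda>n. n \<epsilon> omega \<and> (\<exists>k. k \<epsilon> omega \<and> n = dbl k))"
    by (rule is_set_sep[where a = omega]) (intro definability dfun_dbl, simp)
  then obtain e where e: "\<And>n. n \<epsilon> e \<longleftrightarrow> n \<epsilon> omega \<and> (\<exists>k. k \<epsilon> omega \<and> n = dbl k)"
    unfolding is_set_def by blast
  have e0: "empty \<epsilon> e" using e dbl_empty omega_empty by metis
  have es: "suc k \<epsilon> e \<longleftrightarrow> \<not> k \<epsilon> e" if k: "k \<epsilon> omega" for k
  proof
    assume "suc k \<epsilon> e"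
    then obtain i where "i \<epsilon> omega" "suc k = dbl i" using e by blast
    then show "\<not> k \<epsilon> e" using e dbl_neq_suc_dbl[of i] by metis
  next
    assume "\<not> k \<epsilon> e"
    then obtain i where "i \<epsilon> omega" "k = suc (dbl i)" using e k dbl_or_suc_dbl[OF k] by blast
    then show "suc k \<epsilon> e" using e k dbl_suc omega_suc by metis
  qed
  have "n \<epsilon> e' \<longleftrightarrow> n \<epsilon> e" if e': "empty \<epsilon> e'" "\<forall>k. k \<epsilon> n \<longrightarrow> (suc k \<epsilon> e' \<longleftrightarrow> \<not> k \<epsilon> e')" for e'
  proof -
    have "k \<epsilon> suc n \<longrightarrow> (k \<epsilon> e' \<longleftrightarrow> k \<epsilon> e)" if k: "k \<epsilon> omega" for k
    proof (rule omega_induct[where P = "\<lambda>k. k \<epsilon> suc n \<longrightarrow> (k \<epsilon> e' \<longleftrightarrow> k \<epsilon> e)", OF _ _ _ k])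
      show "dpred (\<lambda>s. s 0 \<epsilon> suc n \<longrightarrow> (s 0 \<epsilon> e' \<longleftrightarrow> s 0 \<epsilon> e))" by (intro definability)
      show "empty \<epsilon> suc n \<longrightarrow> (empty \<epsilon> e' \<longleftrightarrow> empty \<epsilon> e)" using e' e0 by simp
      fix k assume k: "k \<epsilon> omega" and IH: "k \<epsilon> suc n \<longrightarrow> (k \<epsilon> e' \<longleftrightarrow> k \<epsilon> e)"
      show "suc k \<epsilon> suc n \<longrightarrow> (suc k \<epsilon> e' \<longleftrightarrow> suc k \<epsilon> e)"
      proof
        assume "suc k \<epsilon> suc n"
        then have "k \<epsilon> n"
          using ordinal_trans[of n k "suc k"] ordinal_mem[OF ordinal_omega assms] by auto
        then show "suc k \<epsilon> e' \<longleftrightarrow> suc k \<epsilon> e" using e' IH es[OF k] by simp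
      qed
    qed
    then show ?thesis using assms by simp
  qed
  moreover have "\<forall>k. k \<epsilon> n \<longrightarrow> (suc k \<epsilon> e \<longleftrightarrow> \<not> k \<epsilon> e)" using es omega_mem[OF assms] by blast
  ultimately have "even_nat n \<longleftrightarrow> n \<epsilon> e" unfolding even_nat_def using e0 by blast
  then show ?thesis using e assms by blast
qed

lemma even_nat_dbl: "n \<epsilon> omega \<Longrightarrow> even_nat (dbl n)"
  using even_nat_iff by auto

lemma not_even_nat_suc_dbl: "n \<epsilon> omega \<Longrightarrow> \<not> even_nat (suc (dbl n))"
  using even_nat_iff[of "suc (dbl n)"] dbl_neq_suc_dbl by auto metis

lemma dpred_even_nat: "dfun t \<Longrightarrow> dpred (\<lambda>s. even_nat (t s))"
  by (rule dpred_subst1) (unfold even_nat_def, intro definability)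

section \<open>Countable sets and sets that inject into the reals\<close>

definition countable :: "'a \<Rightarrow> bool" where
  "countable A \<longleftrightarrow> injects A omega"

definition counts :: "'a \<Rightarrow> 'a \<Rightarrow> bool" where
  "counts c A \<longleftrightarrow> (\<forall>x. x \<epsilon> A \<longrightarrow> ap c x \<epsilon> omega) \<and>
     (\<forall>x y. x \<epsilon> A \<longrightarrow> y \<epsilon> A \<longrightarrow> ap c x = ap c y \<longrightarrow> x = y)"

lemma countsD:
  assumes "counts c A"
  shows "x \<epsilon> A \<Longrightarrow> ap c x \<epsilon> omega" "x \<epsilon> A \<Longrightarrow> y \<epsilon> A \<Longrightarrow> ap c x = ap c y \<Longrightarrow> x = y"
  using assms unfolding counts_def by blast+

lemma countable_iff: "countable A \<longleftrightarrow> (\<exists>c. counts c A)"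
proof
  assume "countable A"
  then show "\<exists>c. counts c A" unfolding countable_def counts_def by (elim injectsE) blast
next
  assume "\<exists>c. counts c A"
  then obtain c where "counts c A" by blast
  then show "countable A" unfolding countable_def
    by (intro injectsI[where t = "ap c"]) (auto intro: countsD dfun_ap dfun_const dfun_var)
qed

lemma dpred_counts: "dfun t \<Longrightarrow> dfun u \<Longrightarrow> dpred (\<lambda>s. counts (t s) (u s))"
  by (rule dpred_subst2) (unfold counts_def, intro definability)

lemma countable_injects: "injects A B \<Longrightarrow> countable B \<Longrightarrow> countable A"
  unfolding countable_def by (rule injects_trans)

lemma countable_subset: "subset A B \<Longrightarrow> countable B \<Longrightarrow> countable A"
  by (rule countable_injects[OF injects_subset])

lemma countable_omega: "countable omega"
  unfolding countable_def by (rule injects_subset) (simp add: subset_def)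

lemma countable_prod:
  assumes "countable A" "countable B" shows "countable (prod A B)"
proof -
  obtain a b where a: "counts a A" and b: "counts b B" using assms countable_iff by blast
  show ?thesis unfolding countable_def
  proof (rule injectsI[where t = "\<lambda>p. npair (ap a (pfst p)) (ap b (psnd p))"])
    show "dfun (\<lambda>s. npair (ap a (pfst (s 0))) (ap b (psnd (s 0))))"
      by (intro definability dfun_npair dfun_pfst dfun_psnd)
    show "npair (ap a (pfst p)) (ap b (psnd p)) \<epsilon> omega" if "p \<epsilon> prod A B" for p
      using that countsD[OF a] countsD[OF b] by (auto simp: prod_iff)
    show "p = q" if "p \<epsilon> prod A B" "q \<epsilon> prod A B"
      "npair (ap a (pfst p)) (ap b (psnd p)) = npair (ap a (pfst q)) (ap b (psnd q))" for p q
    proof -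
      obtain x y where p: "x \<epsilon> A" "y \<epsilon> B" "p = opair x y" using \<open>p \<epsilon> prod A B\<close> prod_iff by blast
      obtain u v where q: "u \<epsilon> A" "v \<epsilon> B" "q = opair u v" using \<open>q \<epsilon> prod A B\<close> prod_iff by blast
      have "npair (ap a x) (ap b y) = npair (ap a u) (ap b v)" using that p q by simp
      then have "ap a x = ap a u \<and> ap b y = ap b v"
        by (intro npair_inject countsD(1)[OF a] countsD(1)[OF b] p q)
      then show ?thesis using p q countsD(2)[OF a] countsD(2)[OF b] by blast
    qed
  qed
qed

lemma is_set_disjoint_sum:
  "is_set (\<lambda>p. (\<exists>x. x \<epsilon> A \<and> p = opair empty x) \<or> (\<exists>y. y \<epsilon> B \<and> p = opair (suc empty) y))"
  by (rule is_set_sep[where a = "prod omega (un A B)"]) (intro definability, auto)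

lemma disjoint_sum_iff: "p \<epsilon> disjoint_sum A B \<longleftrightarrow>
    (\<exists>x. x \<epsilon> A \<and> p = opair empty x) \<or> (\<exists>y. y \<epsilon> B \<and> p = opair (suc empty) y)"
  unfolding disjoint_sum_def by (rule mem_SET[OF is_set_disjoint_sum])

lemma dfun_disjoint_sum: "dfun t \<Longrightarrow> dfun u \<Longrightarrow> dfun (\<lambda>s. disjoint_sum (t s) (u s))"
  by (rule dfun_subst2) (unfold disjoint_sum_def, intro definability)

lemma injects_prod_mono:
  assumes "injects A A'" "injects B B'" shows "injects (prod A B) (prod A' B')"
proof -
  obtain a where a: "\<And>x. x \<epsilon> A \<Longrightarrow> ap a x \<epsilon> A'"
    "\<And>x y. x \<epsilon> A \<Longrightarrow> y \<epsilon> A \<Longrightarrow> ap a x = ap a y \<Longrightarrow> x = y" using assms(1) by (rule injectsE) blast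
  obtain b where b: "\<And>x. x \<epsilon> B \<Longrightarrow> ap b x \<epsilon> B'"
    "\<And>x y. x \<epsilon> B \<Longrightarrow> y \<epsilon> B \<Longrightarrow> ap b x = ap b y \<Longrightarrow> x = y" using assms(2) by (rule injectsE) blast
  show ?thesis
  proof (rule injectsI[where t = "\<lambda>p. opair (ap a (pfst p)) (ap b (psnd p))"])
    show "dfun (\<lambda>s. opair (ap a (pfst (s 0))) (ap b (psnd (s 0))))"
      by (intro definability dfun_pfst dfun_psnd)
  qed (use a b in \<open>auto simp: prod_iff\<close>)
qed

lemma countable_disjoint_sum:
  assumes "countable A" "countable B" shows "countable (disjoint_sum A B)"
proof -
  obtain a b where a: "counts a A" and b: "counts b B" using assms countable_iff by blast
  let ?t = "\<lambda>p. opair (pfst p) (if pfst p = empty then ap a (psnd p) else ap b (psnd p))"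
  have "injects (disjoint_sum A B) (prod omega omega)"
  proof (rule injectsI[where t = ?t])
    show "dfun (\<lambda>s. ?t (s 0))" by (intro definability dfun_pfst dfun_psnd)
  qed (use countsD[OF a] countsD[OF b] in \<open>auto simp: disjoint_sum_iff\<close>)
  then show ?thesis by (rule countable_injects) (intro countable_prod countable_omega)
qed

text \<open>Lets two pieces of data, such as the code of an ordinal and a relation transported along
  it, be packed into one real.\<close>

lemma injects_prod_power_set:
  "injects (prod (power_set A) (power_set B)) (power_set (disjoint_sum A B))"
proof (rule injectsI[where t = "\<lambda>p. disjoint_sum (pfst p) (psnd p)"])
  show "dfun (\<lambda>s. disjoint_sum (pfst (s 0)) (psnd (s 0)))"
    by (intro definability dfun_disjoint_sum dfun_pfst dfun_psnd)
  show "disjoint_sum (pfst p) (psnd p) \<epsilon> power_set (disjoint_sum A B)"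
    if "p \<epsilon> prod (power_set A) (power_set B)" for p
    using that by (auto simp: prod_iff subset_def disjoint_sum_iff)
  fix p q
  assume "p \<epsilon> prod (power_set A) (power_set B)" "q \<epsilon> prod (power_set A) (power_set B)"
    and eq: "disjoint_sum (pfst p) (psnd p) = disjoint_sum (pfst q) (psnd q)"
  have "x \<epsilon> pfst p \<longleftrightarrow> x \<epsilon> pfst q" "x \<epsilon> psnd p \<longleftrightarrow> x \<epsilon> psnd q" for x
    using disjoint_sum_iff[of "opair empty x" "pfst p" "psnd p"]
      disjoint_sum_iff[of "opair (suc empty) x" "pfst p" "psnd p"]
      disjoint_sum_iff[of "opair empty x" "pfst q" "psnd q"]
      disjoint_sum_iff[of "opair (suc empty) x" "pfst q" "psnd q"] eq by auto
  then have "pfst p = pfst q" "psnd p = psnd q" by (auto intro: extens)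
  then show "p = q"
    using \<open>p \<epsilon> prod _ _\<close> \<open>q \<epsilon> prod _ _\<close> by (auto simp: prod_iff)
qed

lemma maps_subset_prod: "maps f A B \<Longrightarrow> subset f (prod A B)"
  unfolding maps_iff subset_def by (auto simp: mem_fun_on_iff)

lemma fun_space_iff: "f \<epsilon> fun_space A B \<longleftrightarrow> maps f A B"
  unfolding fun_space_def
  by (rule mem_SET, rule is_set_sep[where a = "power_set (prod A B)"])
     (intro definability, simp add: maps_subset_prod)

lemma reals_iff: "x \<epsilon> reals \<longleftrightarrow> maps x omega omega"
  unfolding reals_def by (rule fun_space_iff)

lemma power_set_injects_reals:
  assumes "countable A" shows "injects (power_set A) reals"
proof -
  obtain c where c: "counts c A" using assms countable_iff by blast
  let ?u = "\<lambda>S n. if \<exists>a. a \<epsilon> S \<and> ap c a = n then suc empty else empty"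
  have u: "dfun (\<lambda>s. ?u S (s 0))" for S by (intro definability)
  show ?thesis
  proof (rule injectsI[where t = "\<lambda>S. lam omega (?u S)"])
    show "dfun (\<lambda>s. lam omega (?u (s 0)))" by (intro definability)
    show "lam omega (?u S) \<epsilon> reals" for S
      unfolding reals_iff by (rule maps_lam[OF u]) auto
    fix S T assume S: "S \<epsilon> power_set A" and T: "T \<epsilon> power_set A" and eq: "lam omega (?u S) = lam omega (?u T)"
    have u: "?u S n = ?u T n" if "n \<epsilon> omega" for n
      using ap_lam[OF u that, of S] ap_lam[OF u that, of T] eq by simp
    have "x \<epsilon> S \<longleftrightarrow> x \<epsilon> T" if x: "x \<epsilon> A" for x
    proof -
      have "(\<exists>a. a \<epsilon> S \<and> ap c a = ap c x) \<longleftrightarrow> (\<exists>a. a \<epsilon> T \<and> ap c a = ap c x)"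
        using u[OF countsD(1)[OF c x]] by (auto split: if_splits)
      moreover have "(\<exists>a. a \<epsilon> S \<and> ap c a = ap c x) \<longleftrightarrow> x \<epsilon> S"
        using S countsD(2)[OF c _ x] unfolding power_set_iff subset_def by blast
      moreover have "(\<exists>a. a \<epsilon> T \<and> ap c a = ap c x) \<longleftrightarrow> x \<epsilon> T"
        using T countsD(2)[OF c _ x] unfolding power_set_iff subset_def by blast
      ultimately show ?thesis by blast
    qed
    then show "S = T" using S T by (intro extens) (auto simp: subset_def)
  qed
qed

lemma reals_subset: "subset reals (power_set (prod omega omega))"
  unfolding subset_def[of reals] by (simp add: reals_iff maps_subset_prod)

lemma prod_power_set_injects_reals:
  "countable A \<Longrightarrow> countable B \<Longrightarrow> injects (prod (power_set A) (power_set B)) reals"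
  by (rule injects_trans[OF injects_prod_power_set power_set_injects_reals[OF countable_disjoint_sum]])

lemma prod_reals_injects_reals: "injects (prod reals reals) reals"
proof -
  have "injects reals (power_set (prod omega omega))" by (rule injects_subset[OF reals_subset])
  moreover have "countable (prod omega omega)" by (intro countable_prod countable_omega)
  ultimately show ?thesis
    by (intro injects_trans[OF injects_prod_mono prod_power_set_injects_reals])
qed

lemma const_real: "lam omega (\<lambda>_. n) \<epsilon> reals" if "n \<epsilon> omega"
  unfolding reals_iff by (rule maps_lam[OF dfun_const that])

text \<open>The order of \<open>d\<close> carried over to natural numbers. It is taken reflexive so
  that its field is the whole image of \<open>d\<close>: the strict order would be empty for both
  \<open>empty\<close> and \<open>suc empty\<close>.\<close>

definition code :: "'a \<Rightarrow> 'a \<Rightarrow> 'a" where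
  "code d c = (SET p. \<exists>u v. u \<epsilon> d \<and> v \<epsilon> d \<and> (u \<epsilon> v \<or> u = v) \<and> p = opair (ap c u) (ap c v))"

lemma dfun_code: "dfun t \<Longrightarrow> dfun u \<Longrightarrow> dfun (\<lambda>s. code (t s) (u s))"
  by (rule dfun_subst2) (unfold code_def, intro definability)

lemma code_iff:
  assumes "counts c d"
  shows "p \<epsilon> code d c \<longleftrightarrow> (\<exists>u v. u \<epsilon> d \<and> v \<epsilon> d \<and> (u \<epsilon> v \<or> u = v) \<and> p = opair (ap c u) (ap c v))"
  unfolding code_def
  by (rule mem_SET, rule is_set_sep[where a = "prod omega omega"])
     (intro definability, use countsD(1)[OF assms] in auto)

lemma code_subset: "counts c d \<Longrightarrow> subset (code d c) (prod omega omega)"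
  unfolding subset_def by (auto simp: code_iff countsD(1))

text \<open>Wellorders are rigid. Equal codes make the correspondence given by
  \<open>ap c u = ap c' u'\<close> an isomorphism between \<open>d\<close> and \<open>d'\<close>,
  and by induction an isomorphism of ordinals fixes every element. So the code remembers the
  counting as well as the ordinal.\<close>

lemma code_unique:
  assumes d: "ordinal d" "counts c d" and d': "ordinal d'" "counts c' d'" and eq: "code d c = code d' c'"
  shows "d = d' \<and> (\<forall>u. u \<epsilon> d \<longrightarrow> ap c u = ap c' u)"
proof -
  \<comment> \<open>Stated for arbitrary codes, as is the next claim, because both are applied in
    the two directions between \<open>d\<close> and \<open>d'\<close>.\<close>
  have le: "\<exists>u v. u \<epsilon> e \<and> v \<epsilon> e \<and> (u \<epsilon> v \<or> u = v) \<and> ap a w = ap b u \<and> ap a x = ap b v"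
    if "counts a D" "counts b e" "code D a = code e b" "w \<epsilon> D" "x \<epsilon> D" "w \<epsilon> x \<or> w = x" for a b D e w x
  proof -
    have "opair (ap a w) (ap a x) \<epsilon> code D a" using that code_iff by blast
    then show ?thesis using that by (simp add: code_iff)
  qed
  \<comment> \<open>The coded pair for \<open>w\<close> and \<open>u\<close> comes from some
    \<open>w'\<close> and \<open>v'\<close> in \<open>e\<close>. Injectivity of \<open>b\<close>
    identifies \<open>v'\<close> with \<open>u'\<close>, and \<open>w' = v'\<close> would force
    \<open>w = u\<close>, so \<open>w'\<close> lies strictly below \<open>u'\<close>.\<close>
  have below: "\<exists>w'. w' \<epsilon> u' \<and> ap a w = ap b w'"
    if a: "counts a D" "counts b e" "ordinal D" "code D a = code e b" "u \<epsilon> D" "u' \<epsilon> e" "ap a u = ap b u'" "w \<epsilon> u"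
    for a b D e u u' w
  proof -
    have w: "w \<epsilon> D" using a ordinal_trans by blast
    obtain w' v' where v: "w' \<epsilon> e" "v' \<epsilon> e" "w' \<epsilon> v' \<or> w' = v'" "ap a w = ap b w'" "ap a u = ap b v'"
      using le[OF a(1,2,4) w a(5)] a(8) by blast
    then have "v' = u'" using a countsD(2)[of b e] by metis
    moreover have "w' \<noteq> v'" using v a w countsD(2)[of a D w u] not_mem_self by metis
    ultimately show ?thesis using v by blast
  qed
  have same: "u = u'" if "u \<epsilon> d" "u' \<epsilon> d'" "ap c u = ap c' u'" for u u'
  proof -
    have "u \<epsilon> d \<longrightarrow> (\<forall>u'. u' \<epsilon> d' \<longrightarrow> ap c u = ap c' u' \<longrightarrow> u = u')"
    proof (rule ordinal_induct[where P = "\<lambda>u. u \<epsilon> d \<longrightarrow> (\<forall>u'. u' \<epsilon> d' \<longrightarrow> ap c u = ap c' u' \<longrightarrow> u = u')"])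
      show "dpred (\<lambda>s. s 0 \<epsilon> d \<longrightarrow> (\<forall>u'. u' \<epsilon> d' \<longrightarrow> ap c (s 0) = ap c' u' \<longrightarrow> s 0 = u'))"
        by (intro definability)
      show "ordinal u" using ordinal_mem[OF d(1) \<open>u \<epsilon> d\<close>] .
      fix u
      assume IH: "\<And>w. w \<epsilon> u \<Longrightarrow> w \<epsilon> d \<longrightarrow> (\<forall>u'. u' \<epsilon> d' \<longrightarrow> ap c w = ap c' u' \<longrightarrow> w = u')"
      show "u \<epsilon> d \<longrightarrow> (\<forall>u'. u' \<epsilon> d' \<longrightarrow> ap c u = ap c' u' \<longrightarrow> u = u')"
      proof (intro allI impI extens)
        fix u' w assume u: "u \<epsilon> d" "u' \<epsilon> d'" "ap c u = ap c' u'"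
        have u1: "x \<epsilon> d" if "x \<epsilon> u" for x using ordinal_trans[OF d(1) that u(1)] .
        have u2: "x \<epsilon> d'" if "x \<epsilon> u'" for x using ordinal_trans[OF d'(1) that u(2)] .
        show "w \<epsilon> u \<longleftrightarrow> w \<epsilon> u'"
        proof
          assume w: "w \<epsilon> u"
          then obtain w' where "w' \<epsilon> u'" "ap c w = ap c' w'"
            using below[OF d(2) d'(2) d(1) eq u] by blast
          then show "w \<epsilon> u'" using IH[OF w] u1[OF w] u2 by blast
        next
          assume w: "w \<epsilon> u'"
          then obtain w' where w': "w' \<epsilon> u" "ap c' w = ap c w'"
            using below[OF d'(2) d(2) d'(1) eq[symmetric] u(2,1) u(3)[symmetric]] by blast
          then show "w \<epsilon> u" using IH[OF w'(1)] u1[OF w'(1)] u2[OF w] by metis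
        qed
      qed
    qed
    then show ?thesis using that by blast
  qed
  have 1: "u \<epsilon> d' \<and> ap c u = ap c' u" if u: "u \<epsilon> d" for u
  proof -
    obtain u' where "u' \<epsilon> d'" "ap c u = ap c' u'" using le[OF d(2) d'(2) eq u u] by blast
    then show ?thesis using same[OF u] by auto
  qed
  have 2: "u \<epsilon> d" if u: "u \<epsilon> d'" for u
  proof -
    obtain u' where "u' \<epsilon> d" "ap c' u = ap c u'" using le[OF d'(2) d(2) eq[symmetric] u u] by blast
    then show ?thesis using same[of u' u] u by auto
  qed
  have "d = d'" by (rule extens) (use 1 2 in blast)
  then show ?thesis using 1 by blast
qed

text \<open>Hartogs' argument. Decoding is definable, so Replacement collects its values on the
  subsets of \<open>prod omega omega\<close> into a set \<open>H\<close>, and every countable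
  ordinal is such a value. Subsets that code no ordinal may contribute anything; Separation discards
  it.\<close>

lemma omega1_iff: "a \<epsilon> omega1 \<longleftrightarrow> ordinal a \<and> countable a"
proof -
  let ?dec = "\<lambda>s. the_set (\<lambda>d. ordinal d \<and> (\<exists>c. counts c d \<and> s = code d c))"
  have dec: "?dec (code d c) = d" if "ordinal d" "counts c d" for d c
    by (rule the_set_eq) (use that code_unique in blast)+
  have "is_set (\<lambda>d. \<exists>s. s \<epsilon> power_set (prod omega omega) \<and> d = ?dec s)"
    by (rule is_set_replace) (intro definability dpred_ordinal dpred_counts dfun_code)
  then obtain H where H: "\<And>d. d \<epsilon> H \<longleftrightarrow> (\<exists>s. s \<epsilon> power_set (prod omega omega) \<and> d = ?dec s)"
    unfolding is_set_def by blast
  have "d \<epsilon> H" if d: "ordinal d \<and> injects d omega" for d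
  proof -
    obtain c where c: "counts c d" using d countable_iff[of d] unfolding countable_def by blast
    then have "?dec (code d c) = d" using dec d by blast
    moreover have "code d c \<epsilon> power_set (prod omega omega)" using code_subset[OF c] by simp
    ultimately show ?thesis unfolding H by (intro exI[of _ "code d c"]) simp
  qed
  then show ?thesis unfolding omega1_def countable_def
    by (intro mem_SET is_set_sep[where a = H] definability dpred_ordinal)
qed

section \<open>Closure properties of \<open>omega1\<close>\<close>

lemma ordinal_omega1: "ordinal omega1"
proof (rule ordinalI)
  fix x y assume x: "x \<epsilon> omega1" and y: "y \<epsilon> x"
  then have "ordinal x" "countable x" by (simp_all add: omega1_iff)
  moreover have "subset y x" unfolding subset_def using ordinal_trans[OF \<open>ordinal x\<close> _ y] by blast
  ultimately show "y \<epsilon> omega1" using ordinal_mem y countable_subset by (simp add: omega1_iff)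
qed (simp add: omega1_iff)

lemma omega1_suc:
  assumes "a \<epsilon> omega1" shows "suc a \<epsilon> omega1"
proof -
  obtain c where c: "counts c a" using assms omega1_iff countable_iff by blast
  have "countable (suc a)" unfolding countable_def
  proof (rule injectsI[where t = "\<lambda>x. if x = a then empty else suc (ap c x)"])
    show "dfun (\<lambda>s. if s 0 = a then empty else suc (ap c (s 0)))" by (intro definability)
  qed (use countsD[OF c] in \<open>auto split: if_splits\<close>)
  then show ?thesis using assms omega1_iff ordinal_suc by blast
qed

lemma omega1_empty [simp]: "empty \<epsilon> omega1"
  unfolding omega1_iff countable_def using ordinal_empty injects_subset[of empty] by (simp add: subset_def)

lemma countable_un:
  assumes "countable A" "countable B" shows "countable (un A B)"
proof -
  have "injects (un A B) (disjoint_sum A B)"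
  proof (rule injectsI[where t = "\<lambda>x. if x \<epsilon> A then opair empty x else opair (suc empty) x"])
    show "dfun (\<lambda>s. if s 0 \<epsilon> A then opair empty (s 0) else opair (suc empty) (s 0))" by (intro definability)
  qed (auto simp: disjoint_sum_iff split: if_splits)
  then show ?thesis using countable_injects countable_disjoint_sum[OF assms] by blast
qed

lemma omega1_un: "a \<epsilon> omega1 \<Longrightarrow> b \<epsilon> omega1 \<Longrightarrow> un a b \<epsilon> omega1"
  unfolding omega1_iff using ordinal_un countable_un by blast

section \<open>Countable choice for sets of reals\<close>

definition countable_choice_reals :: bool where
  "countable_choice_reals \<longleftrightarrow> (\<forall>A. (\<forall>n. n \<epsilon> omega \<longrightarrow> (\<exists>x. x \<epsilon> reals \<and> x \<epsilon> ap A n)) \<longrightarrow>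
     (\<exists>C. \<forall>n. n \<epsilon> omega \<longrightarrow> ap C n \<epsilon> reals \<and> ap C n \<epsilon> ap A n))"

lemma restr_iff: "p \<epsilon> restr f A \<longleftrightarrow> p \<epsilon> f \<and> (\<exists>x y. x \<epsilon> A \<and> p = opair x y)"
  unfolding restr_def by (rule mem_SET, rule is_set_sep[where a = f]) (intro definability, simp)

lemma restr_empty: "restr f empty = empty"
  by (simp add: eq_empty_iff restr_iff)

text \<open>The sequence whose \<open>n\<close>-th term is \<open>H n s\<close> for the finite sequence \<open>s\<close> of the terms before it.\<close>

definition history :: "('a \<Rightarrow> 'a \<Rightarrow> 'a) \<Rightarrow> 'a \<Rightarrow> 'a" where
  "history H n = nrec empty (\<lambda>k g. un g (upair (opair k (H k g)) (opair k (H k g)))) n"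

definition run :: "('a \<Rightarrow> 'a \<Rightarrow> 'a) \<Rightarrow> 'a" where
  "run H = lam omega (\<lambda>n. H n (history H n))"

text \<open>In the games below \<open>H\<close> combines a strategy with the moves of the opponent,
  so a single recursion produces the run in which both are followed.\<close>

lemma run:
  assumes H: "dfun (\<lambda>s. H (s 0) (s (Suc 0)))"
    and H_om: "\<forall>n g. n \<epsilon> omega \<longrightarrow> maps g n omega \<longrightarrow> H n g \<epsilon> omega"
  shows "maps (run H) omega omega"
    and "n \<epsilon> omega \<Longrightarrow> ap (run H) n = H n (restr (run H) n)"
    and "n \<epsilon> omega \<Longrightarrow> maps (restr (run H) n) n omega"
proof -
  have H_omega: "H n g \<epsilon> omega" if "n \<epsilon> omega" "maps g n omega" for n g using H_om that by blast
  have step: "dfun (\<lambda>s. un (s (Suc 0)) (upair (opair (s 0) (H (s 0) (s (Suc 0)))) (opair (s 0) (H (s 0) (s (Suc 0))))))"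
    by (intro definability H)
  have hist: "dfun (\<lambda>s. history H (s 0))"
    unfolding history_def by (intro definability dfun_nrec dfun_subst2[OF H])
  then have t: "dfun (\<lambda>s. H (s 0) (history H (s 0)))"
    by (intro dfun_subst2[OF H] definability)
  have h0: "history H empty = empty" unfolding history_def by (rule nrec_empty[OF step])
  have hs: "history H (suc n) = un (history H n) (upair (opair n (H n (history H n))) (opair n (H n (history H n))))"
    if "n \<epsilon> omega" for n
    unfolding history_def by (rule nrec_suc[OF step that])
  have h: "history H n = lam n (\<lambda>k. H k (history H k))" if n: "n \<epsilon> omega" for n
  proof -
    have "\<forall>p. p \<epsilon> history H n \<longleftrightarrow> (\<exists>k. k \<epsilon> n \<and> p = opair k (H k (history H k)))"
    proof (rule omega_induct[where P = "\<lambda>n. \<forall>p. p \<epsilon> history H n \<longleftrightarrow> (\<exists>k. k \<epsilon> n \<and> p = opair k (H k (history H k)))",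
          OF _ _ _ n])
      show "dpred (\<lambda>s. \<forall>p. p \<epsilon> history H (s 0) \<longleftrightarrow> (\<exists>k. k \<epsilon> s 0 \<and> p = opair k (H k (history H k))))"
        by (intro definability dfun_subst1[OF hist] dfun_subst1[OF t])
    qed (auto simp: h0 hs)
    then show ?thesis by (intro extens) (simp add: mem_lam[OF t])
  qed
  have om: "H n (history H n) \<epsilon> omega" if n: "n \<epsilon> omega" for n
  proof -
    \<comment> \<open>All earlier values are carried along in the induction, since
      \<open>H_omega\<close> applies only once the whole history is known to map into
      \<open>omega\<close>.\<close>
    have "\<forall>k. k \<epsilon> suc n \<longrightarrow> H k (history H k) \<epsilon> omega"
    proof (rule omega_induct[where P = "\<lambda>n. \<forall>k. k \<epsilon> suc n \<longrightarrow> H k (history H k) \<epsilon> omega", OF _ _ _ n])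
      show "dpred (\<lambda>s. \<forall>k. k \<epsilon> suc (s 0) \<longrightarrow> H k (history H k) \<epsilon> omega)"
        by (intro definability dfun_subst1[OF t])
      have "maps (history H empty) empty omega" unfolding h[OF omega_empty] by (rule maps_lam[OF t]) simp
      then show "\<forall>k. k \<epsilon> suc empty \<longrightarrow> H k (history H k) \<epsilon> omega" using H_omega[OF omega_empty] by simp
      fix n assume n: "n \<epsilon> omega" and IH: "\<forall>k. k \<epsilon> suc n \<longrightarrow> H k (history H k) \<epsilon> omega"
      then have sn: "suc n \<epsilon> omega" by simp
      have "maps (history H (suc n)) (suc n) omega"
        unfolding h[OF sn] by (rule maps_lam[OF t]) (use IH in blast)
      then have "H (suc n) (history H (suc n)) \<epsilon> omega" by (rule H_omega[OF sn])
      then show "\<forall>k. k \<epsilon> suc (suc n) \<longrightarrow> H k (history H k) \<epsilon> omega" using IH by auto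
    qed
    then show ?thesis by simp
  qed
  show "maps (run H) omega omega" unfolding run_def by (rule maps_lam[OF t om])
  have r: "restr (run H) n = history H n" if "n \<epsilon> omega" for n
    by (rule extens) (auto simp: restr_iff run_def mem_lam[OF t] h[OF that] omega_mem[OF that])
  show "ap (run H) n = H n (restr (run H) n)" if "n \<epsilon> omega"
    unfolding r[OF that] unfolding run_def by (rule ap_lam[OF t that])
  show "maps (restr (run H) n) n omega" if "n \<epsilon> omega"
    unfolding r[OF that] h[OF that] by (rule maps_lam[OF t]) (use om omega_mem[OF that] in blast)
qed

section \<open>Games: the moves of player II, and choice from determinacy\<close>

definition odd_part :: "'a \<Rightarrow> 'a" where
  "odd_part f = lam omega (\<lambda>k. ap f (suc (dbl k)))"

lemma dfun_odd_part: "dfun t \<Longrightarrow> dfun (\<lambda>s. odd_part (t s))"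
  by (rule dfun_subst1) (unfold odd_part_def, intro definability dfun_dbl)

lemma ap_odd_part: "k \<epsilon> omega \<Longrightarrow> ap (odd_part f) k = ap f (suc (dbl k))"
  unfolding odd_part_def by (rule ap_lam) (intro definability dfun_dbl)

lemma odd_part_reals: "f \<epsilon> reals \<Longrightarrow> odd_part f \<epsilon> reals"
  unfolding odd_part_def reals_iff by (rule maps_lam) (intro definability dfun_dbl, simp add: maps_iff)

lemma is_set_finite_seqs: "is_set (\<lambda>s. \<exists>n. n \<epsilon> omega \<and> even_nat n \<and> maps s n A)"
  "is_set (\<lambda>s. \<exists>n. n \<epsilon> omega \<and> \<not> even_nat n \<and> maps s n A)"
proof -
  have "s \<epsilon> power_set (prod omega A)" if "n \<epsilon> omega" "maps s n A" for s n
    using maps_subset_prod[OF that(2)] omega_mem[OF that(1)] by (auto simp: subset_def prod_iff)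
  then show "is_set (\<lambda>s. \<exists>n. n \<epsilon> omega \<and> even_nat n \<and> maps s n A)"
    "is_set (\<lambda>s. \<exists>n. n \<epsilon> omega \<and> \<not> even_nat n \<and> maps s n A)"
    by - (rule is_set_sep[where a = "power_set (prod omega A)"], intro definability dpred_even_nat, blast)+
qed

lemma even_positions_iff: "s \<epsilon> even_positions A \<longleftrightarrow> (\<exists>n. n \<epsilon> omega \<and> even_nat n \<and> maps s n A)"
  unfolding even_positions_def by (rule mem_SET[OF is_set_finite_seqs(1)])

lemma odd_positions_iff: "s \<epsilon> odd_positions A \<longleftrightarrow> (\<exists>n. n \<epsilon> omega \<and> \<not> even_nat n \<and> maps s n A)"
  unfolding odd_positions_def by (rule mem_SET[OF is_set_finite_seqs(2)])

text \<open>Player I names \<open>n\<close> with the first move and player II must build an element of \<open>A n\<close>. Player I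
  cannot win, and a winning strategy of player II yields a choice function.\<close>

lemma AD_imp_countable_choice:
  assumes AD shows countable_choice_reals
  unfolding countable_choice_reals_def
proof (intro allI impI)
  fix A assume A: "\<forall>n. n \<epsilon> omega \<longrightarrow> (\<exists>x. x \<epsilon> reals \<and> x \<epsilon> ap A n)"
  \<comment> \<open>The payoff set of player I: the moves of player II fail to form an element of
    the set named by the first move. Later moves of player I have no influence on it.\<close>
  have "is_set (\<lambda>f. f \<epsilon> reals \<and> \<not> odd_part f \<epsilon> ap A (ap f empty))"
    by (rule is_set_sep[where a = reals]) (intro definability dfun_odd_part, simp)
  then obtain Z where Z: "\<And>f. f \<epsilon> Z \<longleftrightarrow> f \<epsilon> reals \<and> \<not> odd_part f \<epsilon> ap A (ap f empty)"
    unfolding is_set_def by blast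
  have even0: "even_nat empty" using even_nat_dbl[OF omega_empty] by simp
  have "determined omega Z" using \<open>AD\<close> Z unfolding AD_def subset_def by blast
  then consider "I_wins omega Z" | "II_wins omega Z" unfolding determined_def by blast
  then show "\<exists>C. \<forall>n. n \<epsilon> omega \<longrightarrow> ap C n \<epsilon> reals \<and> ap C n \<epsilon> ap A n"
  proof cases
    case 1
    then obtain \<sigma> where \<sigma>: "maps \<sigma> (even_positions omega) omega"
      and win: "\<And>f. maps f omega omega \<Longrightarrow>
        (\<forall>n. n \<epsilon> omega \<longrightarrow> even_nat n \<longrightarrow> app f n = app \<sigma> (restr f n)) \<Longrightarrow> f \<epsilon> Z"
      unfolding I_wins_def by blast
    have \<sigma>_pos: "ap \<sigma> g \<epsilon> omega" "app \<sigma> g = ap \<sigma> g" if "n \<epsilon> omega" "even_nat n" "maps g n omega" for n g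
    proof -
      have g: "g \<epsilon> even_positions omega" using that even_positions_iff by blast
      then show "ap \<sigma> g \<epsilon> omega" using \<sigma> unfolding maps_iff by blast
      show "app \<sigma> g = ap \<sigma> g" using \<sigma> g app_eq_ap unfolding maps_iff by blast
    qed
    have "maps empty empty omega" unfolding maps_iff fun_on_def by simp
    then have "ap \<sigma> empty \<epsilon> omega" using \<sigma>_pos(1)[OF omega_empty even0] by blast
    \<comment> \<open>The first move prescribed by \<sigma> is made before the opponent moves, so
      player II can fix a target \<open>y\<close> in advance and play its digits at the odd
      positions. The resulting run follows \<sigma> and lies outside \<open>Z\<close>, a
      contradiction.\<close>
    then obtain y where y: "y \<epsilon> reals" "y \<epsilon> ap A (ap \<sigma> empty)" using A by blast
    let ?half = "\<lambda>n. the_set (\<lambda>k. k \<epsilon> omega \<and> n = suc (dbl k))"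
    have half: "?half (suc (dbl k)) = k" if "k \<epsilon> omega" for k
      by (rule the_set_eq) (use that dbl_inject in auto)
    let ?H = "\<lambda>n g. if even_nat n then ap \<sigma> g else ap y (?half n)"
    have H: "dfun (\<lambda>s. ?H (s 0) (s (Suc 0)))" by (intro definability dpred_even_nat dfun_dbl)
    have H_omega: "\<forall>n g. n \<epsilon> omega \<longrightarrow> maps g n omega \<longrightarrow> ?H n g \<epsilon> omega"
    proof (intro allI impI)
      fix n g assume n: "n \<epsilon> omega" and g: "maps g n omega"
      show "?H n g \<epsilon> omega"
      proof (cases "even_nat n")
        case True then show ?thesis using \<sigma>_pos(1)[OF n True g] by simp
      next
        case False
        then obtain k where k: "k \<epsilon> omega" "n = suc (dbl k)"
          using dbl_or_suc_dbl[OF n] even_nat_dbl by blast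
        then show ?thesis using False half y(1) unfolding reals_iff maps_iff by simp
      qed
    qed
    define f where "f = run ?H"
    note f = run[OF H H_omega, folded f_def]
    have f_on: "fun_on f omega" using f(1) maps_iff by blast
    have "app f n = app \<sigma> (restr f n)" if "n \<epsilon> omega" "even_nat n" for n
      using f(2)[OF that(1)] \<sigma>_pos(2)[OF that f(3)[OF that(1)]] app_eq_ap[OF f_on that(1)] that(2) by simp
    then have "f \<epsilon> Z" using win f(1) by blast
    moreover have "ap f empty = ap \<sigma> empty" using f(2)[OF omega_empty] even0 restr_empty by simp
    moreover have "odd_part f = y"
    proof (rule fun_on_eqI)
      show "fun_on (odd_part f) omega" "fun_on y omega"
        using odd_part_reals[of f] f(1) y(1) unfolding reals_iff maps_iff by blast+
      show "ap (odd_part f) k = ap y k" if "k \<epsilon> omega" for k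
        using f(2)[of "suc (dbl k)"] half[OF that] not_even_nat_suc_dbl[OF that] ap_odd_part[OF that] that
        by simp
    qed
    ultimately show ?thesis using y Z by auto
  next
    case 2
    then obtain \<tau> where \<tau>: "maps \<tau> (odd_positions omega) omega"
      and win: "\<And>f. maps f omega omega \<Longrightarrow>
        (\<forall>n. n \<epsilon> omega \<longrightarrow> \<not> even_nat n \<longrightarrow> app f n = app \<tau> (restr f n)) \<Longrightarrow> \<not> f \<epsilon> Z"
      unfolding II_wins_def by blast
    have \<tau>_pos: "ap \<tau> g \<epsilon> omega" "app \<tau> g = ap \<tau> g" if "n \<epsilon> omega" "\<not> even_nat n" "maps g n omega" for n g
    proof -
      have g: "g \<epsilon> odd_positions omega" using that odd_positions_iff by blast
      then show "ap \<tau> g \<epsilon> omega" using \<tau> unfolding maps_iff by blast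
      show "app \<tau> g = ap \<tau> g" using \<tau> g app_eq_ap unfolding maps_iff by blast
    qed
    \<comment> \<open>Player I plays \<open>n\<close> at every turn, although only the first of
      these moves counts. Since \<tau> is one fixed parameter, the answer to \<open>n\<close>
      depends definably on \<open>n\<close>, which is what turns it into a choice function.\<close>
    let ?H = "\<lambda>n k g. if even_nat k then n else ap \<tau> g"
    let ?c = "\<lambda>n. odd_part (run (?H n))"
    have c: "dfun (\<lambda>s. ?c (s 0))"
      unfolding run_def history_def by (intro definability dfun_odd_part dfun_nrec dpred_even_nat)
    have "?c n \<epsilon> reals \<and> ?c n \<epsilon> ap A n" if n: "n \<epsilon> omega" for n
    proof -
      have H: "dfun (\<lambda>s. ?H n (s 0) (s (Suc 0)))" by (intro definability dpred_even_nat)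
      have H_omega: "\<forall>k g. k \<epsilon> omega \<longrightarrow> maps g k omega \<longrightarrow> ?H n k g \<epsilon> omega"
        using \<tau>_pos(1) n by auto
      define f where "f = run (?H n)"
      note f = run[OF H H_omega, folded f_def]
      have f_on: "fun_on f omega" using f(1) maps_iff by blast
      have "app f k = app \<tau> (restr f k)" if "k \<epsilon> omega" "\<not> even_nat k" for k
        using f(2)[OF that(1)] \<tau>_pos(2)[OF that f(3)[OF that(1)]] app_eq_ap[OF f_on that(1)] that(2) by simp
      then have "\<not> f \<epsilon> Z" using win f(1) by blast
      moreover have "f \<epsilon> reals" using f(1) reals_iff by blast
      moreover have "ap f empty = n" using f(2)[OF omega_empty] even0 by simp
      ultimately have "odd_part f \<epsilon> reals" "odd_part f \<epsilon> ap A n" using Z odd_part_reals by auto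
      then show ?thesis unfolding f_def by blast
    qed
    then show ?thesis using ap_lam[OF c] by (intro exI[of _ "lam omega ?c"]) simp
  qed
qed

section \<open>Choice from dependent choice\<close>

lemma finite_choice:
  assumes A: "\<And>i. i \<epsilon> omega \<Longrightarrow> \<exists>x. x \<epsilon> reals \<and> x \<epsilon> ap A i" and n: "n \<epsilon> omega"
  shows "\<exists>g. \<forall>i. i \<epsilon> n \<longrightarrow> ap g i \<epsilon> reals \<and> ap g i \<epsilon> ap A i"
proof (rule omega_induct[where P = "\<lambda>n. \<exists>g. \<forall>i. i \<epsilon> n \<longrightarrow> ap g i \<epsilon> reals \<and> ap g i \<epsilon> ap A i", OF _ _ _ n])
  show "dpred (\<lambda>s. \<exists>g. \<forall>i. i \<epsilon> s 0 \<longrightarrow> ap g i \<epsilon> reals \<and> ap g i \<epsilon> ap A i)" by (intro definability)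
  fix n assume n: "n \<epsilon> omega" and "\<exists>g. \<forall>i. i \<epsilon> n \<longrightarrow> ap g i \<epsilon> reals \<and> ap g i \<epsilon> ap A i"
  then obtain g where g: "\<And>i. i \<epsilon> n \<Longrightarrow> ap g i \<epsilon> reals \<and> ap g i \<epsilon> ap A i" by blast
  obtain x where x: "x \<epsilon> reals" "x \<epsilon> ap A n" using A[OF n] by blast
  have t: "dfun (\<lambda>s. if s 0 = n then x else ap g (s 0))" by (intro definability)
  have "ap (lam (suc n) (\<lambda>i. if i = n then x else ap g i)) i = (if i = n then x else ap g i)"
    if "i \<epsilon> suc n" for i by (rule ap_lam[OF t that])
  then show "\<exists>g. \<forall>i. i \<epsilon> suc n \<longrightarrow> ap g i \<epsilon> reals \<and> ap g i \<epsilon> ap A i"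
    using x g by (intro exI[of _ "lam (suc n) (\<lambda>i. if i = n then x else ap g i)"]) auto
qed simp

text \<open>Dependent choice is applied to pairs \<open>(n, y)\<close> with \<open>y\<close> in \<open>A n\<close>, coded as reals. The sequence
  obtained may start at any \<open>k\<close>, so finitely many choices have to be supplied separately.\<close>

lemma DC_imp_countable_choice:
  assumes DC_reals shows countable_choice_reals
  unfolding countable_choice_reals_def
proof (intro allI impI)
  fix A assume "\<forall>n. n \<epsilon> omega \<longrightarrow> (\<exists>x. x \<epsilon> reals \<and> x \<epsilon> ap A n)"
  then have A: "\<And>n. n \<epsilon> omega \<Longrightarrow> \<exists>x. x \<epsilon> reals \<and> x \<epsilon> ap A n" by blast
  have "subset omega (power_set omega)" using omega_mem by (auto simp: subset_def)
  then have "injects (prod omega reals) (prod (power_set omega) (power_set (prod omega omega)))"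
    by (intro injects_prod_mono injects_subset reals_subset)
  then have "injects (prod omega reals) reals"
    by (rule injects_trans) (intro prod_power_set_injects_reals countable_prod countable_omega)
  then obtain e where e: "\<And>p. p \<epsilon> prod omega reals \<Longrightarrow> ap e p \<epsilon> reals"
    "\<And>p q. p \<epsilon> prod omega reals \<Longrightarrow> q \<epsilon> prod omega reals \<Longrightarrow> ap e p = ap e q \<Longrightarrow> p = q"
    by (rule injectsE) blast
  let ?m = "\<lambda>n y. ap e (opair n y)"
  have m: "?m n y \<epsilon> reals" if "n \<epsilon> omega" "y \<epsilon> reals" for n y using e(1) that by simp
  have m_inj: "n = n' \<and> y = y'"
    if "n \<epsilon> omega" "y \<epsilon> reals" "n' \<epsilon> omega" "y' \<epsilon> reals" "?m n y = ?m n' y'" for n y n' y'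
    using e(2)[of "opair n y" "opair n' y'"] that by simp
  let ?Q = "\<lambda>n z. \<exists>y. y \<epsilon> reals \<and> y \<epsilon> ap A n \<and> z = ?m n y"
  \<comment> \<open>Dependent choice asks for a relation that is total on the reals, so a real that
    codes no pair is followed by a code with index \<open>empty\<close>.\<close>
  let ?S = "\<lambda>x z. (\<exists>n y. n \<epsilon> omega \<and> y \<epsilon> reals \<and> x = ?m n y \<and> ?Q (suc n) z) \<or>
      (\<not> (\<exists>n y. n \<epsilon> omega \<and> y \<epsilon> reals \<and> x = ?m n y) \<and> ?Q empty z)"
  have "is_set (\<lambda>p. \<exists>x z. p = opair x z \<and> x \<epsilon> reals \<and> z \<epsilon> reals \<and> ?S x z)"
    by (rule is_set_sep[where a = "prod reals reals"]) (intro definability, auto)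
  then obtain R where R: "\<And>p. p \<epsilon> R \<longleftrightarrow> (\<exists>x z. p = opair x z \<and> x \<epsilon> reals \<and> z \<epsilon> reals \<and> ?S x z)"
    unfolding is_set_def by blast
  have Q: "\<exists>z. z \<epsilon> reals \<and> ?Q n z" if "n \<epsilon> omega" for n using A[OF that] m[OF that] by blast
  have "\<exists>z. z \<epsilon> reals \<and> opair x z \<epsilon> R" if x: "x \<epsilon> reals" for x
  proof (cases "\<exists>n y. n \<epsilon> omega \<and> y \<epsilon> reals \<and> x = ?m n y")
    case True
    then obtain n y where n: "n \<epsilon> omega" "y \<epsilon> reals" "x = ?m n y" by blast
    then obtain z where "z \<epsilon> reals" "?Q (suc n) z" using Q[of "suc n"] by auto
    moreover from this have "?S x z" using n by blast
    ultimately have "opair x z \<epsilon> R" using R x by blast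
    then show ?thesis using \<open>z \<epsilon> reals\<close> by blast
  next
    case False
    obtain z where "z \<epsilon> reals" "?Q empty z" using Q[OF omega_empty] by blast
    moreover from this have "?S x z" using False by blast
    ultimately have "opair x z \<epsilon> R" using R x by blast
    then show ?thesis using \<open>z \<epsilon> reals\<close> by blast
  qed
  then obtain f where f: "maps f omega reals" "\<And>n. n \<epsilon> omega \<Longrightarrow> opair (app f n) (app f (suc n)) \<epsilon> R"
    using \<open>DC_reals\<close> unfolding DC_reals_def by blast
  have fR: "?S (ap f n) (ap f (suc n))" if "n \<epsilon> omega" for n
    using f(2)[OF that] app_eq_ap[of f omega n] app_eq_ap[of f omega "suc n"] f(1) that R
    unfolding maps_iff by auto
  \<comment> \<open>The term at \<open>empty\<close> may be an arbitrary real. The term after it is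
    surely a code of an element of some \<open>A k\<close>, whatever the first one was.\<close>
  obtain k where k: "k \<epsilon> omega" "?Q k (ap f (suc empty))"
    using fR[OF omega_empty] omega_empty omega_suc by blast
  \<comment> \<open>Once a term is a code, each step raises the coded index by exactly one, so no
    index from \<open>k\<close> on is skipped.\<close>
  have tail: "k \<epsilon> i \<or> k = i \<longrightarrow> (\<exists>n. n \<epsilon> omega \<and> ?Q i (ap f n))" if "i \<epsilon> omega" for i
  proof (rule omega_induct[where P = "\<lambda>i. k \<epsilon> i \<or> k = i \<longrightarrow> (\<exists>n. n \<epsilon> omega \<and> ?Q i (ap f n))", OF _ _ _ that])
    show "dpred (\<lambda>s. k \<epsilon> s 0 \<or> k = s 0 \<longrightarrow> (\<exists>n. n \<epsilon> omega \<and> ?Q (s 0) (ap f n)))" by (intro definability)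
    have k': "\<exists>n. n \<epsilon> omega \<and> ?Q k (ap f n)" using k omega_suc omega_empty by blast
    then show "k \<epsilon> empty \<or> k = empty \<longrightarrow> (\<exists>n. n \<epsilon> omega \<and> ?Q empty (ap f n))" by auto
    fix i assume i: "i \<epsilon> omega" and IH: "k \<epsilon> i \<or> k = i \<longrightarrow> (\<exists>n. n \<epsilon> omega \<and> ?Q i (ap f n))"
    show "k \<epsilon> suc i \<or> k = suc i \<longrightarrow> (\<exists>n. n \<epsilon> omega \<and> ?Q (suc i) (ap f n))"
    proof
      assume "k \<epsilon> suc i \<or> k = suc i"
      then show "\<exists>n. n \<epsilon> omega \<and> ?Q (suc i) (ap f n)"
      proof
        assume "k = suc i" then show ?thesis using k' by simp
      next
        assume "k \<epsilon> suc i"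
        then obtain n y where n: "n \<epsilon> omega" "y \<epsilon> reals" "ap f n = ?m i y" using IH by auto
        then obtain n' y' where n': "n' \<epsilon> omega" "y' \<epsilon> reals" "ap f n = ?m n' y'" "?Q (suc n') (ap f (suc n))"
          using fR[OF n(1)] i by blast
        have "n' = i" using m_inj[OF n'(1,2) i n(2) trans[OF n'(3)[symmetric] n(3)]] by blast
        moreover have "suc n \<epsilon> omega" using n(1) by simp
        ultimately show ?thesis using n'(4) by blast
      qed
    qed
  qed
  obtain g where g: "\<And>i. i \<epsilon> k \<Longrightarrow> ap g i \<epsilon> reals \<and> ap g i \<epsilon> ap A i"
    using finite_choice[OF A k(1)] by blast
  \<comment> \<open>Taking the least term that codes an element for \<open>i\<close> makes the
    selection definable; injectivity of the coding then makes \<open>y\<close> unique.\<close>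
  let ?n = "\<lambda>i. the_set (\<lambda>n. n \<epsilon> omega \<and> ?Q i (ap f n) \<and> (\<forall>j. j \<epsilon> n \<longrightarrow> \<not> ?Q i (ap f j)))"
  let ?c = "\<lambda>i. if i \<epsilon> k then ap g i else the_set (\<lambda>y. y \<epsilon> reals \<and> ap f (?n i) = ?m i y)"
  have c: "dfun (\<lambda>s. ?c (s 0))" by (intro definability)
  have "?c i \<epsilon> reals \<and> ?c i \<epsilon> ap A i" if i: "i \<epsilon> omega" for i
  proof (cases "i \<epsilon> k")
    case False
    then have "k \<epsilon> i \<or> k = i"
      using ordinal_linear[of i k] ordinal_mem[OF ordinal_omega] i k(1) by blast
    then obtain n where n: "n \<epsilon> omega" "?Q i (ap f n)" using tail[OF i] by blast
    have "dpred (\<lambda>s. ?Q i (ap f (s 0)))" by (intro definability)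
    then obtain n' where n': "n' \<epsilon> omega" "?Q i (ap f n')" "?n i = n'"
      by (rule omega_least[where P = "\<lambda>n. ?Q i (ap f n)" and n = n]) (use n in blast)+
    then obtain y where y: "y \<epsilon> reals" "y \<epsilon> ap A i" "ap f n' = ?m i y" by blast
    then have "the_set (\<lambda>y. y \<epsilon> reals \<and> ap f (?n i) = ?m i y) = y"
      unfolding n'(3) by (intro the_set_eq) (use y m_inj[OF i _ i] in auto)
    then show ?thesis using False y by simp
  qed (simp add: g)
  then show "\<exists>C. \<forall>n. n \<epsilon> omega \<longrightarrow> ap C n \<epsilon> reals \<and> ap C n \<epsilon> ap A n"
    using ap_lam[OF c] by (intro exI[of _ "lam omega ?c"]) simp
qed

section \<open>Codes of bounded sets and quotients of the reals\<close>

text \<open>Regularity of \<open>omega1\<close>. Countings of the \<open>t b\<close> are not reals,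
  so what is chosen is a real naming the code of one. By \<open>code_unique\<close> that real
  determines the counting on \<open>t b\<close>, and the union is counted by pairs of
  numbers.\<close>

lemma countable_UN_omega1:
  assumes CC: countable_choice_reals and a: "countable a"
    and t: "dfun (\<lambda>s. t (s 0))" and t_omega1: "\<And>b. b \<epsilon> a \<Longrightarrow> t b \<epsilon> omega1"
  obtains u where "u \<epsilon> omega1" "\<And>z. z \<epsilon> u \<longleftrightarrow> (\<exists>b. b \<epsilon> a \<and> z \<epsilon> t b)"
proof -
  obtain c where c: "counts c a" using a countable_iff by blast
  let ?W = "prod omega omega"
  have "injects (power_set ?W) reals"
    by (intro power_set_injects_reals countable_prod countable_omega)
  then obtain e where e: "\<And>p. p \<epsilon> power_set ?W \<Longrightarrow> ap e p \<epsilon> reals"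
    "\<And>p q. p \<epsilon> power_set ?W \<Longrightarrow> q \<epsilon> power_set ?W \<Longrightarrow> ap e p = ap e q \<Longrightarrow> p = q"
    by (rule injectsE) blast
  \<comment> \<open>For \<open>n\<close> outside the range of \<open>c\<close> the condition is
    vacuous, which keeps every set of the family inhabited.\<close>
  let ?S = "\<lambda>n z. z \<epsilon> reals \<and> (\<forall>b. b \<epsilon> a \<longrightarrow> ap c b = n \<longrightarrow>
      (\<exists>c'. counts c' (t b) \<and> z = ap e (code (t b) c')))"
  have S: "dpred (\<lambda>s. ?S n (s 0))" for n
    by (intro definability dpred_counts dfun_code dfun_subst1[OF t])
  have A1: "dfun (\<lambda>s. SET z. ?S (s 0) z)"
    by (intro definability dpred_counts dfun_code dfun_subst1[OF t])
  have A2: "z \<epsilon> ap (lam omega (\<lambda>n. SET z. ?S n z)) n \<longleftrightarrow> ?S n z" if "n \<epsilon> omega" for n z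
    unfolding ap_lam[OF A1 that] by (rule mem_SET, rule is_set_sep[where a = reals, OF S]) blast
  have "\<exists>z. z \<epsilon> reals \<and> ?S n z" if n: "n \<epsilon> omega" for n
  proof (cases "\<exists>b. b \<epsilon> a \<and> ap c b = n")
    case True
    then obtain b where b: "b \<epsilon> a" "ap c b = n" by blast
    obtain c' where c': "counts c' (t b)"
      using t_omega1[OF b(1)] omega1_iff countable_iff by blast
    have "b' = b" if "b' \<epsilon> a" "ap c b' = n" for b' using countsD(2)[OF c] that b by blast
    then have "?S n (ap e (code (t b) c'))"
      using e(1)[of "code (t b) c'"] code_subset[OF c'] c' by auto
    then show ?thesis by blast
  next
    case False
    then show ?thesis using const_real[OF omega_empty] by blast
  qed
  then obtain C where C: "\<And>n. n \<epsilon> omega \<Longrightarrow> ?S n (ap C n)"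
    using CC[unfolded countable_choice_reals_def, rule_format, of "lam omega (\<lambda>n. SET z. ?S n z)"]
    by (auto simp: A2)
  have code_C: "\<exists>c'. counts c' (t b) \<and> ap C (ap c b) = ap e (code (t b) c')" if "b \<epsilon> a" for b
    using C[OF countsD(1)[OF c that]] that by blast
  have code_eq: "ap c' x = ap c'' x" if "b \<epsilon> a" "counts c' (t b)" "counts c'' (t b)"
    "ap e (code (t b) c') = ap e (code (t b) c'')" "x \<epsilon> t b" for b c' c'' x
  proof -
    have "code (t b) c' = code (t b) c''"
      using e(2)[of "code (t b) c'" "code (t b) c''"] that code_subset by simp
    moreover have "ordinal (t b)" using t_omega1[OF that(1)] omega1_iff by blast
    ultimately show ?thesis using code_unique[of "t b" c' "t b" c''] that(2,3,5) by blast
  qed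
  obtain u where u: "\<And>z. z \<epsilon> u \<longleftrightarrow> (\<exists>b. b \<epsilon> a \<and> z \<epsilon> t b)"
    using is_set_UN[OF t, of a] unfolding is_set_def by blast
  \<comment> \<open>\<open>?n x\<close> is the least number of an ordinal in the family that
    contains \<open>x\<close>, and \<open>?N x n\<close> is the number of \<open>x\<close> in the
    counting chosen for it. The latter is written as a unique value, so that no counting is
    selected.\<close>
  let ?P = "\<lambda>x n. \<exists>b. b \<epsilon> a \<and> ap c b = n \<and> x \<epsilon> t b"
  let ?n = "\<lambda>x. the_set (\<lambda>n. n \<epsilon> omega \<and> ?P x n \<and> (\<forall>k. k \<epsilon> n \<longrightarrow> \<not> ?P x k))"
  let ?N = "\<lambda>x n. the_set (\<lambda>m. \<exists>b c'. b \<epsilon> a \<and> ap c b = n \<and> counts c' (t b) \<and>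
      ap C n = ap e (code (t b) c') \<and> m = ap c' x)"
  have n: "\<exists>b. b \<epsilon> a \<and> ap c b = ?n x \<and> x \<epsilon> t b" if x: "x \<epsilon> u" for x
  proof -
    obtain b where b: "b \<epsilon> a" "x \<epsilon> t b" using x u by blast
    have "dpred (\<lambda>s. ?P x (s 0))" by (intro definability dfun_subst1[OF t])
    then show ?thesis
      by (rule omega_least[where P = "?P x" and n = "ap c b"]) (use b countsD(1)[OF c] in auto)
  qed
  have N: "?N x (ap c b) = ap c' x"
    if b: "b \<epsilon> a" "x \<epsilon> t b" and c': "counts c' (t b)" "ap C (ap c b) = ap e (code (t b) c')" for x b c'
  proof (rule the_set_eq)
    show "\<exists>b' c''. b' \<epsilon> a \<and> ap c b' = ap c b \<and> counts c'' (t b') \<and>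
      ap C (ap c b) = ap e (code (t b') c'') \<and> ap c' x = ap c'' x" using b c' by blast
    fix m assume "\<exists>b' c''. b' \<epsilon> a \<and> ap c b' = ap c b \<and> counts c'' (t b') \<and>
      ap C (ap c b) = ap e (code (t b') c'') \<and> m = ap c'' x"
    then obtain b' c'' where b': "b' \<epsilon> a" "ap c b' = ap c b" "counts c'' (t b')"
      "ap C (ap c b) = ap e (code (t b') c'')" "m = ap c'' x" by blast
    have "b' = b" using countsD(2)[OF c b'(1) b(1) b'(2)] .
    then have "ap c'' x = ap c' x"
      using code_eq[OF b(1) _ c'(1) _ b(2), of c''] b'(3,4) c'(2) by simp
    then show "m = ap c' x" using b'(5) by simp
  qed
  have N_omega: "?N x (?n x) \<epsilon> omega" if x: "x \<epsilon> u" for x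
  proof -
    obtain b where b: "b \<epsilon> a" "ap c b = ?n x" "x \<epsilon> t b" using n[OF x] by blast
    obtain c' where c': "counts c' (t b)" "ap C (ap c b) = ap e (code (t b) c')" using code_C[OF b(1)] by blast
    show ?thesis using N[OF b(1,3) c'] countsD(1)[OF c'(1) b(3)] unfolding b(2) by simp
  qed
  have "countable u" unfolding countable_def
  proof (rule injectsI[where t = "\<lambda>x. npair (?n x) (?N x (?n x))"])
    show "dfun (\<lambda>s. npair (?n (s 0)) (?N (s 0) (?n (s 0))))"
      by (intro definability dfun_npair dpred_counts dfun_code dfun_subst1[OF t])
    have n_omega: "?n x \<epsilon> omega" if "x \<epsilon> u" for x using n[OF that] countsD(1)[OF c] by metis
    show "npair (?n x) (?N x (?n x)) \<epsilon> omega" if "x \<epsilon> u" for x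
      by (intro npair_omega N_omega n_omega that)
    fix x y assume x: "x \<epsilon> u" and y: "y \<epsilon> u" and "npair (?n x) (?N x (?n x)) = npair (?n y) (?N y (?n y))"
    then have eq: "?n x = ?n y" "?N x (?n x) = ?N y (?n y)"
      using npair_inject[OF n_omega[OF x] N_omega[OF x] n_omega[OF y] N_omega[OF y]] by blast+
    obtain b where b: "b \<epsilon> a" "ap c b = ?n x" "x \<epsilon> t b" using n[OF x] by blast
    obtain b' where b': "b' \<epsilon> a" "ap c b' = ?n y" "y \<epsilon> t b'" using n[OF y] by blast
    have bb: "b' = b" using countsD(2)[OF c b'(1) b(1)] b(2) b'(2) eq(1) by simp
    obtain c' where c': "counts c' (t b)" "ap C (ap c b) = ap e (code (t b) c')" using code_C[OF b(1)] by blast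
    have yb: "y \<epsilon> t b" using b'(3) bb by simp
    have "ap c' x = ap c' y" using N[OF b(1,3) c'] N[OF b(1) yb c'] eq(2)
      unfolding b(2) eq(1) by simp
    then show "x = y" using countsD(2)[OF c'(1) b(3) yb] by blast
  qed
  moreover have "ordinal u" by (rule ordinal_UN[OF u]) (use t_omega1 omega1_iff in blast)
  ultimately show ?thesis using that u omega1_iff by blast
qed

section \<open>Bounded sets and their real codes\<close>

definition bounded :: "'a \<Rightarrow> bool" where
  "bounded f \<longleftrightarrow> (\<exists>d. d \<epsilon> omega1 \<and> subset f (prod d d))"

text \<open>Membership can be unfolded only after the set is known to exist. \<open>app\<close> has
  no definability rule, so the comprehension is first rewritten with \<open>ap\<close>, which has
  the same values on the domain.\<close>

lemma countable_increasing_maps: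
  assumes "f \<epsilon> countable_increasing" obtains a where "a \<epsilon> omega1" "maps f a omega1"
proof -
  let ?P = "\<lambda>f. \<exists>a. a \<epsilon> omega1 \<and> maps f a omega1 \<and> (\<forall>b c. b \<epsilon> c \<longrightarrow> c \<epsilon> a \<longrightarrow> app f b \<epsilon> app f c)"
  let ?Q = "\<lambda>f. \<exists>a. a \<epsilon> omega1 \<and> maps f a omega1 \<and> (\<forall>b c. b \<epsilon> c \<longrightarrow> c \<epsilon> a \<longrightarrow> ap f b \<epsilon> ap f c)"
  have "(\<forall>b c. b \<epsilon> c \<longrightarrow> c \<epsilon> a \<longrightarrow> app f b \<epsilon> app f c) \<longleftrightarrow> (\<forall>b c. b \<epsilon> c \<longrightarrow> c \<epsilon> a \<longrightarrow> ap f b \<epsilon> ap f c)"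
    if "a \<epsilon> omega1" "maps f a omega1" for f a
  proof -
    have "app f x = ap f x" if "x \<epsilon> a" for x
      using app_eq_ap that \<open>maps f a omega1\<close> unfolding maps_iff by blast
    moreover have "b \<epsilon> a" if "b \<epsilon> c" "c \<epsilon> a" for b c
      using ordinal_trans that \<open>a \<epsilon> omega1\<close> omega1_iff by blast
    ultimately show ?thesis by auto
  qed
  then have eq: "?P f \<longleftrightarrow> ?Q f" for f by blast
  have "is_set ?P" unfolding eq
  proof (rule is_set_sep[where a = "power_set (prod omega1 omega1)"])
    show "dpred (\<lambda>s. ?Q (s 0))" by (intro definability)
    fix f assume "?Q f"
    then obtain a where a: "a \<epsilon> omega1" "maps f a omega1" by blast
    then show "f \<epsilon> power_set (prod omega1 omega1)"
      using maps_subset_prod[OF a(2)] ordinal_trans[OF ordinal_omega1 _ a(1)] by (auto simp: subset_def prod_iff)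
  qed
  then show ?thesis using assms that unfolding countable_increasing_def by (auto simp: mem_SET)
qed

lemma countable_increasing_bounded:
  assumes countable_choice_reals "f \<epsilon> countable_increasing" shows "bounded f"
proof -
  obtain a where a: "a \<epsilon> omega1" "maps f a omega1" using assms(2) countable_increasing_maps by blast
  \<comment> \<open>Successors are united rather than the values themselves, so that every value is
    an element of the union.\<close>
  have t: "dfun (\<lambda>s. suc (ap f (s 0)))" by (intro definability)
  have "countable a" using a(1) omega1_iff by blast
  moreover have "suc (ap f b) \<epsilon> omega1" if "b \<epsilon> a" for b using a(2) that omega1_suc maps_iff by blast
  ultimately obtain u where u: "u \<epsilon> omega1" "\<And>z. z \<epsilon> u \<longleftrightarrow> (\<exists>b. b \<epsilon> a \<and> z \<epsilon> suc (ap f b))"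
    by (rule countable_UN_omega1[OF assms(1) _ t]) blast+
  have "ap f x \<epsilon> u" if "x \<epsilon> a" for x unfolding u(2) using that by (intro exI[of _ x]) simp
  then have "subset f (prod (un a u) (un a u))"
    using a(2) by (auto simp: subset_def maps_iff mem_fun_on_iff)
  then show ?thesis unfolding bounded_def using omega1_un[OF a(1) u(1)] by blast
qed

text \<open>The least countable ordinal whose square contains \<open>f\<close>, written as an
  intersection so that no bound has to be selected.\<close>

definition bound :: "'a \<Rightarrow> 'a" where
  "bound f = (SET z. z \<epsilon> omega1 \<and> (\<forall>d. d \<epsilon> omega1 \<longrightarrow> subset f (prod d d) \<longrightarrow> z \<epsilon> d))"

lemma dfun_bound: "dfun t \<Longrightarrow> dfun (\<lambda>s. bound (t s))"
  by (rule dfun_subst1) (unfold bound_def, intro definability)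

lemma bound_iff:
  "z \<epsilon> bound f \<longleftrightarrow> z \<epsilon> omega1 \<and> (\<forall>d. d \<epsilon> omega1 \<longrightarrow> subset f (prod d d) \<longrightarrow> z \<epsilon> d)"
  unfolding bound_def by (rule mem_SET, rule is_set_sep[where a = omega1]) (intro definability, simp)

lemma bound:
  assumes "bounded f" shows "bound f \<epsilon> omega1" "subset f (prod (bound f) (bound f))"
proof -
  obtain d where d: "d \<epsilon> omega1" "subset f (prod d d)" using assms bounded_def by blast
  have "ordinal (bound f)"
  proof (rule ordinalI)
    fix x y assume x: "x \<epsilon> bound f" and y: "y \<epsilon> x"
    then have "y \<epsilon> omega1" using bound_iff ordinal_trans[OF ordinal_omega1] by blast
    moreover have "y \<epsilon> d" if "d \<epsilon> omega1" "subset f (prod d d)" for d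
      using x y that bound_iff ordinal_trans omega1_iff by blast
    ultimately show "y \<epsilon> bound f" using bound_iff by blast
  qed (use bound_iff omega1_iff in blast)
  moreover have "countable (bound f)"
    by (rule countable_subset[of _ d]) (use d bound_iff omega1_iff in \<open>auto simp: subset_def\<close>)
  ultimately show "bound f \<epsilon> omega1" using omega1_iff by blast
  show "subset f (prod (bound f) (bound f))" unfolding subset_def
  proof (intro allI impI)
    fix p assume p: "p \<epsilon> f"
    then obtain x y where xy: "x \<epsilon> d" "y \<epsilon> d" "p = opair x y" using d by (auto simp: subset_def prod_iff)
    then have "x \<epsilon> omega1" "y \<epsilon> omega1" using d(1) ordinal_trans[OF ordinal_omega1] by blast+
    moreover have "x \<epsilon> d'" "y \<epsilon> d'" if "subset f (prod d' d')" for d'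
      using that p xy unfolding subset_def by auto
    ultimately show "p \<epsilon> prod (bound f) (bound f)" using xy bound_iff by simp
  qed
qed

lemma bounded_power_set_injects_reals:
  assumes "d \<epsilon> omega1" shows "injects (power_set (prod d d)) reals"
  using assms by (intro power_set_injects_reals countable_prod) (simp_all add: omega1_iff)

definition image2 :: "'a \<Rightarrow> 'a \<Rightarrow> 'a" where
  "image2 c f = (SET q. \<exists>x y. opair x y \<epsilon> f \<and> q = opair (ap c x) (ap c y))"

lemma dfun_image2: "dfun t \<Longrightarrow> dfun u \<Longrightarrow> dfun (\<lambda>s. image2 (t s) (u s))"
  by (rule dfun_subst2) (unfold image2_def, intro definability)

lemma image2_iff:
  assumes "counts c d" "subset f (prod d d)"
  shows "q \<epsilon> image2 c f \<longleftrightarrow> (\<exists>x y. opair x y \<epsilon> f \<and> q = opair (ap c x) (ap c y))"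
  unfolding image2_def
proof (rule mem_SET, rule is_set_sep[where a = "prod omega omega"])
  show "dpred (\<lambda>s. \<exists>x y. opair x y \<epsilon> f \<and> s 0 = opair (ap c x) (ap c y))" by (intro definability)
  fix q assume "\<exists>x y. opair x y \<epsilon> f \<and> q = opair (ap c x) (ap c y)"
  then obtain x y where xy: "opair x y \<epsilon> f" "q = opair (ap c x) (ap c y)" by blast
  then have "opair x y \<epsilon> prod d d" using assms(2) unfolding subset_def by blast
  then show "q \<epsilon> prod omega omega" using xy countsD(1)[OF assms(1)] by simp
qed

text \<open>A code fixes the ordinal and the counting on it, and the counting undoes
  \<open>image2\<close>. Since \<open>d\<close> and \<open>c\<close> are free, one \<open>f\<close>
  can have many codes; this is why the reals are mapped onto the bounded sets and quotients
  appear.\<close>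

lemma reals_onto_bounded:
  obtains K where "dfun (\<lambda>s. K (s 0))" "\<And>f. bounded f \<Longrightarrow> \<exists>x. x \<epsilon> reals \<and> K x = f"
proof -
  let ?W = "power_set (prod omega omega)"
  have "injects (prod ?W ?W) reals"
    by (intro prod_power_set_injects_reals countable_prod countable_omega)
  then obtain e where e: "\<And>p. p \<epsilon> prod ?W ?W \<Longrightarrow> ap e p \<epsilon> reals"
    "\<And>p q. p \<epsilon> prod ?W ?W \<Longrightarrow> q \<epsilon> prod ?W ?W \<Longrightarrow> ap e p = ap e q \<Longrightarrow> p = q"
    by (rule injectsE) blast
  let ?codes = "\<lambda>x f d c. d \<epsilon> omega1 \<and> counts c d \<and> subset f (prod d d) \<and>
      x = ap e (opair (code d c) (image2 c f))"
  let ?K = "\<lambda>x. the_set (\<lambda>f. \<exists>d c. ?codes x f d c)"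
  have in_W: "opair (code d c) (image2 c f) \<epsilon> prod ?W ?W" if "counts c d" "subset f (prod d d)" for d c f
  proof -
    have "subset (image2 c f) (prod omega omega)"
      using that(2) countsD(1)[OF that(1)] unfolding subset_def by (auto simp: image2_iff[OF that])
    then show ?thesis using code_subset[OF that(1)] by simp
  qed
  \<comment> \<open>An inclusion suffices, because the two codings of \<open>x\<close> can be
    exchanged.\<close>
  have le: "p \<epsilon> g" if f: "?codes x f d c" and g: "?codes x g d' c'" and p: "p \<epsilon> f" for x f g d d' c c' p
  proof -
    have "opair (code d c) (image2 c f) = opair (code d' c') (image2 c' g)"
      by (rule e(2)) (use in_W f g in auto)
    then have eq: "code d c = code d' c'" "image2 c f = image2 c' g" by auto
    have "ordinal d" "ordinal d'" using f g omega1_iff by blast+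
    then have "d = d' \<and> (\<forall>u. u \<epsilon> d \<longrightarrow> ap c u = ap c' u)"
      by (intro code_unique) (use f g eq(1) in blast)+
    then have d: "d = d'" "\<And>u. u \<epsilon> d \<Longrightarrow> ap c u = ap c' u" by blast+
    obtain x y where xy: "x \<epsilon> d" "y \<epsilon> d" "p = opair x y" using f p by (auto simp: subset_def prod_iff)
    then have "opair (ap c x) (ap c y) \<epsilon> image2 c f" using image2_iff[of c d f] f p by blast
    then obtain x' y' where xy': "opair x' y' \<epsilon> g" "ap c x = ap c' x'" "ap c y = ap c' y'"
      using eq(2) image2_iff[of c' d' g] g by auto
    have "opair x' y' \<epsilon> prod d' d'" using g xy'(1) unfolding subset_def by blast
    then have x'y': "x' \<epsilon> d'" "y' \<epsilon> d'" by simp_all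
    have c': "counts c' d'" using g by blast
    have "ap c' x = ap c' x'" "ap c' y = ap c' y'" using xy' d(2)[OF xy(1)] d(2)[OF xy(2)] by simp_all
    moreover have "x \<epsilon> d'" "y \<epsilon> d'" using xy d(1) by simp_all
    ultimately have "x = x'" "y = y'" using countsD(2)[OF c'] x'y' by blast+
    then show ?thesis using xy xy' by simp
  qed
  have K: "?K x = f" if "?codes x f d c" for x f d c
  proof (rule the_set_eq)
    show "\<exists>d c. ?codes x f d c" using that by blast
    fix g assume "\<exists>d c. ?codes x g d c"
    then obtain d' c' where g: "?codes x g d' c'" by blast
    show "g = f" by (rule extens) (use le[OF that g] le[OF g that] in blast)
  qed
  have "\<exists>x. x \<epsilon> reals \<and> ?K x = f" if f: "bounded f" for f
  proof -
    obtain d where d: "d \<epsilon> omega1" "subset f (prod d d)" using f bounded_def by blast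
    then obtain c where c: "counts c d" using omega1_iff countable_iff by blast
    let ?x = "ap e (opair (code d c) (image2 c f))"
    have "?x \<epsilon> reals" by (rule e(1)[OF in_W[OF c d(2)]])
    moreover have "?K ?x = f" by (rule K) (use c d in blast)
    ultimately show ?thesis by blast
  qed
  moreover have "dfun (\<lambda>s. ?K (s 0))"
    by (intro definability dpred_counts dfun_code dfun_image2)
  ultimately show ?thesis using that[of ?K] by blast
qed

section \<open>Quotients of the reals and the partition of \<open>X\<close>\<close>

lemma reals_quotient_iff: "c \<epsilon> reals_quotient E \<longleftrightarrow> (\<exists>x. x \<epsilon> reals \<and> c = (SET y. opair x y \<epsilon> E))"
  unfolding reals_quotient_def by (rule mem_SET) (intro is_set_replace definability)

lemma dfun_reals_quotient: "dfun t \<Longrightarrow> dfun (\<lambda>s. reals_quotient (t s))"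
  by (rule dfun_subst1) (unfold reals_quotient_def, intro definability)

lemma is_set_Sigma:
  assumes "dfun (\<lambda>s. t (s 0))" shows "is_set (\<lambda>p. \<exists>a c. a \<epsilon> A \<and> c \<epsilon> t a \<and> p = opair a c)"
proof -
  have "is_set (\<lambda>p. \<exists>a. a \<epsilon> A \<and> p \<epsilon> prod (upair a a) (t a))"
    by (rule is_set_UN) (intro definability assms)
  then show ?thesis by (rule back_subst[of is_set]) (auto simp: prod_iff)
qed

lemma quotients_disjoint_union_iff:
  assumes "fun_on E omega1"
  shows "p \<epsilon> quotients_disjoint_union E \<longleftrightarrow>
    (\<exists>a c. a \<epsilon> omega1 \<and> c \<epsilon> reals_quotient (app E a) \<and> p = opair a c)"
proof -
  have "is_set (\<lambda>p. \<exists>a c. a \<epsilon> omega1 \<and> c \<epsilon> reals_quotient (ap E a) \<and> p = opair a c)"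
    by (rule is_set_Sigma) (intro definability dfun_reals_quotient)
  then have "is_set (\<lambda>p. \<exists>a c. a \<epsilon> omega1 \<and> c \<epsilon> reals_quotient (app E a) \<and> p = opair a c)"
    by (rule back_subst[of is_set]) (use app_eq_ap[OF assms] in auto)
  then show ?thesis unfolding quotients_disjoint_union_def by (rule mem_SET)
qed

text \<open>All reals that do not code an element of the piece \<open>a\<close> of \<open>X\<close> are made to code the
  distinguished element \<open>j a\<close> of that piece.\<close>

lemma bijection_quotients_disjoint_union:
  assumes K: "dfun (\<lambda>s. K (s 0))" and \<pi>: "dfun (\<lambda>s. \<pi> (s 0))" and j: "dfun (\<lambda>s. j (s 0))"
    and onto: "\<And>f. f \<epsilon> X \<Longrightarrow> \<exists>x. x \<epsilon> reals \<and> K x = f"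
    and \<pi>_omega1: "\<And>f. f \<epsilon> X \<Longrightarrow> \<pi> f \<epsilon> omega1"
    and jX: "\<And>a. a \<epsilon> omega1 \<Longrightarrow> j a \<epsilon> X" and \<pi>_j: "\<And>a. a \<epsilon> omega1 \<Longrightarrow> \<pi> (j a) = a"
  obtains E where "fun_on E omega1" "in_bijection X (quotients_disjoint_union E)"
    "\<And>a. a \<epsilon> omega1 \<Longrightarrow> equivalence_on_reals (app E a)"
    "\<And>a. a \<epsilon> omega1 \<Longrightarrow> in_bijection (reals_quotient (app E a)) (SET f. f \<epsilon> X \<and> \<pi> f = a)"
proof -
  define C where "C a x = (if K x \<epsilon> X \<and> \<pi> (K x) = a then K x else j a)" for a x
  have C: "dfun t \<Longrightarrow> dfun u \<Longrightarrow> dfun (\<lambda>s. C (t s) (u s))" for t u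
    unfolding C_def by (intro definability dfun_subst1[OF K] dfun_subst1[OF \<pi>] dfun_subst1[OF j])
  have C_mem: "C a x \<epsilon> X" "\<pi> (C a x) = a" if "a \<epsilon> omega1" for a x using jX[OF that] \<pi>_j[OF that] unfolding C_def by auto
  have C_onto: "\<exists>x. x \<epsilon> reals \<and> C (\<pi> f) x = f" if "f \<epsilon> X" for f using onto[OF that] that unfolding C_def by auto
  define E where "E a = (SET p. \<exists>x y. x \<epsilon> reals \<and> y \<epsilon> reals \<and> C a x = C a y \<and> p = opair x y)" for a
  have dE: "dfun (\<lambda>s. E (s 0))" unfolding E_def by (intro definability C)
  have E: "p \<epsilon> E a \<longleftrightarrow> (\<exists>x y. x \<epsilon> reals \<and> y \<epsilon> reals \<and> C a x = C a y \<and> p = opair x y)" for p a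
    unfolding E_def by (rule mem_SET, rule is_set_sep[where a = "prod reals reals"]) (intro definability C, auto)
  \<comment> \<open>The classes of \<open>E a\<close> are the fibres of \<open>C a\<close>. By
    \<open>C_onto\<close> no fibre over an element of the piece is empty, so the fibre determines
    the element.\<close>
  define cls where "cls a f = (SET y. y \<epsilon> reals \<and> C a y = f)" for a f
  have cls: "y \<epsilon> cls a f \<longleftrightarrow> y \<epsilon> reals \<and> C a y = f" for y a f
    unfolding cls_def by (rule mem_SET, rule is_set_sep[where a = reals]) (intro definability C, blast)
  have d_cls: "dfun t \<Longrightarrow> dfun u \<Longrightarrow> dfun (\<lambda>s. cls (t s) (u s))" for t u
    by (rule dfun_subst2) (unfold cls_def, intro definability C)
  have cls_eq: "(SET y. opair x y \<epsilon> E a) = cls a (C a x)" if "x \<epsilon> reals" for x a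
    by (rule SET_eq) (use that in \<open>auto simp: E cls\<close>)
  have quot: "c \<epsilon> reals_quotient (E a) \<longleftrightarrow> (\<exists>f. f \<epsilon> X \<and> \<pi> f = a \<and> c = cls a f)" if a: "a \<epsilon> omega1" for c a
  proof -
    have "c \<epsilon> reals_quotient (E a) \<longleftrightarrow> (\<exists>x. x \<epsilon> reals \<and> c = cls a (C a x))"
      unfolding reals_quotient_iff using cls_eq by auto
    also have "\<dots> \<longleftrightarrow> (\<exists>f. f \<epsilon> X \<and> \<pi> f = a \<and> c = cls a f)"
      using C_mem[OF a] C_onto by metis
    finally show ?thesis .
  qed
  have cls_inj: "f = g" if f: "f \<epsilon> X" "cls (\<pi> f) f = cls (\<pi> f) g" for f g
  proof -
    obtain x where x: "x \<epsilon> reals" "C (\<pi> f) x = f" using C_onto[OF f(1)] by blast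
    then have "x \<epsilon> cls (\<pi> f) f" using cls by blast
    then have "C (\<pi> f) x = g" unfolding f(2) cls by blast
    then show ?thesis using x by simp
  qed
  have app: "app (lam omega1 E) a = E a" if "a \<epsilon> omega1" for a by (rule app_lam[OF dE that])
  have E_on: "fun_on (lam omega1 E) omega1" by (rule fun_on_lam[OF dE])
  note U = quotients_disjoint_union_iff[OF E_on]
  show ?thesis
  proof (rule that[OF E_on])
    show "in_bijection X (quotients_disjoint_union (lam omega1 E))"
    proof (rule in_bijectionI[where t = "\<lambda>f. opair (\<pi> f) (cls (\<pi> f) f)"])
      show "dfun (\<lambda>s. opair (\<pi> (s 0)) (cls (\<pi> (s 0)) (s 0)))"
        by (intro definability d_cls \<pi>)
      show "opair (\<pi> f) (cls (\<pi> f) f) \<epsilon> quotients_disjoint_union (lam omega1 E)" if "f \<epsilon> X" for f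
        unfolding U using that \<pi>_omega1[OF that] quot[OF \<pi>_omega1[OF that]] app[OF \<pi>_omega1[OF that]] by auto
      show "f = g" if "f \<epsilon> X" "g \<epsilon> X" "opair (\<pi> f) (cls (\<pi> f) f) = opair (\<pi> g) (cls (\<pi> g) g)" for f g
        using cls_inj[of f g] that by auto
      fix p assume "p \<epsilon> quotients_disjoint_union (lam omega1 E)"
      then obtain a c where a: "a \<epsilon> omega1" "c \<epsilon> reals_quotient (E a)" "p = opair a c"
        unfolding U using app by auto
      then obtain f where "f \<epsilon> X" "\<pi> f = a" "c = cls a f" using quot[OF a(1)] by blast
      then show "\<exists>f. f \<epsilon> X \<and> opair (\<pi> f) (cls (\<pi> f) f) = p" using a by blast
    qed
  next
    fix a assume a: "a \<epsilon> omega1"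
    show "equivalence_on_reals (app (lam omega1 E) a)"
      unfolding app[OF a] equivalence_on_reals_def by (intro conjI) (auto simp: E)
    have P: "f \<epsilon> (SET f. f \<epsilon> X \<and> \<pi> f = a) \<longleftrightarrow> f \<epsilon> X \<and> \<pi> f = a" for f
      by (rule mem_SET, rule is_set_sep[where a = X]) (intro definability \<pi>, simp)
    have "in_bijection (SET f. f \<epsilon> X \<and> \<pi> f = a) (reals_quotient (app (lam omega1 E) a))"
    proof (rule in_bijectionI[where t = "cls a"])
      show "dfun (\<lambda>s. cls a (s 0))" by (intro definability d_cls)
    qed (use cls_inj quot[OF a] in \<open>auto simp: P app[OF a]\<close>)
    then show "in_bijection (reals_quotient (app (lam omega1 E) a)) (SET f. f \<epsilon> X \<and> \<pi> f = a)"
      by (rule in_bijection_sym)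
  qed
qed

text \<open>Elements of \<open>X\<close> not assigned to a piece by \<open>Q\<close> go to the piece of their bound.\<close>

lemma ex_quotients:
  assumes K: "dfun (\<lambda>s. K (s 0))" and onto: "\<And>f. bounded f \<Longrightarrow> \<exists>x. x \<epsilon> reals \<and> K x = f"
    and X: "\<And>f. f \<epsilon> X \<Longrightarrow> bounded f"
    and Q: "dpred (\<lambda>s. Q (s 0) (s (Suc 0)))" and Q_omega1: "\<And>f a. Q f a \<Longrightarrow> a \<epsilon> omega1"
    and Q_unique: "\<And>f a b. Q f a \<Longrightarrow> Q f b \<Longrightarrow> a = b"
    and j: "dfun (\<lambda>s. j (s 0))" and jX: "\<And>a. a \<epsilon> omega1 \<Longrightarrow> j a \<epsilon> X"
    and Qj: "\<And>a. a \<epsilon> omega1 \<Longrightarrow> Q (j a) a"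
  obtains E where "fun_on E omega1" "in_bijection X (quotients_disjoint_union E)"
    "\<And>a. a \<epsilon> omega1 \<Longrightarrow> equivalence_on_reals (app E a) \<and>
      (\<exists>P. in_bijection (reals_quotient (app E a)) P \<and>
        (\<forall>f. f \<epsilon> P \<longrightarrow> f \<epsilon> X \<and> (Q f a \<or> subset f (prod a a))) \<and> (\<forall>f. f \<epsilon> X \<longrightarrow> Q f a \<longrightarrow> f \<epsilon> P))"
proof -
  define \<pi> where "\<pi> f = (if \<exists>a. Q f a then the_set (\<lambda>a. Q f a) else bound f)" for f
  have d\<pi>: "dfun (\<lambda>s. \<pi> (s 0))" unfolding \<pi>_def by (intro definability dpred_subst2[OF Q] dfun_bound)
  have \<pi>_Q: "\<pi> f = a" if "Q f a" for f a
  proof -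
    have "the_set (\<lambda>a. Q f a) = a" by (rule the_set_eq) (use that Q_unique in blast)+
    then show ?thesis using that unfolding \<pi>_def by auto
  qed
  have \<pi>_omega1: "\<pi> f \<epsilon> omega1" if "f \<epsilon> X" for f
  proof (cases "\<exists>a. Q f a")
    case True then show ?thesis using \<pi>_Q Q_omega1 by blast
  next
    case False then show ?thesis using bound(1)[OF X[OF that]] unfolding \<pi>_def by auto
  qed
  have piece: "Q f (\<pi> f) \<or> subset f (prod (\<pi> f) (\<pi> f))" if "f \<epsilon> X" for f
  proof (cases "\<exists>a. Q f a")
    case True then show ?thesis using \<pi>_Q by blast
  next
    case False then show ?thesis using bound(2)[OF X[OF that]] unfolding \<pi>_def by auto
  qed
  have P: "f \<epsilon> (SET f. f \<epsilon> X \<and> \<pi> f = a) \<longleftrightarrow> f \<epsilon> X \<and> \<pi> f = a" for f a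
    by (rule mem_SET, rule is_set_sep[where a = X]) (intro definability d\<pi>, blast)
  obtain E where E: "fun_on E omega1" "in_bijection X (quotients_disjoint_union E)"
    "\<And>a. a \<epsilon> omega1 \<Longrightarrow> equivalence_on_reals (app E a)"
    "\<And>a. a \<epsilon> omega1 \<Longrightarrow> in_bijection (reals_quotient (app E a)) (SET f. f \<epsilon> X \<and> \<pi> f = a)"
    by (rule bijection_quotients_disjoint_union[OF K d\<pi> j onto[OF X] \<pi>_omega1 jX \<pi>_Q[OF Qj]]) blast+
  show ?thesis
  proof (rule that[OF E(1,2)], intro conjI exI)
    fix a assume a: "a \<epsilon> omega1"
    show "equivalence_on_reals (app E a)" by (rule E(3)[OF a])
    show "in_bijection (reals_quotient (app E a)) (SET f. f \<epsilon> X \<and> \<pi> f = a)" by (rule E(4)[OF a])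
    show "\<forall>f. f \<epsilon> (SET f. f \<epsilon> X \<and> \<pi> f = a) \<longrightarrow> f \<epsilon> X \<and> (Q f a \<or> subset f (prod a a))"
      using piece unfolding P by blast
    show "\<forall>f. f \<epsilon> X \<longrightarrow> Q f a \<longrightarrow> f \<epsilon> (SET f. f \<epsilon> X \<and> \<pi> f = a)"
      using \<pi>_Q unfolding P by blast
  qed
qed

section \<open>The size of the pieces\<close>

lemma un_injects_reals:
  assumes "injects A reals" "injects B reals" shows "injects (un A B) reals"
proof -
  obtain a where a: "\<And>x. x \<epsilon> A \<Longrightarrow> ap a x \<epsilon> reals"
    "\<And>x y. x \<epsilon> A \<Longrightarrow> y \<epsilon> A \<Longrightarrow> ap a x = ap a y \<Longrightarrow> x = y" using assms(1) by (rule injectsE) blast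
  obtain b where b: "\<And>x. x \<epsilon> B \<Longrightarrow> ap b x \<epsilon> reals"
    "\<And>x y. x \<epsilon> B \<Longrightarrow> y \<epsilon> B \<Longrightarrow> ap b x = ap b y \<Longrightarrow> x = y" using assms(2) by (rule injectsE) blast
  \<comment> \<open>Two distinct constant reals serve as tags inside
    \<open>prod reals reals\<close>, which in turn injects into the reals.\<close>
  define r where "r n = lam omega (\<lambda>_. n)" for n
  have r: "r empty \<epsilon> reals" "r (suc empty) \<epsilon> reals" unfolding r_def by (simp_all add: const_real)
  have "r empty \<noteq> r (suc empty)"
    using ap_lam[OF dfun_const omega_empty, of empty] ap_lam[OF dfun_const omega_empty, of "suc empty"]
    unfolding r_def by auto
  then have "injects (un A B) (prod reals reals)"
    by (intro injectsI[where t = "\<lambda>x. if x \<epsilon> A then opair (r empty) (ap a x) else opair (r (suc empty)) (ap b x)"])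
       ((intro definability)?, auto simp: r a b split: if_splits)
  then show ?thesis using injects_trans prod_reals_injects_reals by blast
qed

theorem weakly_smooth_quotients:
  assumes CC: countable_choice_reals and X: "subset X countable_increasing" and inj: "injects omega1 X"
  shows "\<exists>E. fun_on E omega1 \<and> (\<forall>a. a \<epsilon> omega1 \<longrightarrow> weakly_smooth (app E a)) \<and>
    in_bijection X (quotients_disjoint_union E)"
proof -
  have X_bounded: "bounded f" if "f \<epsilon> X" for f
    using that X countable_increasing_bounded[OF CC] unfolding subset_def by blast
  obtain j where j: "\<And>a. a \<epsilon> omega1 \<Longrightarrow> ap j a \<epsilon> X"
    "\<And>a b. a \<epsilon> omega1 \<Longrightarrow> b \<epsilon> omega1 \<Longrightarrow> ap j a = ap j b \<Longrightarrow> a = b" using inj by (rule injectsE) blast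
  obtain K where K: "dfun (\<lambda>s. K (s 0))" "\<And>f. bounded f \<Longrightarrow> \<exists>x. x \<epsilon> reals \<and> K x = f"
    by (rule reals_onto_bounded) blast
  \<comment> \<open>Only the distinguished element \<open>ap j a\<close> is assigned by hand; every
    other element goes to the piece of its bound.\<close>
  have Q: "dpred (\<lambda>s. s (Suc 0) \<epsilon> omega1 \<and> ap j (s (Suc 0)) = s 0)" by (intro definability)
  have dj: "dfun (\<lambda>s. ap j (s 0))" by (intro definability)
  obtain E where E: "fun_on E omega1" "in_bijection X (quotients_disjoint_union E)"
    "\<And>a. a \<epsilon> omega1 \<Longrightarrow> equivalence_on_reals (app E a) \<and>
      (\<exists>P. in_bijection (reals_quotient (app E a)) P \<and>
        (\<forall>f. f \<epsilon> P \<longrightarrow> f \<epsilon> X \<and> ((a \<epsilon> omega1 \<and> ap j a = f) \<or> subset f (prod a a))) \<and>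
        (\<forall>f. f \<epsilon> X \<longrightarrow> a \<epsilon> omega1 \<and> ap j a = f \<longrightarrow> f \<epsilon> P))"
    by (rule ex_quotients[where K = K and X = X and Q = "\<lambda>f a. a \<epsilon> omega1 \<and> ap j a = f" and j = "ap j"])
       (use K X_bounded Q dj j in blast)+
  have "weakly_smooth (app E a)" if a: "a \<epsilon> omega1" for a
  proof -
    obtain P where P: "in_bijection (reals_quotient (app E a)) P"
      "\<And>f. f \<epsilon> P \<Longrightarrow> f \<epsilon> X \<and> (ap j a = f \<or> subset f (prod a a))" using E(3)[OF a] by blast
    \<comment> \<open>Apart from subsets of \<open>prod a a\<close> the piece holds only
      \<open>ap j a\<close>, so enlarging \<open>a\<close> by one further bound makes the entire
      piece bounded by a single countable ordinal.\<close>
    let ?b = "bound (ap j a)"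
    note b = bound[OF X_bounded[OF j(1)[OF a]]]
    have "f \<epsilon> power_set (prod (un a ?b) (un a ?b))" if "f \<epsilon> P" for f
    proof (cases "ap j a = f")
      case True
      then show ?thesis using b(2) by (auto simp: subset_def prod_iff)
    next
      case False
      then have "subset f (prod a a)" using P(2)[OF that] by blast
      then show ?thesis by (auto simp: subset_def prod_iff)
    qed
    then have "injects P (power_set (prod (un a ?b) (un a ?b)))"
      by (intro injects_subset) (simp add: subset_def[of P])
    then have "injects P reals"
      using injects_trans bounded_power_set_injects_reals[OF omega1_un[OF a b(1)]] by blast
    then have "injects (reals_quotient (app E a)) reals"
      using injects_trans in_bijection_injects[OF P(1)] by blast
    then show ?thesis using E(3)[OF a] unfolding weakly_smooth_def by blast
  qed
  then show ?thesis using E(1,2) by blast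
qed

text \<open>The copy of the reals inside \<open>X\<close> is cut into \<open>omega1\<close> pieces, each containing a copy of the
  reals: the real coding the pair \<open>(x, y)\<close> goes to the ordinal coded by \<open>y\<close>.\<close>

theorem smooth_quotients:
  assumes CC: countable_choice_reals and X: "subset X countable_increasing"
    and inj: "injects (disjoint_sum reals omega1) X"
  shows "\<exists>E. fun_on E omega1 \<and> (\<forall>a. a \<epsilon> omega1 \<longrightarrow> smooth (app E a)) \<and>
    in_bijection X (quotients_disjoint_union E)"
proof -
  have X_bounded: "bounded f" if "f \<epsilon> X" for f
    using that X countable_increasing_bounded[OF CC] unfolding subset_def by blast
  obtain h where h: "\<And>p. p \<epsilon> disjoint_sum reals omega1 \<Longrightarrow> ap h p \<epsilon> X"
    "\<And>p q. p \<epsilon> disjoint_sum reals omega1 \<Longrightarrow> q \<epsilon> disjoint_sum reals omega1 \<Longrightarrow> ap h p = ap h q \<Longrightarrow> p = q"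
    using inj by (rule injectsE) blast
  define i where "i z = ap h (opair empty z)" for z
  define j where "j a = ap h (opair (suc empty) a)" for a
  have sum: "opair empty z \<epsilon> disjoint_sum reals omega1 \<longleftrightarrow> z \<epsilon> reals"
    "opair (suc empty) a \<epsilon> disjoint_sum reals omega1 \<longleftrightarrow> a \<epsilon> omega1" for z a
    by (auto simp: disjoint_sum_iff)
  have i: "i z \<epsilon> X" if "z \<epsilon> reals" for z unfolding i_def using h(1) sum that by blast
  have j: "j a \<epsilon> X" if "a \<epsilon> omega1" for a unfolding j_def using h(1) sum that by blast
  have i_inj: "z = z'" if "z \<epsilon> reals" "z' \<epsilon> reals" "i z = i z'" for z z'
    using h(2)[of "opair empty z" "opair empty z'"] that unfolding i_def sum by simp
  have j_inj: "a = a'" if "a \<epsilon> omega1" "a' \<epsilon> omega1" "j a = j a'" for a a'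
    using h(2)[of "opair (suc empty) a" "opair (suc empty) a'"] that unfolding j_def sum by simp
  have ij: "i z \<noteq> j a" if "z \<epsilon> reals" "a \<epsilon> omega1" for z a
    using h(2)[of "opair empty z" "opair (suc empty) a"] that unfolding i_def j_def sum by auto
  have di: "dfun t \<Longrightarrow> dfun (\<lambda>s. i (t s))" for t
    by (rule dfun_subst1) (unfold i_def, intro definability)
  have dj: "dfun t \<Longrightarrow> dfun (\<lambda>s. j (t s))" for t
    by (rule dfun_subst1) (unfold j_def, intro definability)
  obtain K where K: "dfun (\<lambda>s. K (s 0))" "\<And>f. bounded f \<Longrightarrow> \<exists>x. x \<epsilon> reals \<and> K x = f"
    by (rule reals_onto_bounded) blast
  obtain m where m: "\<And>p. p \<epsilon> prod reals reals \<Longrightarrow> ap m p \<epsilon> reals"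
    "\<And>p q. p \<epsilon> prod reals reals \<Longrightarrow> q \<epsilon> prod reals reals \<Longrightarrow> ap m p = ap m q \<Longrightarrow> p = q"
    using prod_reals_injects_reals by (rule injectsE) blast
  \<comment> \<open>\<open>K\<close> decodes sets of pairs, so the ordinal \<open>a\<close> is
    represented by the bounded set \<open>prod a a\<close>, whose diagonal gives \<open>a\<close>
    back.\<close>
  define good where "good z a \<longleftrightarrow> (\<exists>x y. x \<epsilon> reals \<and> y \<epsilon> reals \<and> z = ap m (opair x y) \<and> K y = prod a a)" for z a
  have good_unique: "a = b" if ga: "good z a" and gb: "good z b" for z a b
  proof -
    obtain x y where xy: "x \<epsilon> reals" "y \<epsilon> reals" "z = ap m (opair x y)" "K y = prod a a"
      using ga unfolding good_def by blast
    obtain x' y' where xy': "x' \<epsilon> reals" "y' \<epsilon> reals" "z = ap m (opair x' y')" "K y' = prod b b"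
      using gb unfolding good_def by blast
    have "y = y'" using m(2)[of "opair x y" "opair x' y'"] xy xy' by simp
    then have eq: "prod a a = prod b b" using xy(4) xy'(4) by simp
    show "a = b"
    proof (rule extens)
      show "u \<epsilon> a \<longleftrightarrow> u \<epsilon> b" for u
        using opair_prod_iff[of u u a a] opair_prod_iff[of u u b b] eq by simp
    qed
  qed
  \<comment> \<open>No element is claimed by two pieces: \<open>i\<close> and \<open>j\<close> are
    injective with disjoint ranges, and \<open>good\<close> determines \<open>a\<close> from
    \<open>z\<close>.\<close>
  define Q where "Q f a \<longleftrightarrow> a \<epsilon> omega1 \<and> (j a = f \<or> (\<exists>z. z \<epsilon> reals \<and> i z = f \<and> good z a))" for f a
  have Q_dpred: "dpred (\<lambda>s. Q (s 0) (s (Suc 0)))"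
    unfolding Q_def good_def by (intro definability di dj dfun_subst1[OF K(1)])
  have Q_unique: "a = b" if "Q f a" "Q f b" for f a b
    using that i_inj j_inj ij good_unique unfolding Q_def by metis
  obtain E where E: "fun_on E omega1" "in_bijection X (quotients_disjoint_union E)"
    "\<And>a. a \<epsilon> omega1 \<Longrightarrow> equivalence_on_reals (app E a) \<and>
      (\<exists>P. in_bijection (reals_quotient (app E a)) P \<and>
        (\<forall>f. f \<epsilon> P \<longrightarrow> f \<epsilon> X \<and> (Q f a \<or> subset f (prod a a))) \<and> (\<forall>f. f \<epsilon> X \<longrightarrow> Q f a \<longrightarrow> f \<epsilon> P))"
  proof (rule ex_quotients[where K = K and X = X and Q = Q and j = j])
    show "dfun (\<lambda>s. j (s 0))" by (intro dj dfun_var)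
    show "Q (j a) a" if "a \<epsilon> omega1" for a using that unfolding Q_def by blast
    show "a \<epsilon> omega1" if "Q f a" for f a using that unfolding Q_def by blast
  qed (use K X_bounded Q_dpred Q_unique j in blast)+
  have "smooth (app E a)" if a: "a \<epsilon> omega1" for a
  proof -
    obtain P where P: "in_bijection (reals_quotient (app E a)) P"
      "\<And>f. f \<epsilon> P \<Longrightarrow> f \<epsilon> X \<and> (Q f a \<or> subset f (prod a a))" "\<And>f. f \<epsilon> X \<Longrightarrow> Q f a \<Longrightarrow> f \<epsilon> P"
      using E(3)[OF a] by blast
    let ?b = "bound (j a)"
    note b = bound[OF X_bounded[OF j[OF a]]]
    \<comment> \<open>Upper bound for the piece: its members lie in the copy \<open>I\<close> of the
      reals, or are \<open>j a\<close>, or are subsets of \<open>prod a a\<close>, and the last two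
      kinds are in \<open>?B\<close>.\<close>
    let ?B = "power_set (prod (un a ?b) (un a ?b))"
    have "is_set (\<lambda>f. \<exists>z. z \<epsilon> reals \<and> f = i z)" by (rule is_set_replace) (intro di dfun_var)
    then obtain I where I: "\<And>f. f \<epsilon> I \<longleftrightarrow> (\<exists>z. z \<epsilon> reals \<and> f = i z)" unfolding is_set_def by blast
    have "in_bijection reals I"
    proof (rule in_bijectionI[where t = i])
      show "dfun (\<lambda>s. i (s 0))" by (intro di dfun_var)
      show "i z \<epsilon> I" if "z \<epsilon> reals" for z unfolding I using that by blast
      show "\<exists>z. z \<epsilon> reals \<and> i z = f" if "f \<epsilon> I" for f using that unfolding I by blast
    qed (rule i_inj)
    then have "injects I reals" by (rule in_bijection_injects[OF in_bijection_sym])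
    moreover have "injects ?B reals" by (rule bounded_power_set_injects_reals[OF omega1_un[OF a b(1)]])
    ultimately have "injects (un I ?B) reals" by (rule un_injects_reals)
    moreover have "f \<epsilon> un I ?B" if f: "f \<epsilon> P" for f
    proof -
      consider "f \<epsilon> I" | "j a = f" | "subset f (prod a a)" using P(2)[OF f] I unfolding Q_def by blast
      then show ?thesis
      proof cases
        case 2 then show ?thesis using b(2) by (auto simp: subset_def prod_iff)
      next
        case 3 then show ?thesis by (auto simp: subset_def prod_iff)
      qed simp
    qed
    then have "injects P (un I ?B)" by (intro injects_subset) (simp add: subset_def[of P])
    ultimately have P_reals: "injects P reals" using injects_trans by blast
    \<comment> \<open>Lower bound: one code \<open>y\<close> of \<open>prod a a\<close> is fixed
      while \<open>x\<close> runs through all reals. The codes need not be chosen uniformly in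
      \<open>a\<close>, because smoothness of each quotient asserts only that some bijection
      exists.\<close>
    have "bounded (prod a a)" unfolding bounded_def subset_def using a by blast
    then obtain y where y: "y \<epsilon> reals" "K y = prod a a" using K(2) by blast
    have "injects reals P"
    proof (rule injectsI[where t = "\<lambda>x. i (ap m (opair x y))"])
      show "dfun (\<lambda>s. i (ap m (opair (s 0) y)))" by (intro di definability)
      fix x assume x: "x \<epsilon> reals"
      then have mx: "ap m (opair x y) \<epsilon> reals" using m(1) y(1) by simp
      moreover have "good (ap m (opair x y)) a" unfolding good_def using x y by blast
      ultimately have "Q (i (ap m (opair x y))) a" unfolding Q_def using a by blast
      then show "i (ap m (opair x y)) \<epsilon> P" using P(3) i[OF mx] by blast
    next
      fix x x' assume x: "x \<epsilon> reals" "x' \<epsilon> reals" and eq: "i (ap m (opair x y)) = i (ap m (opair x' y))"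
      have "ap m (opair x y) = ap m (opair x' y)" by (rule i_inj[OF _ _ eq]) (use m(1) x y(1) in simp)+
      then show "x = x'" using m(2)[of "opair x y" "opair x' y"] x y(1) by simp
    qed
    moreover have "injects (reals_quotient (app E a)) reals"
      by (rule injects_trans[OF in_bijection_injects[OF P(1)] P_reals])
    moreover have "injects P (reals_quotient (app E a))"
      by (rule in_bijection_injects[OF in_bijection_sym[OF P(1)]])
    ultimately have "in_bijection (reals_quotient (app E a)) reals"
      using injects_trans by (intro cantor_bernstein) blast+
    then show ?thesis using E(3)[OF a] unfolding smooth_def by blast
  qed
  then show ?thesis using E(1,2) by blast
qed

text \<open>The ordinals inject through the classes of a fixed real.\<close>

lemma disjoint_sum_injects:
  assumes E: "fun_on E omega1" and smooth: "\<And>a. a \<epsilon> omega1 \<Longrightarrow> smooth (app E a)"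
    and X: "in_bijection X (quotients_disjoint_union E)"
  shows "injects (disjoint_sum reals omega1) X"
proof -
  have "in_bijection reals (reals_quotient (app E empty))"
    using smooth[OF omega1_empty] in_bijection_sym unfolding smooth_def by blast
  then obtain h where h: "\<And>x. x \<epsilon> reals \<Longrightarrow> ap h x \<epsilon> reals_quotient (app E empty)"
    "\<And>x y. x \<epsilon> reals \<Longrightarrow> y \<epsilon> reals \<Longrightarrow> ap h x = ap h y \<Longrightarrow> x = y"
    by (rule in_bijectionE) blast
  define r where "r = lam omega (\<lambda>_. empty)"
  have r: "r \<epsilon> reals" unfolding r_def by (rule const_real) simp
  let ?c = "\<lambda>a. SET y. opair r y \<epsilon> ap E a"
  have c: "?c a \<epsilon> reals_quotient (app E a)" if "a \<epsilon> omega1" for a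
    unfolding reals_quotient_iff app_eq_ap[OF E that] using r by blast
  \<comment> \<open>The reals go into the quotient with index \<open>empty\<close>; moving each
    ordinal up by one keeps that index free for them.\<close>
  let ?t = "\<lambda>p. if pfst p = empty then opair empty (ap h (psnd p)) else opair (suc (psnd p)) (?c (suc (psnd p)))"
  have "injects (disjoint_sum reals omega1) (quotients_disjoint_union E)"
  proof (rule injectsI[where t = ?t])
    show "dfun (\<lambda>s. ?t (s 0))" by (intro definability dfun_pfst dfun_psnd)
    show "?t p \<epsilon> quotients_disjoint_union E" if "p \<epsilon> disjoint_sum reals omega1" for p
      using that h(1) c omega1_suc unfolding disjoint_sum_iff quotients_disjoint_union_iff[OF E] by auto
    show "p = q" if "p \<epsilon> disjoint_sum reals omega1" "q \<epsilon> disjoint_sum reals omega1" "?t p = ?t q" for p q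
      using that h(2) unfolding disjoint_sum_iff by auto
  qed
  then show ?thesis using injects_trans in_bijection_injects[OF in_bijection_sym[OF X]] by blast
qed

end

theorem theorem6p1:
  fixes mem :: "'v \<Rightarrow> 'v \<Rightarrow> bool"
  assumes "eps_structure.ZF mem"
  shows
    "(eps_structure.AD mem \<longrightarrow>
       (\<forall>X. eps_structure.subset mem X (eps_structure.countable_increasing mem) \<longrightarrow>
          eps_structure.injects mem (eps_structure.omega1 mem) X \<longrightarrow>
          (\<exists>E. eps_structure.fun_on mem E (eps_structure.omega1 mem) \<and>
             (\<forall>a. mem a (eps_structure.omega1 mem) \<longrightarrow>
                eps_structure.weakly_smooth mem (eps_structure.app mem E a)) \<and>
             eps_structure.in_bijection mem X (eps_structure.quotients_disjoint_union mem E))))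
     \<and>
     (eps_structure.AD_plus mem \<longrightarrow> eps_structure.V_eq_L_power_reals mem \<longrightarrow>
       (\<forall>X. eps_structure.subset mem X (eps_structure.countable_increasing mem) \<longrightarrow>
          eps_structure.injects mem
            (eps_structure.disjoint_sum mem (eps_structure.reals mem) (eps_structure.omega1 mem)) X \<longrightarrow>
          (\<exists>E. eps_structure.fun_on mem E (eps_structure.omega1 mem) \<and>
             (\<forall>a. mem a (eps_structure.omega1 mem) \<longrightarrow>
                eps_structure.smooth mem (eps_structure.app mem E a)) \<and>
             eps_structure.in_bijection mem X (eps_structure.quotients_disjoint_union mem E))))
     \<and>
     (eps_structure.AD_plus mem \<longrightarrow> eps_structure.V_eq_L_power_reals mem \<longrightarrow>
       (\<forall>X. eps_structure.subset mem X (eps_structure.countable_increasing mem) \<longrightarrow>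
          ((\<exists>E. eps_structure.fun_on mem E (eps_structure.omega1 mem) \<and>
              (\<forall>a. mem a (eps_structure.omega1 mem) \<longrightarrow>
                 eps_structure.smooth mem (eps_structure.app mem E a)) \<and>
              eps_structure.in_bijection mem X (eps_structure.quotients_disjoint_union mem E))
           \<longleftrightarrow>
           eps_structure.injects mem
             (eps_structure.disjoint_sum mem (eps_structure.reals mem) (eps_structure.omega1 mem)) X)))"
proof -
  interpret zf_model mem by (rule zf_model.intro[OF assms])
  have CC: "AD_plus \<Longrightarrow> countable_choice_reals"
    using DC_imp_countable_choice unfolding AD_plus_def by blast
  show ?thesis
  proof (intro conjI impI allI)
    fix X assume AD "subset X countable_increasing" "injects omega1 X"
    then show "\<exists>E. fun_on E omega1 \<and> (\<forall>a. mem a omega1 \<longrightarrow> weakly_smooth (app E a)) \<and>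
        in_bijection X (quotients_disjoint_union E)"
      using weakly_smooth_quotients AD_imp_countable_choice by blast
  next
    fix X assume AD_plus "subset X countable_increasing" "injects (disjoint_sum reals omega1) X"
    then show "\<exists>E. fun_on E omega1 \<and> (\<forall>a. mem a omega1 \<longrightarrow> smooth (app E a)) \<and>
        in_bijection X (quotients_disjoint_union E)"
      using smooth_quotients CC by blast
  next
    fix X assume AD_plus "subset X countable_increasing"
    then show "(\<exists>E. fun_on E omega1 \<and> (\<forall>a. mem a omega1 \<longrightarrow> smooth (app E a)) \<and>
        in_bijection X (quotients_disjoint_union E)) \<longleftrightarrow> injects (disjoint_sum reals omega1) X"
      using smooth_quotients[OF CC] disjoint_sum_injects by blast
  qed
qed

end
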